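(* Inoue surfaces and Kodaira surfaces, seen as quotients of solvable Lie groups endowed with invariant complex structures, do not admit any invariant second-Chern-Einstein metric; that is, no invariant Hermitian metric on them, with associated $(1,1)$-form $\omega$, satisfies $\mathrm{Ric}^{(2)}(\omega)=\lambda\,\omega$ for a real-valued smooth function $\lambda$. On the other hand, Kodaira surfaces admit first-Chern-Ricci-flat metrics, i.e. Hermitian metrics with $\mathrm{Ric}^{(1)}(\omega)=0$.
   Context: The surfaces considered are the compact non-Kähler complex surfaces diffeomorphic to solvmanifolds, i.e. to compact quotients $X=\Gamma\backslash G$ of four-dimensional solvable Lie groups $G$ by discrete subgroups $\Gamma$: Inoue surfaces (of type $S_M$ and $S^{\pm}$) and Kodaira surfaces (primary and secondary). A complex structure or a Hermitian metric on $X$ is called invariant if it is induced by a left-invariant one on $G$. For a Hermitian manifold $(X,J,g)$ with Hermitian structure $h=g-\sqrt{-1}\,\omega$, where $\omega=g(\cdot,J\cdot)$ is the associated $(1,1)$-form, let $(h_{i\bar j})$ be the Hermitian matrix representing $h$ in local holomorphic coordinates $z^j$. The curvature of the Chern connection of the holomorphic tangent bundle (the unique Hermitian connection extending the Cauchy-Riemann operator $\bar\partial$) has components $$\Theta_{i\bar jk\bar\ell}=-\frac{\partial^2 h_{k\bar\ell}}{\partial z^i\partial\bar z^j}+h^{p\bar q}\frac{\partial h_{k\bar q}}{\partial z^i}\frac{\partial h_{p\bar\ell}}{\partial\bar z^j}.$$ The first Chern-Ricci form is $\mathrm{Ric}^{(1)}(\omega)=h^{k\bar\ell}\Theta_{i\bar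 jk\bar\ell}\,\sqrt{-1}\,dz^i\wedge d\bar z^j$, and the second Chern-Ricci form is $\mathrm{Ric}^{(2)}(\omega)=h^{i\bar j}\Theta_{i\bar jk\bar\ell}\,\sqrt{-1}\,dz^k\wedge d\bar z^\ell$. *)

theory Defs
  imports "HOL-Analysis.Analysis" "HOL-Algebra.Bij"
begin

section \<open>Smooth maps\<close>

text \<open>\<open>C\<^sup>n\<close> and \<open>C\<^sup>\<infinity>\<close> maps on an open subset of a Euclidean space.\<close>

fun Ck_on :: "nat \<Rightarrow> 'a::euclidean_space set \<Rightarrow> ('a \<Rightarrow> 'b::real_normed_vector) \<Rightarrow> bool" where
  "Ck_on 0 S f \<longleftrightarrow> continuous_on S f"
| "Ck_on (Suc n) S f \<longleftrightarrow>
     (\<forall>x\<in>S. f differentiable (at x)) \<and> (\<forall>v. Ck_on n S (\<lambda>x. frechet_derivative f (at x) v))"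

definition smooth_on :: "'a::euclidean_space set \<Rightarrow> ('a \<Rightarrow> 'b::real_normed_vector) \<Rightarrow> bool" where
  "smooth_on S f \<longleftrightarrow> (\<forall>n. Ck_on n S f)"

abbreviation tangent_map ::
  "('a::real_normed_vector \<Rightarrow> 'b::real_normed_vector) \<Rightarrow> 'a \<Rightarrow> 'a \<Rightarrow> 'b" where
  "tangent_map f x \<equiv> frechet_derivative f (at x)"


section \<open>The solvable Lie groups\<close>

text \<open>
  A simply connected four-dimensional solvable Lie group is diffeomorphic to \<open>\<real>\<^sup>4\<close>; each group below is
  given by a smooth group law on \<open>real^4\<close>.  Left-invariant vector fields \<open>e\<^sub>1, \<dots>, e\<^sub>4\<close> extending the
  standard basis at the neutral element \<open>0\<close> satisfy the bracket relations stated with each group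
  (all other brackets being zero).
\<close>

definition pt :: "real \<Rightarrow> real \<Rightarrow> real \<Rightarrow> real \<Rightarrow> real^4" where
  "pt x y z t = (\<chi> i. if i = 1 then x else if i = 2 then y else if i = 3 then z else t)"

lemma pt_nth [simp]:
  "pt x y z t $ 1 = x" "pt x y z t $ 2 = y" "pt x y z t $ 3 = z" "pt x y z t $ 4 = t"
  by (simp_all add: pt_def)

lemma pt_eq_iff: "v = w \<longleftrightarrow> v$1 = w$1 \<and> v$2 = w$2 \<and> v$3 = w$3 \<and> v$4 = w$4" for v w :: "real^4"
  by (simp add: vec_eq_iff forall_4)

text \<open>\<open>Nil\<^sup>3 \<times> \<real>\<close>: \<open>[e\<^sub>1,e\<^sub>2] = e\<^sub>3\<close>.\<close>

definition nil3_R :: "(real^4) monoid" where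
  "nil3_R = \<lparr>carrier = UNIV,
     mult = (\<lambda>a b. pt (a$1 + b$1) (a$2 + b$2) (a$3 + b$3 + (a$1 * b$2 - a$2 * b$1) / 2) (a$4 + b$4)),
     one = 0\<rparr>"

text \<open>
  \<open>Nil\<^sup>3 \<rtimes> \<real>\<close> with \<open>\<real>\<close> acting by rotations of the \<open>(x,y)\<close>-plane:
  \<open>[e\<^sub>1,e\<^sub>2] = e\<^sub>3\<close>, \<open>[e\<^sub>4,e\<^sub>1] = e\<^sub>2\<close>, \<open>[e\<^sub>4,e\<^sub>2] = -e\<^sub>1\<close>.
\<close>

definition nil3_rot :: "(real^4) monoid" where
  "nil3_rot = \<lparr>carrier = UNIV,
     mult = (\<lambda>a b.
       let p = cos (a$4) * b$1 - sin (a$4) * b$2;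
           q = sin (a$4) * b$1 + cos (a$4) * b$2
       in pt (a$1 + p) (a$2 + q) (a$3 + b$3 + (a$1 * q - a$2 * p) / 2) (a$4 + b$4)),
     one = 0\<rparr>"

text \<open>
  \<open>\<real>\<^sup>3 \<rtimes> \<real>\<close> with \<open>t\<close> acting on \<open>\<complex> \<times> \<real>\<close> by \<open>exp ((\<alpha> + \<i> \<beta>) t)\<close> and \<open>exp (-2 \<alpha> t)\<close>:
  \<open>[e\<^sub>4,e\<^sub>1] = \<alpha> e\<^sub>1 + \<beta> e\<^sub>2\<close>, \<open>[e\<^sub>4,e\<^sub>2] = -\<beta> e\<^sub>1 + \<alpha> e\<^sub>2\<close>, \<open>[e\<^sub>4,e\<^sub>3] = -2 \<alpha> e\<^sub>3\<close>.
\<close>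

definition sol0 :: "real \<Rightarrow> real \<Rightarrow> (real^4) monoid" where
  "sol0 \<alpha> \<beta> = \<lparr>carrier = UNIV,
     mult = (\<lambda>a b. pt
       (a$1 + exp (\<alpha> * a$4) * (cos (\<beta> * a$4) * b$1 - sin (\<beta> * a$4) * b$2))
       (a$2 + exp (\<alpha> * a$4) * (sin (\<beta> * a$4) * b$1 + cos (\<beta> * a$4) * b$2))
       (a$3 + exp (- 2 * \<alpha> * a$4) * b$3)
       (a$4 + b$4)),
     one = 0\<rparr>"

text \<open>
  \<open>Nil\<^sup>3 \<rtimes> \<real>\<close> with hyperbolic action:
  \<open>[e\<^sub>1,e\<^sub>2] = e\<^sub>3\<close>, \<open>[e\<^sub>4,e\<^sub>1] = e\<^sub>1\<close>, \<open>[e\<^sub>4,e\<^sub>2] = -e\<^sub>2\<close>.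
\<close>

definition sol1 :: "(real^4) monoid" where
  "sol1 = \<lparr>carrier = UNIV,
     mult = (\<lambda>a b.
       let p = exp (a$4) * b$1;
           q = exp (- a$4) * b$2
       in pt (a$1 + p) (a$2 + q) (a$3 + b$3 + (a$1 * q - a$2 * p) / 2) (a$4 + b$4)),
     one = 0\<rparr>"

text \<open>The automorphism of \<^const>\<open>sol1\<close> by which surfaces of type \<open>S\<^sup>-\<close> differ from those of type \<open>S\<^sup>+\<close>.\<close>

definition sol1_flip :: "real^4 \<Rightarrow> real^4" where
  "sol1_flip a = pt (a$1) (- a$2) (- a$3) (a$4)"

lemma group_nil3_R: "group nil3_R"
proof (rule groupI)
  fix a assume "a \<in> carrier nil3_R"
  show "\<exists>b\<in>carrier nil3_R. b \<otimes>\<^bsub>nil3_R\<^esub> a = \<one>\<^bsub>nil3_R\<^esub>"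
    by (rule bexI[of _ "- a"]) (simp_all add: nil3_R_def pt_eq_iff)
qed (auto simp: nil3_R_def pt_eq_iff field_simps)

lemma group_nil3_rot: "group nil3_rot"
proof (rule groupI)
  fix a assume "a \<in> carrier nil3_rot"
  let ?b = "pt (- (cos (a$4) * a$1 + sin (a$4) * a$2))
               (sin (a$4) * a$1 - cos (a$4) * a$2) (- a$3) (- a$4)"
  show "\<exists>b\<in>carrier nil3_rot. b \<otimes>\<^bsub>nil3_rot\<^esub> a = \<one>\<^bsub>nil3_rot\<^esub>"
    by (rule bexI[of _ ?b]) (simp_all add: nil3_rot_def pt_eq_iff Let_def algebra_simps)
next
  fix a b c
  have sc0: "sin x * sin x = 1 - cos x * cos x" for x :: real
    using sin_cos_squared_add[of x] by (simp add: power2_eq_square)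
  have sc: "sin x * (sin x * y) = y - cos x * (cos x * y)" for x y :: real
    unfolding mult.assoc[symmetric] sc0 by (simp add: algebra_simps)
  show "a \<otimes>\<^bsub>nil3_rot\<^esub> b \<otimes>\<^bsub>nil3_rot\<^esub> c = a \<otimes>\<^bsub>nil3_rot\<^esub> (b \<otimes>\<^bsub>nil3_rot\<^esub> c)"
    by (simp add: nil3_rot_def pt_eq_iff Let_def sin_add cos_add field_simps sc sc0)
qed (auto simp: nil3_rot_def pt_eq_iff Let_def)

lemma group_sol0: "group (sol0 \<alpha> \<beta>)"
proof (rule groupI)
  fix a assume "a \<in> carrier (sol0 \<alpha> \<beta>)"
  let ?b = "pt (- exp (- \<alpha> * a$4) * (cos (\<beta> * a$4) * a$1 + sin (\<beta> * a$4) * a$2))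
               (exp (- \<alpha> * a$4) * (sin (\<beta> * a$4) * a$1 - cos (\<beta> * a$4) * a$2))
               (- exp (2 * \<alpha> * a$4) * a$3) (- a$4)"
  show "\<exists>b\<in>carrier (sol0 \<alpha> \<beta>). b \<otimes>\<^bsub>sol0 \<alpha> \<beta>\<^esub> a = \<one>\<^bsub>sol0 \<alpha> \<beta>\<^esub>"
    by (rule bexI[of _ ?b]) (simp_all add: sol0_def pt_eq_iff algebra_simps)
qed (auto simp: sol0_def pt_eq_iff sin_add cos_add exp_add distrib_left distrib_right
       algebra_simps exp_diff exp_minus divide_inverse)

lemma group_sol1: "group sol1"
proof (rule groupI)
  fix a assume "a \<in> carrier sol1"
  let ?b = "pt (- exp (- a$4) * a$1) (- exp (a$4) * a$2) (- a$3) (- a$4)"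
  show "\<exists>b\<in>carrier sol1. b \<otimes>\<^bsub>sol1\<^esub> a = \<one>\<^bsub>sol1\<^esub>"
    by (rule bexI[of _ ?b]) (simp_all add: sol1_def pt_eq_iff Let_def algebra_simps)
qed (auto simp: sol1_def pt_eq_iff Let_def field_simps exp_add exp_diff exp_minus)

lemma sol1_flip_hom: "sol1_flip (a \<otimes>\<^bsub>sol1\<^esub> b) = sol1_flip a \<otimes>\<^bsub>sol1\<^esub> sol1_flip b"
  by (simp add: sol1_flip_def sol1_def pt_eq_iff Let_def field_simps)


section \<open>Compact quotients and tensors on them\<close>

text \<open>
  A compact quotient \<open>X\<close> is represented by its universal cover \<open>G\<close>, a group with underlying manifold
  \<open>real^4\<close>, together with the group \<open>D\<close> of deck transformations; functions and tensors
  on \<open>X\<close> are the \<open>D\<close>-invariant functions and tensors on \<open>G\<close>.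
\<close>

abbreviation left_translation :: "('a, 'm) monoid_scheme \<Rightarrow> 'a \<Rightarrow> 'a \<Rightarrow> 'a" where
  "left_translation G a \<equiv> (\<lambda>x. a \<otimes>\<^bsub>G\<^esub> x)"

definition left_translations :: "(real^4) monoid \<Rightarrow> (real^4 \<Rightarrow> real^4) set" where
  "left_translations G = range (left_translation G)"

definition cocompact_discrete_subgroup :: "(real^4) monoid \<Rightarrow> (real^4) set \<Rightarrow> bool" where
  "cocompact_discrete_subgroup G \<Gamma> \<longleftrightarrow>
     subgroup \<Gamma> G \<and> discrete \<Gamma> \<and>
     (\<exists>K. compact K \<and> (\<Union>\<gamma>\<in>\<Gamma>. left_translation G \<gamma> ` K) = UNIV)"

definition solvmanifold :: "(real^4) monoid \<Rightarrow> (real^4 \<Rightarrow> real^4) set \<Rightarrow> bool" where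
  "solvmanifold G D \<longleftrightarrow>
     (\<exists>\<Gamma>. cocompact_discrete_subgroup G \<Gamma> \<and> D = left_translation G ` \<Gamma>)"

text \<open>
  The gluing map \<open>(w,z) \<mapsto> (c w, -z)\<close> of an Inoue surface of type \<open>S\<^sup>-\<close> acts on the group as a left
  translation composed with the automorphism \<^const>\<open>sol1_flip\<close>, so the deck group is not contained
  in the left translations; its translations form a subgroup of index two, whose quotient is the
  double cover of type \<open>S\<^sup>+\<close>.
\<close>

definition flip_solvmanifold :: "(real^4 \<Rightarrow> real^4) set \<Rightarrow> bool" where
  "flip_solvmanifold D \<longleftrightarrow>
     subgroup D (BijGroup UNIV) \<and>
     D \<subseteq> left_translations sol1 \<union> (\<lambda>L. L \<circ> sol1_flip) ` left_translations sol1 \<and>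
     \<not> D \<subseteq> left_translations sol1 \<and>
     (\<forall>\<gamma>\<in>D. \<gamma> \<noteq> id \<longrightarrow> (\<forall>x. \<gamma> x \<noteq> x)) \<and>
     cocompact_discrete_subgroup sol1 {a. left_translation sol1 a \<in> D}"

type_synonym endo_field = "real^4 \<Rightarrow> real^4 \<Rightarrow> real^4"
type_synonym metric_field = "real^4 \<Rightarrow> real^4 \<Rightarrow> real^4 \<Rightarrow> real"

definition function_invariant :: "(real^4 \<Rightarrow> real^4) set \<Rightarrow> (real^4 \<Rightarrow> real) \<Rightarrow> bool" where
  "function_invariant T f \<longleftrightarrow> (\<forall>\<gamma>\<in>T. \<forall>x. f (\<gamma> x) = f x)"

definition endo_invariant :: "(real^4 \<Rightarrow> real^4) set \<Rightarrow> endo_field \<Rightarrow> bool" where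
  "endo_invariant T J \<longleftrightarrow>
     (\<forall>\<gamma>\<in>T. \<forall>x v. J (\<gamma> x) (tangent_map \<gamma> x v) = tangent_map \<gamma> x (J x v))"

definition metric_invariant :: "(real^4 \<Rightarrow> real^4) set \<Rightarrow> metric_field \<Rightarrow> bool" where
  "metric_invariant T g \<longleftrightarrow>
     (\<forall>\<gamma>\<in>T. \<forall>x u v. g (\<gamma> x) (tangent_map \<gamma> x u) (tangent_map \<gamma> x v) = g x u v)"


section \<open>Complex structures and Hermitian metrics\<close>

text \<open>
  Holomorphic coordinates are given by the inverse \<open>\<psi>\<close> of a chart, a local parametrization by an
  open subset of \<open>\<complex>\<^sup>2\<close>.
\<close>

definition holomorphic_parametrization ::
  "endo_field \<Rightarrow> (complex^2) set \<Rightarrow> (complex^2 \<Rightarrow> real^4) \<Rightarrow> bool" where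
  "holomorphic_parametrization J V \<psi> \<longleftrightarrow>
     open V \<and> inj_on \<psi> V \<and> open (\<psi> ` V) \<and> smooth_on V \<psi> \<and> smooth_on (\<psi> ` V) (inv_into V \<psi>) \<and>
     (\<forall>z\<in>V. \<forall>v. tangent_map \<psi> z (\<i> *s v) = J (\<psi> z) (tangent_map \<psi> z v))"

definition complex_structure :: "endo_field \<Rightarrow> bool" where
  "complex_structure J \<longleftrightarrow>
     (\<forall>x. linear (J x)) \<and> (\<forall>x v. J x (J x v) = - v) \<and> (\<forall>v. smooth_on UNIV (\<lambda>x. J x v)) \<and>
     (\<forall>x. \<exists>V \<psi>. holomorphic_parametrization J V \<psi> \<and> x \<in> \<psi> ` V)"

definition invariant_complex_structure ::
  "(real^4) monoid \<Rightarrow> (real^4 \<Rightarrow> real^4) set \<Rightarrow> endo_field \<Rightarrow> bool" where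
  "invariant_complex_structure G D J \<longleftrightarrow>
     complex_structure J \<and> endo_invariant D J \<and> endo_invariant (left_translations G) J"

definition hermitian_metric ::
  "(real^4 \<Rightarrow> real^4) set \<Rightarrow> endo_field \<Rightarrow> metric_field \<Rightarrow> bool" where
  "hermitian_metric D J g \<longleftrightarrow>
     (\<forall>x. bilinear (g x)) \<and> (\<forall>x u v. g x u v = g x v u) \<and> (\<forall>x u. u \<noteq> 0 \<longrightarrow> g x u u > 0) \<and>
     (\<forall>u v. smooth_on UNIV (\<lambda>x. g x u v)) \<and>
     (\<forall>x u v. g x (J x u) (J x v) = g x u v) \<and>
     metric_invariant D g"

definition invariant_hermitian_metric ::
  "(real^4) monoid \<Rightarrow> (real^4 \<Rightarrow> real^4) set \<Rightarrow> endo_field \<Rightarrow> metric_field \<Rightarrow> bool" where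
  "invariant_hermitian_metric G D J g \<longleftrightarrow>
     hermitian_metric D J g \<and> metric_invariant (left_translations G) g"


section \<open>Inoue and Kodaira surfaces\<close>

definition inoue_surface_SM ::
  "(real^4) monoid \<Rightarrow> (real^4 \<Rightarrow> real^4) set \<Rightarrow> endo_field \<Rightarrow> bool" where
  "inoue_surface_SM G D J \<longleftrightarrow>
     (\<exists>\<alpha> \<beta>. \<alpha> \<noteq> 0 \<and> G = sol0 \<alpha> \<beta>) \<and> solvmanifold G D \<and> invariant_complex_structure G D J"

definition inoue_surface_S_plus ::
  "(real^4) monoid \<Rightarrow> (real^4 \<Rightarrow> real^4) set \<Rightarrow> endo_field \<Rightarrow> bool" where
  "inoue_surface_S_plus G D J \<longleftrightarrow>
     G = sol1 \<and> solvmanifold G D \<and> invariant_complex_structure G D J"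

definition inoue_surface_S_minus ::
  "(real^4) monoid \<Rightarrow> (real^4 \<Rightarrow> real^4) set \<Rightarrow> endo_field \<Rightarrow> bool" where
  "inoue_surface_S_minus G D J \<longleftrightarrow>
     G = sol1 \<and> flip_solvmanifold D \<and> invariant_complex_structure G D J"

definition inoue_surface ::
  "(real^4) monoid \<Rightarrow> (real^4 \<Rightarrow> real^4) set \<Rightarrow> endo_field \<Rightarrow> bool" where
  "inoue_surface G D J \<longleftrightarrow>
     inoue_surface_SM G D J \<or> inoue_surface_S_plus G D J \<or> inoue_surface_S_minus G D J"

text \<open>
  A lattice of \<^const>\<open>nil3_rot\<close> whose rotation angles are all multiples of \<open>2 \<pi>\<close> yields a primary
  Kodaira surface again.
\<close>

definition kodaira_surface ::
  "(real^4) monoid \<Rightarrow> (real^4 \<Rightarrow> real^4) set \<Rightarrow> endo_field \<Rightarrow> bool" where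
  "kodaira_surface G D J \<longleftrightarrow>
     (G = nil3_R \<or> G = nil3_rot) \<and> solvmanifold G D \<and> invariant_complex_structure G D J"


section \<open>Chern-Ricci forms\<close>

definition omega :: "endo_field \<Rightarrow> metric_field \<Rightarrow> metric_field" where
  "omega J g x u v = g x u (J x v)"

definition herm :: "endo_field \<Rightarrow> metric_field \<Rightarrow> real^4 \<Rightarrow> real^4 \<Rightarrow> real^4 \<Rightarrow> complex" where
  "herm J g x u v = of_real (g x u v) - \<i> * of_real (omega J g x u v)"

text \<open>
  With \<open>\<omega> = g(\<cdot>, J \<cdot>)\<close>, the form \<open>h = g - \<i> \<omega>\<close> is complex antilinear in its first and linear in its
  second argument, so that the matrix with \<open>h = \<Sum> h\<^sub>k\<^sub>l dz\<^sub>k d\<bar>z\<^sub>l\<close>, linear in \<open>k\<close> and antilinear in \<open>l\<close>,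
  takes the coordinate vector \<open>\<partial>\<^sub>l\<close> in the first and \<open>\<partial>\<^sub>k\<close> in the second argument.
\<close>

definition herm_matrix ::
  "endo_field \<Rightarrow> metric_field \<Rightarrow> (complex^2 \<Rightarrow> real^4) \<Rightarrow> complex^2 \<Rightarrow> complex^2^2" where
  "herm_matrix J g \<psi> z =
     (\<chi> k l. herm J g (\<psi> z) (tangent_map \<psi> z (axis l 1)) (tangent_map \<psi> z (axis k 1)))"

definition dz :: "2 \<Rightarrow> (complex^2 \<Rightarrow> complex) \<Rightarrow> complex^2 \<Rightarrow> complex" where
  "dz i f z = (tangent_map f z (axis i 1) - \<i> * tangent_map f z (axis i \<i>)) / 2"

definition dzbar :: "2 \<Rightarrow> (complex^2 \<Rightarrow> complex) \<Rightarrow> complex^2 \<Rightarrow> complex" where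
  "dzbar i f z = (tangent_map f z (axis i 1) + \<i> * tangent_map f z (axis i \<i>)) / 2"

text \<open>\<open>h\<^sup>k\<^sup>l\<close> with \<open>\<Sum>\<^sub>l h\<^sup>k\<^sup>l h\<^sub>m\<^sub>l = \<delta>\<^sub>k\<^sub>m\<close>, i.e. the transpose of the inverse matrix.\<close>

definition herm_inverse :: "(complex^2 \<Rightarrow> complex^2^2) \<Rightarrow> complex^2 \<Rightarrow> complex^2^2" where
  "herm_inverse H z = transpose (matrix_inv (H z))"

definition chern_curvature ::
  "(complex^2 \<Rightarrow> complex^2^2) \<Rightarrow> complex^2 \<Rightarrow> 2 \<Rightarrow> 2 \<Rightarrow> 2 \<Rightarrow> 2 \<Rightarrow> complex" where
  "chern_curvature H z i j k l =
     - dz i (dzbar j (\<lambda>w. H w $ k $ l)) z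
     + (\<Sum>p\<in>UNIV. \<Sum>q\<in>UNIV. herm_inverse H z $ p $ q *
          dz i (\<lambda>w. H w $ k $ q) z * dzbar j (\<lambda>w. H w $ p $ l) z)"

definition ricci1_matrix :: "(complex^2 \<Rightarrow> complex^2^2) \<Rightarrow> complex^2 \<Rightarrow> complex^2^2" where
  "ricci1_matrix H z =
     (\<chi> i j. \<Sum>k\<in>UNIV. \<Sum>l\<in>UNIV. herm_inverse H z $ k $ l * chern_curvature H z i j k l)"

definition ricci2_matrix :: "(complex^2 \<Rightarrow> complex^2^2) \<Rightarrow> complex^2 \<Rightarrow> complex^2^2" where
  "ricci2_matrix H z =
     (\<chi> k l. \<Sum>i\<in>UNIV. \<Sum>j\<in>UNIV. herm_inverse H z $ i $ j * chern_curvature H z i j k l)"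

text \<open>The value on real tangent vectors \<open>u\<close>, \<open>v\<close> of the form \<open>\<i> \<Sum> R\<^sub>i\<^sub>j dz\<^sub>i \<and> d\<bar>z\<^sub>j\<close>.\<close>

definition form11 :: "complex^2^2 \<Rightarrow> complex^2 \<Rightarrow> complex^2 \<Rightarrow> complex" where
  "form11 R u v =
     \<i> * (\<Sum>i\<in>UNIV. \<Sum>j\<in>UNIV. R $ i $ j * (u $ i * cnj (v $ j) - v $ i * cnj (u $ j)))"

definition first_chern_ricci_flat :: "endo_field \<Rightarrow> metric_field \<Rightarrow> bool" where
  "first_chern_ricci_flat J g \<longleftrightarrow>
     (\<forall>V \<psi>. holomorphic_parametrization J V \<psi> \<longrightarrow>
       (\<forall>z\<in>V. \<forall>u v. form11 (ricci1_matrix (herm_matrix J g \<psi>) z) u v = 0))"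

definition second_chern_einstein ::
  "(real^4 \<Rightarrow> real^4) set \<Rightarrow> endo_field \<Rightarrow> metric_field \<Rightarrow> bool" where
  "second_chern_einstein D J g \<longleftrightarrow>
     (\<exists>lam::real^4 \<Rightarrow> real. smooth_on UNIV lam \<and> function_invariant D lam \<and>
       (\<forall>V \<psi>. holomorphic_parametrization J V \<psi> \<longrightarrow>
         (\<forall>z\<in>V. \<forall>u v. form11 (ricci2_matrix (herm_matrix J g \<psi>) z) u v =
            of_real (lam (\<psi> z) *
              omega J g (\<psi> z) (tangent_map \<psi> z u) (tangent_map \<psi> z v)))))"

end

theory Submission
  imports Defs
begin

text \<open>
  All four group laws have affine left translations.  A left-invariant vector field is therefore
  \<open>x \<mapsto> E x v\<close>, with \<open>E x\<close> the linear part of the translation by \<open>x\<close>, and invariant tensors are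
  determined by their values at \<open>0\<close>.  In a holomorphic chart these fields become maps into \<open>\<complex>\<^sup>2\<close> which
  are complex linear in \<open>v\<close> with respect to \<open>J\<close>, and the \<open>\<partial>\<close>-bar derivative of the field of \<open>v\<close> along that
  of \<open>u\<close> is again an invariant field: the one of \<open>([u,v] + J [J u,v]) / 2\<close> (\<open>dbar_coord_field\<close>).

  Let \<open>Z\<^sub>1, Z\<^sub>2\<close> be an invariant unitary frame, and let the matrices \<open>A\<^sub>b\<close>, with entry \<open>A b c a\<close> in
  row \<open>c\<close> and column \<open>a\<close>, express the \<open>\<partial>\<close>-bar derivative of \<open>Z\<^sub>a\<close> in the direction conjugate to \<open>Z\<^sub>b\<close> as
  \<open>\<Sum>\<^sub>c A b c a Z\<^sub>c\<close>.  They are constant, so the Chern curvature is an algebraic expression in them,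
  \<open>[A\<^sub>e, A\<^sub>a\<^sup>*] - \<Sum>\<^sub>d (A e d a \<cdot> A\<^sub>d\<^sup>* + cnj (A a d e) \<cdot> A\<^sub>d)\<close> (\<open>frame_curvature\<close>).  In the proof, the unknown
  \<open>(1,0)\<close>-derivatives of the frame, which depend on the chart, cancel.

  What remains is linear algebra.  Integrability of \<open>J\<close>, which comes from the existence of charts,
  is strong enough to find in each group a unitary frame \<open>u, w\<close> in which all \<open>A\<^sub>b\<close> are upper triangular:
  for the groups with one-dimensional center \<open>\<langle>e\<^sub>3\<rangle>\<close>, and for \<open>Nil\<^sup>3 \<times> \<real>\<close>, the vector \<open>u\<close> is a multiple of
  \<open>e\<^sub>3\<close>; for \<open>\<real>\<^sup>3 \<rtimes> \<real>\<close> it lies in the plane \<open>\<langle>e\<^sub>1, e\<^sub>2\<rangle>\<close>, which must be a complex line.  For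
  \<open>A\<^sub>1 = (0, n; 0, m)\<close> and \<open>A\<^sub>2 = (\<kappa>, s; 0, t)\<close> the two diagonal entries of the second Chern-Ricci form
  differ by \<open>2 (|n|\<^sup>2 + |s|\<^sup>2 + |t|\<^sup>2 + Re (cnj s \<cdot> m) - Re (cnj t \<cdot> \<kappa>))\<close>, whereas the Einstein equation at a
  single point makes them equal (\<open>not_second_chern_einstein\<close>).  The difference is positive in all
  cases: for \<open>\<real>\<^sup>3 \<rtimes> \<real>\<close> because \<open>n = m = 0\<close> and \<open>Re (cnj t \<cdot> \<kappa>) < 0\<close> (\<open>sol0_frame\<close>), for the hyperbolic
  extension of \<open>Nil\<^sup>3\<close> because \<open>m = \<kappa> = 0\<close> and \<open>n \<noteq> 0\<close> (\<open>sol1_frame\<close>), and for the Kodaira groups because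
  \<open>\<kappa> = 0\<close>, \<open>Re (cnj s \<cdot> m) + |t|\<^sup>2 = 0\<close> and \<open>s \<noteq> 0\<close> (\<open>kodaira_frame\<close>).

  For the Kodaira groups the same data satisfy \<open>n \<cdot> cnj m + m \<cdot> cnj t = 0\<close>, and these two identities say
  exactly that the first Chern-Ricci form vanishes.  Hence every invariant Hermitian metric on them is
  first-Chern-Ricci-flat, and such a metric exists: average an inner product over \<open>J\<close> at the neutral
  element and translate it.
\<close>

section \<open>Calculus of smooth maps\<close>

text \<open>
  The second difference of \<open>f\<close> over the parallelogram spanned by \<open>h u\<close> and \<open>h v\<close> does not change when
  \<open>u\<close> and \<open>v\<close> are exchanged, and the mean value theorem in both directions expresses it by a mixed
  derivative at a nearby point.  Exchanging the roles gives the symmetry of second derivatives.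
\<close>

lemma second_difference_mvt:
  fixes f :: "'a::euclidean_space \<Rightarrow> real"
  assumes B: "ball x r \<subseteq> S" and h: "0 < h" "h * (norm u + norm v) < r"
    and f: "\<And>y. y \<in> S \<Longrightarrow> f differentiable (at y)"
    and fu: "\<And>y. y \<in> S \<Longrightarrow> (\<lambda>z. tangent_map f z u) differentiable (at y)"
  shows "\<exists>p. dist x p \<le> h * (norm u + norm v) \<and>
    f (x + h *\<^sub>R u + h *\<^sub>R v) - f (x + h *\<^sub>R u) - f (x + h *\<^sub>R v) + f x
      = h * h * tangent_map (\<lambda>z. tangent_map f z u) p v"
proof -
  have bound: "dist x (x + s *\<^sub>R u + t *\<^sub>R v) \<le> h * (norm u + norm v)"
    if "0 \<le> s" "s \<le> h" "0 \<le> t" "t \<le> h" for s t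
  proof -
    have "norm (s *\<^sub>R u + t *\<^sub>R v) \<le> s * norm u + t * norm v"
      using norm_triangle_ineq[of "s *\<^sub>R u" "t *\<^sub>R v"] that by simp
    also have "\<dots> \<le> h * norm u + h * norm v"
      using that by (intro add_mono mult_right_mono) auto
    finally show ?thesis
      using norm_minus_cancel[of "s *\<^sub>R u + t *\<^sub>R v"]
      by (simp add: dist_norm distrib_left add.assoc[symmetric] del: norm_minus_cancel) 
  qed
  have inS: "x + s *\<^sub>R u + t *\<^sub>R v \<in> S" if "0 \<le> s" "s \<le> h" "0 \<le> t" "t \<le> h" for s t
    using bound[OF that] h(2) B by auto
  define G where "G s = f (x + s *\<^sub>R u + h *\<^sub>R v) - f (x + s *\<^sub>R u + 0 *\<^sub>R v)" for s
  define G' where "G' s = tangent_map f (x + s *\<^sub>R u + h *\<^sub>R v) u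
      - tangent_map f (x + s *\<^sub>R u + 0 *\<^sub>R v) u" for s
  have dF: "((\<lambda>s. f (x + s *\<^sub>R u + t *\<^sub>R v)) has_real_derivative
      tangent_map f (x + s *\<^sub>R u + t *\<^sub>R v) u) (at s)"
    if "0 \<le> s" "s \<le> h" "0 \<le> t" "t \<le> h" for s t
  proof -
    have D: "(f has_derivative tangent_map f (x + s *\<^sub>R u + t *\<^sub>R v)) (at (x + s *\<^sub>R u + t *\<^sub>R v))"
      using f[OF inS[OF that]] frechet_derivative_works by blast
    have g: "((\<lambda>s. x + s *\<^sub>R u + t *\<^sub>R v) has_derivative (\<lambda>s. s *\<^sub>R u)) (at s)"
      by (auto intro!: derivative_eq_intros)
    have "tangent_map f (x + s *\<^sub>R u + t *\<^sub>R v) (a *\<^sub>R u)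
        = tangent_map f (x + s *\<^sub>R u + t *\<^sub>R v) u * a" for a
      using linear_cmul[OF has_derivative_linear[OF D]] by simp
    with has_derivative_compose[OF g D] show ?thesis
      by (simp add: has_field_derivative_def)
  qed
  have "\<exists>\<xi>. \<xi> > 0 \<and> \<xi> < h \<and> G h - G 0 = (h - 0) * G' \<xi>"
  proof (rule MVT2[OF h(1)])
    fix s assume "0 \<le> s" "s \<le> h"
    with h(1) show "(G has_real_derivative G' s) (at s)"
      unfolding G_def G'_def by (intro DERIV_diff dF) auto
  qed
  then obtain \<xi> where \<xi>: "0 < \<xi>" "\<xi> < h" "G h - G 0 = h * G' \<xi>" by auto
  define K where "K t = tangent_map f (x + \<xi> *\<^sub>R u + t *\<^sub>R v) u" for t
  define K' where "K' t = tangent_map (\<lambda>z. tangent_map f z u) (x + \<xi> *\<^sub>R u + t *\<^sub>R v) v" for t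
  have "\<exists>\<eta>. \<eta> > 0 \<and> \<eta> < h \<and> K h - K 0 = (h - 0) * K' \<eta>"
  proof (rule MVT2[OF h(1)])
    fix t assume t: "0 \<le> t" "t \<le> h"
    let ?y = "x + \<xi> *\<^sub>R u + t *\<^sub>R v" and ?F = "\<lambda>z. tangent_map f z u"
    have D: "(?F has_derivative tangent_map ?F ?y) (at ?y)"
      using fu[OF inS[of \<xi> t]] frechet_derivative_works \<xi> t by force
    have g: "((\<lambda>t. x + \<xi> *\<^sub>R u + t *\<^sub>R v) has_derivative (\<lambda>t. t *\<^sub>R v)) (at t)"
      by (auto intro!: derivative_eq_intros)
    have "tangent_map ?F ?y (a *\<^sub>R v) = tangent_map ?F ?y v * a" for a
      using linear_cmul[OF has_derivative_linear[OF D]] by simp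
    with has_derivative_compose[OF g D] show "(K has_real_derivative K' t) (at t)"
      by (simp add: has_field_derivative_def K_def[abs_def] K'_def)
  qed
  then obtain \<eta> where \<eta>: "0 < \<eta>" "\<eta> < h" "K h - K 0 = h * K' \<eta>" by auto
  have "G' \<xi> = K h - K 0" by (simp add: G'_def K_def)
  with \<xi> \<eta> have "G h - G 0 = h * h * K' \<eta>" by simp
  with bound[of \<xi> \<eta>] \<xi> \<eta> show ?thesis
    by (intro exI[of _ "x + \<xi> *\<^sub>R u + \<eta> *\<^sub>R v"]) (auto simp: G_def K'_def)
qed

lemma symmetric_second_derivative_real:
  fixes f :: "'a::euclidean_space \<Rightarrow> real"
  assumes S: "open S" "x \<in> S" and f: "Ck_on 2 S f"
  shows "tangent_map (\<lambda>z. tangent_map f z u) x v = tangent_map (\<lambda>z. tangent_map f z v) x u"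
proof -
  define P where "P u v y = tangent_map (\<lambda>z. tangent_map f z u) y v" for u v y
  have f1: "f differentiable (at y)" if "y \<in> S" for y using f that by (simp add: numeral_2_eq_2)
  have f2: "(\<lambda>z. tangent_map f z u) differentiable (at y)" if "y \<in> S" for y u
    using f that by (simp add: numeral_2_eq_2)
  have cont: "isCont (P u v) x" for u v
    using f S by (simp add: numeral_2_eq_2 P_def[abs_def] continuous_on_eq_continuous_at)
  obtain r where r: "r > 0" "ball x r \<subseteq> S" using S openE by blast
  have "\<bar>P u v x - P v u x\<bar> \<le> 2 * e" if "e > 0" for e
  proof -
    obtain d where d: "d > 0" "\<And>y. dist y x < d \<Longrightarrow> dist (P u v y) (P u v x) < e"
      using cont[of u v] \<open>e > 0\<close> unfolding continuous_at_eps_delta by (auto simp: dist_norm)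
    obtain d' where d': "d' > 0" "\<And>y. dist y x < d' \<Longrightarrow> dist (P v u y) (P v u x) < e"
      using cont[of v u] \<open>e > 0\<close> unfolding continuous_at_eps_delta by (auto simp: dist_norm)
    define m where "m = min r (min d d')"
    define h where "h = m / (norm u + norm v + 1)"
    have m: "m > 0" using r d d' by (simp add: m_def)
    have den: "norm u + norm v + 1 > 0" by (simp add: add_nonneg_pos)
    have h0: "h > 0" using m den by (simp add: h_def)
    have hm: "h * (norm u + norm v) < m"
      using m den by (simp add: h_def field_simps)
    from hm have hm': "h * (norm v + norm u) < m" by (simp add: add.commute)
    have mr: "m \<le> r" "m \<le> d" "m \<le> d'" by (auto simp: m_def)
    obtain p where p: "dist x p \<le> h * (norm u + norm v)"
      "f (x + h *\<^sub>R u + h *\<^sub>R v) - f (x + h *\<^sub>R u) - f (x + h *\<^sub>R v) + f x = h * h * P u v p"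
      using second_difference_mvt[OF r(2) h0 less_le_trans[OF hm mr(1)] f1 f2] unfolding P_def by blast
    obtain q where q: "dist x q \<le> h * (norm v + norm u)"
      "f (x + h *\<^sub>R v + h *\<^sub>R u) - f (x + h *\<^sub>R v) - f (x + h *\<^sub>R u) + f x = h * h * P v u q"
      using second_difference_mvt[OF r(2) h0 less_le_trans[OF hm' mr(1)] f1 f2] unfolding P_def by blast
    have swap: "x + h *\<^sub>R u + h *\<^sub>R v = x + h *\<^sub>R v + h *\<^sub>R u" by simp
    have "h * h * P u v p = h * h * P v u q"
      using p(2) q(2) unfolding swap by linarith
    with h0 have eq: "P u v p = P v u q" by simp
    have "dist p x < d" "dist q x < d'"
      using p(1) q(1) hm hm' mr by (auto simp: dist_commute)
    with d d' eq show ?thesis by (force simp: dist_real_def)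
  qed
  from field_le_epsilon[of "\<bar>P u v x - P v u x\<bar>" 0] this[of "_ / 2"]
  have "\<bar>P u v x - P v u x\<bar> \<le> 0" by simp
  then show ?thesis by (simp add: P_def)
qed

lemma Ck_on_SucD: "Ck_on (Suc n) S f \<Longrightarrow> Ck_on n S f"
proof (induction n arbitrary: f)
  case 0
  then show ?case
    by (simp add: continuous_at_imp_continuous_on differentiable_imp_continuous_within)
qed auto

lemma Ck_on_has_derivative:
  assumes "Ck_on (Suc n) S f" "x \<in> S"
  shows "(f has_derivative tangent_map f x) (at x)"
  using assms frechet_derivative_works by auto

lemma Ck_on_cong:
  assumes "open S" "\<And>x. x \<in> S \<Longrightarrow> f x = g x" "Ck_on n S f"
  shows "Ck_on n S g"
  using assms(2-)
proof (induction n arbitrary: f g)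
  case 0
  then show ?case by (simp cong: continuous_on_cong)
next
  case (Suc n)
  have D: "(g has_derivative tangent_map f x) (at x)" if "x \<in> S" for x
    using has_derivative_transform_within_open[OF Ck_on_has_derivative[OF Suc.prems(2) that]
        assms(1) that] Suc.prems(1) by blast
  have eq: "tangent_map g x = tangent_map f x" if "x \<in> S" for x
    using frechet_derivative_at[OF D[OF that]] by simp
  have "Ck_on n S (\<lambda>x. tangent_map g x v)" for v
    using Suc.IH[of "\<lambda>x. tangent_map f x v"] Suc.prems eq by auto
  then show ?case using D by (auto simp: differentiable_def)
qed

lemma Ck_on_subset: "Ck_on n S f \<Longrightarrow> T \<subseteq> S \<Longrightarrow> Ck_on n T f"
  by (induction n arbitrary: f) (auto intro: continuous_on_subset)

lemma Ck_on_const: "Ck_on n S (\<lambda>x. c)"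
  by (induction n arbitrary: c) auto

text \<open>
  The derivative given here need not be syntactically \<^const>\<open>frechet_derivative\<close>; this is the way
  in which all closure properties below enter the recursion defining \<^const>\<open>Ck_on\<close>.
\<close>

lemma Ck_on_SucI:
  assumes "open S" "\<And>x. x \<in> S \<Longrightarrow> (f has_derivative f' x) (at x)"
    "\<And>v. Ck_on n S (\<lambda>x. f' x v)"
  shows "Ck_on (Suc n) S f"
proof -
  have eq: "tangent_map f x = f' x" if "x \<in> S" for x
    using frechet_derivative_at[OF assms(2)[OF that]] by simp
  have "Ck_on n S (\<lambda>x. tangent_map f x v)" for v
    by (rule Ck_on_cong[OF assms(1) _ assms(3)[of v]]) (simp add: eq)
  then show ?thesis using assms(2) by (auto simp: differentiable_def)
qed

lemma Ck_on_bounded_linear: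
  assumes "open S" "bounded_linear L" "Ck_on n S f"
  shows "Ck_on n S (\<lambda>x. L (f x))"
  using assms(3)
proof (induction n arbitrary: f)
  case 0
  then show ?case
    using assms(2) linear_continuous_on bounded_linear.continuous_on by auto
next
  case (Suc n)
  show ?case
  proof (rule Ck_on_SucI[OF assms(1)])
    show "((\<lambda>x. L (f x)) has_derivative (\<lambda>v. L (tangent_map f x v))) (at x)" if "x \<in> S" for x
      by (rule bounded_linear.has_derivative[OF assms(2) Ck_on_has_derivative[OF Suc.prems that]])
  qed (use Suc in auto)
qed

lemma Ck_on_add:
  assumes "open S" "Ck_on n S f" "Ck_on n S g"
  shows "Ck_on n S (\<lambda>x. f x + g x)"
  using assms(2-)
proof (induction n arbitrary: f g)
  case 0
  then show ?case by (auto intro: continuous_on_add)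
next
  case (Suc n)
  show ?case
  proof (rule Ck_on_SucI[OF assms(1)])
    show "((\<lambda>x. f x + g x) has_derivative (\<lambda>v. tangent_map f x v + tangent_map g x v)) (at x)"
      if "x \<in> S" for x
      by (intro has_derivative_add Ck_on_has_derivative[OF Suc.prems(1) that]
            Ck_on_has_derivative[OF Suc.prems(2) that])
  qed (use Suc in auto)
qed

lemma Ck_on_sum:
  assumes "open S" "finite I" "\<And>i. i \<in> I \<Longrightarrow> Ck_on n S (f i)"
  shows "Ck_on n S (\<lambda>x. \<Sum>i\<in>I. f i x)"
  using assms(2,3) by (induction I) (auto intro: Ck_on_add[OF assms(1)] Ck_on_const)

lemma Ck_on_bilinear:
  assumes "open S" "bounded_bilinear B" "Ck_on n S f" "Ck_on n S g"
  shows "Ck_on n S (\<lambda>x. B (f x) (g x))"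
  using assms(3-)
proof (induction n arbitrary: f g)
  case 0
  then show ?case using bounded_bilinear.continuous_on[OF assms(2)] by auto
next
  case (Suc n)
  show ?case
  proof (rule Ck_on_SucI[OF assms(1)])
    show "((\<lambda>x. B (f x) (g x)) has_derivative
        (\<lambda>v. B (f x) (tangent_map g x v) + B (tangent_map f x v) (g x))) (at x)" if "x \<in> S" for x
      by (intro bounded_bilinear.FDERIV[OF assms(2)] Ck_on_has_derivative[OF Suc.prems(1) that]
            Ck_on_has_derivative[OF Suc.prems(2) that])
    show "Ck_on n S (\<lambda>x. B (f x) (tangent_map g x v) + B (tangent_map f x v) (g x))" for v
      using Suc.prems by (intro Ck_on_add[OF assms(1)] Suc.IH) (auto dest: Ck_on_SucD simp del: Ck_on.simps(2), auto)
  qed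
qed

text \<open>
  Differentiability of order \<open>n\<close> is assumed only along fixed directions; this expansion reduces moving
  directions, as they occur in the chain rule and for vector fields, to fixed ones.
\<close>

lemma linear_euclidean_expansion:
  fixes L :: "'a::euclidean_space \<Rightarrow> 'b::real_normed_vector"
  assumes "linear L"
  shows "L w = (\<Sum>b\<in>Basis. (w \<bullet> b) *\<^sub>R L b)"
proof -
  have "L w = L (\<Sum>b\<in>Basis. (w \<bullet> b) *\<^sub>R b)" by (simp add: euclidean_representation)
  also have "\<dots> = (\<Sum>b\<in>Basis. (w \<bullet> b) *\<^sub>R L b)"
    by (simp add: linear_sum[OF assms] linear_cmul[OF assms])
  finally show ?thesis .
qed

lemma Ck_on_compose:
  fixes f :: "'a::euclidean_space \<Rightarrow> 'b::euclidean_space" and g :: "'b \<Rightarrow> 'c::real_normed_vector"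
  assumes "open S" "open T" "f ` S \<subseteq> T" "Ck_on n S f" "Ck_on n T g"
  shows "Ck_on n S (\<lambda>x. g (f x))"
  using assms(4-)
proof (induction n arbitrary: g)
  case 0
  then show ?case using assms(3) by (auto intro: continuous_on_compose2)
next
  case (Suc n)
  show ?case
  proof (rule Ck_on_SucI[OF assms(1)])
    fix x assume x: "x \<in> S"
    then have fx: "f x \<in> T" using assms(3) by auto
    have "((\<lambda>x. g (f x)) has_derivative (\<lambda>v. tangent_map g (f x) (tangent_map f x v))) (at x)"
      using has_derivative_compose[OF Ck_on_has_derivative[OF Suc.prems(1) x]
          Ck_on_has_derivative[OF Suc.prems(2) fx]] .
    moreover have "(\<Sum>b\<in>Basis. (w \<bullet> b) *\<^sub>R tangent_map g (f x) b) = tangent_map g (f x) w" for w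
      by (intro sym[OF linear_euclidean_expansion]
          has_derivative_linear[OF Ck_on_has_derivative[OF Suc.prems(2) fx]])
    ultimately show "((\<lambda>x. g (f x)) has_derivative
        (\<lambda>v. \<Sum>b\<in>Basis. (tangent_map f x v \<bullet> b) *\<^sub>R tangent_map g (f x) b)) (at x)"
      by simp
  next
    fix v
    have f: "Ck_on n S f" using Suc.prems(1) by (rule Ck_on_SucD)
    show "Ck_on n S (\<lambda>x. \<Sum>b\<in>Basis. (tangent_map f x v \<bullet> b) *\<^sub>R tangent_map g (f x) b)"
    proof (rule Ck_on_sum[OF assms(1)], simp, rule Ck_on_bilinear[OF assms(1) bounded_bilinear_scaleR])
      show "Ck_on n S (\<lambda>x. tangent_map f x v \<bullet> b)" for b
        using Suc.prems(1) by (auto intro: Ck_on_bounded_linear[OF assms(1) bounded_linear_inner_left])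
      show "Ck_on n S (\<lambda>x. tangent_map g (f x) b)" for b
        using Suc.prems(2) f by (intro Suc.IH) auto
    qed
  qed
qed

lemma smooth_on_cong: "open S \<Longrightarrow> (\<And>x. x \<in> S \<Longrightarrow> f x = g x) \<Longrightarrow> smooth_on S f \<Longrightarrow> smooth_on S g"
  using Ck_on_cong[of S f g] by (auto simp: smooth_on_def)

lemma smooth_on_subset: "smooth_on S f \<Longrightarrow> T \<subseteq> S \<Longrightarrow> smooth_on T f"
  unfolding smooth_on_def using Ck_on_subset by blast

lemma smooth_on_const: "smooth_on S (\<lambda>x. c)"
  by (simp add: smooth_on_def Ck_on_const)

lemma smooth_on_bounded_linear:
  "open S \<Longrightarrow> bounded_linear L \<Longrightarrow> smooth_on S f \<Longrightarrow> smooth_on S (\<lambda>x. L (f x))"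
  by (simp add: smooth_on_def Ck_on_bounded_linear)

lemma smooth_on_id: "open S \<Longrightarrow> smooth_on S (\<lambda>x. x)"
  unfolding smooth_on_def
proof
  fix n assume "open S" then show "Ck_on n S (\<lambda>x. x)"
    by (cases n) (auto simp: Ck_on_const)
qed

lemma smooth_on_add:
  "open S \<Longrightarrow> smooth_on S f \<Longrightarrow> smooth_on S g \<Longrightarrow> smooth_on S (\<lambda>x. f x + g x)"
  by (simp add: smooth_on_def Ck_on_add)

lemma smooth_on_sum:
  "open S \<Longrightarrow> finite I \<Longrightarrow> (\<And>i. i \<in> I \<Longrightarrow> smooth_on S (f i)) \<Longrightarrow> smooth_on S (\<lambda>x. \<Sum>i\<in>I. f i x)"
  by (simp add: smooth_on_def Ck_on_sum)

lemma smooth_on_bilinear: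
  "open S \<Longrightarrow> bounded_bilinear B \<Longrightarrow> smooth_on S f \<Longrightarrow> smooth_on S g \<Longrightarrow>
    smooth_on S (\<lambda>x. B (f x) (g x))"
  by (simp add: smooth_on_def Ck_on_bilinear)

lemma smooth_on_compose:
  fixes f :: "'a::euclidean_space \<Rightarrow> 'b::euclidean_space"
  shows "open S \<Longrightarrow> open T \<Longrightarrow> f ` S \<subseteq> T \<Longrightarrow> smooth_on S f \<Longrightarrow> smooth_on T g \<Longrightarrow>
    smooth_on S (\<lambda>x. g (f x))"
  unfolding smooth_on_def using Ck_on_compose[of S T f _ g] by blast

lemma smooth_on_has_derivative:
  "smooth_on S f \<Longrightarrow> x \<in> S \<Longrightarrow> (f has_derivative tangent_map f x) (at x)"
  using Ck_on_has_derivative unfolding smooth_on_def by blast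

lemma smooth_on_linear_tangent_map: "smooth_on S f \<Longrightarrow> x \<in> S \<Longrightarrow> linear (tangent_map f x)"
  using smooth_on_has_derivative has_derivative_linear by blast

lemma smooth_on_tangent_map: "smooth_on S f \<Longrightarrow> smooth_on S (\<lambda>x. tangent_map f x v)"
  unfolding smooth_on_def using Ck_on.simps(2) by blast

lemma smooth_on_tangent_map_field:
  fixes f :: "'a::euclidean_space \<Rightarrow> 'b::real_normed_vector" and X :: "'a \<Rightarrow> 'a"
  assumes "open S" "smooth_on S f" "smooth_on S X"
  shows "smooth_on S (\<lambda>x. tangent_map f x (X x))"
proof (rule smooth_on_cong[OF assms(1)])
  show "smooth_on S (\<lambda>x. \<Sum>b\<in>Basis. (X x \<bullet> b) *\<^sub>R tangent_map f x b)"
    by (rule smooth_on_sum[OF assms(1)], simp,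
        rule smooth_on_bilinear[OF assms(1) bounded_bilinear_scaleR
          smooth_on_bounded_linear[OF assms(1) bounded_linear_inner_left assms(3)]
          smooth_on_tangent_map[OF assms(2)]])
  show "(\<Sum>b\<in>Basis. (X x \<bullet> b) *\<^sub>R tangent_map f x b) = tangent_map f x (X x)" if "x \<in> S" for x
    by (rule linear_euclidean_expansion[OF smooth_on_linear_tangent_map[OF assms(2) that], symmetric])
qed

lemma tangent_map_eqI: "(f has_derivative f') (at x) \<Longrightarrow> tangent_map f x = f'"
  using frechet_derivative_at by metis

lemma tangent_map_cong:
  assumes "open S" "x \<in> S" "\<And>y. y \<in> S \<Longrightarrow> f y = g y" "smooth_on S f"
  shows "tangent_map f x = tangent_map g x"
  using tangent_map_eqI[OF has_derivative_transform_within_open[OF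
      smooth_on_has_derivative[OF assms(4,2)] assms(1,2)], of g] assms(3) by simp

lemma symmetric_second_derivative:
  fixes f :: "'a::euclidean_space \<Rightarrow> 'b::euclidean_space"
  assumes S: "open S" "x \<in> S" and f: "smooth_on S f"
  shows "tangent_map (\<lambda>z. tangent_map f z u) x v = tangent_map (\<lambda>z. tangent_map f z v) x u"
proof (rule euclidean_eqI)
  fix b :: 'b assume "b \<in> Basis"
  have comp: "tangent_map (\<lambda>z. h z \<bullet> b) y = (\<lambda>w. tangent_map h y w \<bullet> b)"
    if "smooth_on S h" "y \<in> S" for h :: "'a \<Rightarrow> 'b" and y
    by (intro tangent_map_eqI has_derivative_inner_left smooth_on_has_derivative[OF that])
  have fb: "smooth_on S (\<lambda>z. f z \<bullet> b)"
    by (rule smooth_on_bounded_linear[OF S(1) bounded_linear_inner_left f])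
  have "tangent_map (\<lambda>z. tangent_map f z u) x v \<bullet> b
      = tangent_map (\<lambda>z. tangent_map (\<lambda>z. f z \<bullet> b) z u) x v" for u v
  proof -
    have "tangent_map (\<lambda>z. tangent_map f z u) x v \<bullet> b = tangent_map (\<lambda>z. tangent_map f z u \<bullet> b) x v"
      using comp[OF smooth_on_tangent_map[OF f] S(2)] by simp
    also have "\<dots> = tangent_map (\<lambda>z. tangent_map (\<lambda>z. f z \<bullet> b) z u) x v"
    proof (rule fun_cong[OF tangent_map_cong[OF S]])
      show "tangent_map f y u \<bullet> b = tangent_map (\<lambda>z. f z \<bullet> b) y u" if "y \<in> S" for y
        by (simp only: comp[OF f that])
      show "smooth_on S (\<lambda>z. tangent_map f z u \<bullet> b)"
        by (rule smooth_on_bounded_linear[OF S(1) bounded_linear_inner_left smooth_on_tangent_map[OF f]])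
    qed
    finally show ?thesis .
  qed
  with symmetric_second_derivative_real[OF S, of "\<lambda>z. f z \<bullet> b" u v] fb
  show "tangent_map (\<lambda>z. tangent_map f z u) x v \<bullet> b = tangent_map (\<lambda>z. tangent_map f z v) x u \<bullet> b"
    unfolding smooth_on_def by simp
qed

lemma tangent_map_along_field:
  fixes f :: "'a::euclidean_space \<Rightarrow> 'b::real_normed_vector" and X :: "'a \<Rightarrow> 'a"
  assumes S: "open S" "x \<in> S" and f: "smooth_on S f" and X: "smooth_on S X"
  shows "tangent_map (\<lambda>y. tangent_map f y (X y)) x w
    = tangent_map (\<lambda>y. tangent_map f y (X x)) x w + tangent_map f x (tangent_map X x w)"
proof -
  note expand = linear_euclidean_expansion[OF smooth_on_linear_tangent_map[OF f]]
  have D: "tangent_map (\<lambda>y. tangent_map f y (Y y)) x w =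
     (\<Sum>b\<in>Basis. (Y x \<bullet> b) *\<^sub>R tangent_map (\<lambda>y. tangent_map f y b) x w) +
     tangent_map f x (tangent_map Y x w)" if Y: "smooth_on S Y" for Y
  proof -
    have "((\<lambda>y. \<Sum>b\<in>Basis. (Y y \<bullet> b) *\<^sub>R tangent_map f y b) has_derivative
       (\<lambda>w. \<Sum>b\<in>Basis. (Y x \<bullet> b) *\<^sub>R tangent_map (\<lambda>y. tangent_map f y b) x w
          + (tangent_map Y x w \<bullet> b) *\<^sub>R tangent_map f x b)) (at x)"
      by (rule has_derivative_sum, rule has_derivative_scaleR,
          rule has_derivative_inner_left[OF smooth_on_has_derivative[OF Y S(2)]],
          rule smooth_on_has_derivative[OF smooth_on_tangent_map[OF f] S(2)])
    then have "((\<lambda>y. tangent_map f y (Y y)) has_derivative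
       (\<lambda>w. \<Sum>b\<in>Basis. (Y x \<bullet> b) *\<^sub>R tangent_map (\<lambda>y. tangent_map f y b) x w
          + (tangent_map Y x w \<bullet> b) *\<^sub>R tangent_map f x b)) (at x)"
      by (rule has_derivative_transform_within_open[OF _ S]) (rule expand[symmetric])
    from fun_cong[OF tangent_map_eqI[OF this], of w] expand[OF S(2), of "tangent_map Y x w"]
    show ?thesis by (simp only: sum.distrib)
  qed
  have "tangent_map (\<lambda>y. tangent_map f y (X x)) x w
      = (\<Sum>b\<in>Basis. (X x \<bullet> b) *\<^sub>R tangent_map (\<lambda>y. tangent_map f y b) x w)"
    using D[OF smooth_on_const[of S "X x"]] linear_0[OF smooth_on_linear_tangent_map[OF f S(2)]]
    by simp
  with D[OF X] show ?thesis by (simp only:)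
qed

section \<open>Wirtinger derivatives\<close>

lemma smooth_on_mult:
  fixes F G :: "'a::euclidean_space \<Rightarrow> 'b::real_normed_algebra"
  shows "open S \<Longrightarrow> smooth_on S F \<Longrightarrow> smooth_on S G \<Longrightarrow> smooth_on S (\<lambda>x. F x * G x)"
  by (rule smooth_on_bilinear[OF _ bounded_bilinear_mult])

lemma smooth_on_cnj: "open S \<Longrightarrow> smooth_on S F \<Longrightarrow> smooth_on S (\<lambda>x. cnj (F x))"
  by (rule smooth_on_bounded_linear[OF _ bounded_linear_cnj])

lemma smooth_on_nth: "open S \<Longrightarrow> smooth_on S F \<Longrightarrow> smooth_on S (\<lambda>x. F x $ k)"
  by (rule smooth_on_bounded_linear[OF _ bounded_linear_vec_nth])

lemma smooth_on_dz: "open S \<Longrightarrow> smooth_on S F \<Longrightarrow> smooth_on S (dz i F)"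
proof -
  assume S: "open S" and F: "smooth_on S F"
  have "smooth_on S (\<lambda>z. (1/2) * tangent_map F z (axis i 1) + (- \<i> / 2) * tangent_map F z (axis i \<i>))"
    by (intro smooth_on_add smooth_on_mult smooth_on_const smooth_on_tangent_map S F)
  then show ?thesis
    by (rule smooth_on_cong[OF S, rotated]) (simp add: dz_def field_simps)
qed

lemma smooth_on_dzbar: "open S \<Longrightarrow> smooth_on S F \<Longrightarrow> smooth_on S (dzbar i F)"
proof -
  assume S: "open S" and F: "smooth_on S F"
  have "smooth_on S (\<lambda>z. (1/2) * tangent_map F z (axis i 1) + (\<i> / 2) * tangent_map F z (axis i \<i>))"
    by (intro smooth_on_add smooth_on_mult smooth_on_const smooth_on_tangent_map S F)
  then show ?thesis
    by (rule smooth_on_cong[OF S, rotated]) (simp add: dzbar_def field_simps)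
qed

context
  fixes S :: "(complex^2) set" and z
  assumes S: "open S" "z \<in> S"
begin

lemma tangent_map_add:
  "smooth_on S F \<Longrightarrow> smooth_on S G \<Longrightarrow>
    tangent_map (\<lambda>w. F w + G w) z = (\<lambda>v. tangent_map F z v + tangent_map G z v)"
  by (intro tangent_map_eqI has_derivative_add smooth_on_has_derivative[OF _ S(2)])

lemma tangent_map_mult:
  fixes F G :: "complex^2 \<Rightarrow> complex"
  shows "smooth_on S F \<Longrightarrow> smooth_on S G \<Longrightarrow>
    tangent_map (\<lambda>w. F w * G w) z = (\<lambda>v. F z * tangent_map G z v + tangent_map F z v * G z)"
  by (intro tangent_map_eqI has_derivative_mult smooth_on_has_derivative[OF _ S(2)])

lemma tangent_map_bounded_linear:
  "bounded_linear L \<Longrightarrow> smooth_on S F \<Longrightarrow> tangent_map (\<lambda>w. L (F w)) z = (\<lambda>v. L (tangent_map F z v))"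
  by (rule tangent_map_eqI[OF bounded_linear.has_derivative[OF _ smooth_on_has_derivative[OF _ S(2)]]])

lemma dz_add: "smooth_on S F \<Longrightarrow> smooth_on S G \<Longrightarrow> dz i (\<lambda>w. F w + G w) z = dz i F z + dz i G z"
  and dzbar_add: "smooth_on S F \<Longrightarrow> smooth_on S G \<Longrightarrow>
    dzbar i (\<lambda>w. F w + G w) z = dzbar i F z + dzbar i G z"
  by (simp_all add: dz_def dzbar_def tangent_map_add field_simps)

lemma dz_mult: "smooth_on S F \<Longrightarrow> smooth_on S G \<Longrightarrow>
    dz i (\<lambda>w. F w * G w) z = dz i F z * G z + F z * dz i G z"
  and dzbar_mult: "smooth_on S F \<Longrightarrow> smooth_on S G \<Longrightarrow>
    dzbar i (\<lambda>w. F w * G w) z = dzbar i F z * G z + F z * dzbar i G z"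
  by (simp_all add: dz_def dzbar_def tangent_map_mult field_simps)

lemma dz_cnj: "smooth_on S F \<Longrightarrow> dz i (\<lambda>w. cnj (F w)) z = cnj (dzbar i F z)"
  by (simp add: dz_def dzbar_def tangent_map_bounded_linear[OF bounded_linear_cnj])

lemma dz_cong: "(\<And>w. w \<in> S \<Longrightarrow> F w = G w) \<Longrightarrow> smooth_on S F \<Longrightarrow> dz i F z = dz i G z"
  and dzbar_cong: "(\<And>w. w \<in> S \<Longrightarrow> F w = G w) \<Longrightarrow> smooth_on S F \<Longrightarrow> dzbar i F z = dzbar i G z"
  using tangent_map_cong[OF S, of F G] by (simp_all add: dz_def dzbar_def)

lemma dz_dzbar_commute:
  assumes F: "smooth_on S F"
  shows "dz i (dzbar j F) z = dzbar j (dz i F) z"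
proof -
  let ?T = "\<lambda>v w. tangent_map F w v"
  have T: "smooth_on S (?T v)" for v by (rule smooth_on_tangent_map[OF F])
  have lin: "tangent_map (\<lambda>w. a * ?T u w + b * ?T v w) z x
      = a * tangent_map (?T u) z x + b * tangent_map (?T v) z x" for a b u v x
    using tangent_map_bounded_linear[OF bounded_linear_mult_right T, of a u]
      tangent_map_bounded_linear[OF bounded_linear_mult_right T, of b v]
    by (simp add: tangent_map_add smooth_on_mult[OF S(1) smooth_on_const T])
  have e: "dz i F = (\<lambda>w. (1/2) * ?T (axis i 1) w + (- \<i> / 2) * ?T (axis i \<i>) w)"
    "dzbar j F = (\<lambda>w. (1/2) * ?T (axis j 1) w + (\<i> / 2) * ?T (axis j \<i>) w)"
    by (auto simp: fun_eq_iff dz_def dzbar_def field_simps)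
  note sym = symmetric_second_derivative[OF S F]
  have "dz i (dzbar j F) z = 1/4 * (tangent_map (?T (axis j 1)) z (axis i 1)
      + \<i> * tangent_map (?T (axis j \<i>)) z (axis i 1)
      - \<i> * tangent_map (?T (axis j 1)) z (axis i \<i>) + tangent_map (?T (axis j \<i>)) z (axis i \<i>))"
    unfolding e dz_def lin by (simp add: algebra_simps add_divide_distrib diff_divide_distrib)
  moreover have "dzbar j (dz i F) z = 1/4 * (tangent_map (?T (axis i 1)) z (axis j 1)
      - \<i> * tangent_map (?T (axis i \<i>)) z (axis j 1)
      + \<i> * tangent_map (?T (axis i 1)) z (axis j \<i>) + tangent_map (?T (axis i \<i>)) z (axis j \<i>))"
    unfolding e dzbar_def lin by (simp add: algebra_simps add_divide_distrib diff_divide_distrib)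
  ultimately show ?thesis
    by (simp only: sym[of "axis j 1" "axis i 1"] sym[of "axis j \<i>" "axis i 1"]
        sym[of "axis j 1" "axis i \<i>"] sym[of "axis j \<i>" "axis i \<i>"])
      (simp add: algebra_simps)
qed

end

section \<open>Chern curvature in a unitary frame\<close>

text \<open>
  The entry \<open>(b, c)\<close> of the matrix
  \<open>[A\<^sub>e, A\<^sub>a\<^sup>*] - \<Sum>\<^sub>d (A e d a \<cdot> A\<^sub>d\<^sup>* + cnj (A a d e) \<cdot> A\<^sub>d)\<close>, where \<open>A\<^sub>d\<close> has the entry \<open>A d c a\<close> in row \<open>c\<close> and
  column \<open>a\<close>.
\<close>

definition unitary_curvature ::
  "(2 \<Rightarrow> 2 \<Rightarrow> 2 \<Rightarrow> complex) \<Rightarrow> 2 \<Rightarrow> 2 \<Rightarrow> 2 \<Rightarrow> 2 \<Rightarrow> complex" where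
  "unitary_curvature A a e c b =
     (\<Sum>d\<in>UNIV. A e b d * cnj (A a c d) - cnj (A a d b) * A e d c
        - A e d a * cnj (A d c b) - cnj (A a d e) * A d b c)"

text \<open>
  The columns \<open>M 1\<close>, \<open>M 2\<close> are a frame of \<open>(1,0)\<close>-fields, unitary for the Hermitian matrix function \<open>H\<close>,
  whose \<open>\<partial>\<close>-bar derivatives have constant coefficients in the frame itself.  Only the first derivatives
  in antiholomorphic directions are prescribed.
\<close>

locale unitary_frame =
  fixes V :: "(complex^2) set" and H :: "complex^2 \<Rightarrow> complex^2^2"
    and M :: "2 \<Rightarrow> complex^2 \<Rightarrow> complex^2" and A :: "2 \<Rightarrow> 2 \<Rightarrow> 2 \<Rightarrow> complex"
  assumes open_V: "open V"
    and smooth_M: "smooth_on V (M a)"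
    and smooth_H: "smooth_on V (\<lambda>z. H z $ k $ l)"
    and orthonormal: "z \<in> V \<Longrightarrow>
      (\<Sum>k\<in>UNIV. \<Sum>l\<in>UNIV. M a z $ k * H z $ k $ l * cnj (M b z $ l)) = (if a = b then 1 else 0)"
    and dbar_frame: "z \<in> V \<Longrightarrow>
      (\<Sum>i\<in>UNIV. cnj (M b z $ i) * dzbar i (\<lambda>w. M a w $ k) z) = (\<Sum>c\<in>UNIV. A b c a * M c z $ k)"
begin

text \<open>
  The frame fields and their conjugates as derivations on functions; \<open>m\<close> is the conjugate frame and \<open>n\<close>
  the coframe dual to \<open>M\<close>, obtained by lowering the index of \<open>m\<close> with \<open>H\<close>.
\<close>

definition D where "D a F z = (\<Sum>i\<in>UNIV. M a z $ i * dz i F z)"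
definition Db where "Db a F z = (\<Sum>i\<in>UNIV. cnj (M a z $ i) * dzbar i F z)"

definition m where "m b l z = cnj (M b z $ l)"
definition n where "n b k z = (\<Sum>l\<in>UNIV. H z $ k $ l * m b l z)"

abbreviation "smooth F \<equiv> smooth_on V F"
abbreviation "Hf k l \<equiv> \<lambda>z. H z $ k $ l"

lemma smooth_Mk: "smooth (\<lambda>z. M a z $ k)"
  by (intro smooth_on_nth open_V smooth_M)

lemma smooth_m: "smooth (m b l)"
  unfolding m_def[abs_def] by (intro smooth_on_cnj open_V smooth_Mk)

lemma smooth_n: "smooth (n b k)"
  unfolding n_def[abs_def]
  by (intro smooth_on_sum open_V finite smooth_on_mult smooth_H smooth_m)

lemma smooth_D: "smooth F \<Longrightarrow> smooth (D a F)"
  unfolding D_def[abs_def]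
  by (intro smooth_on_sum open_V finite smooth_on_mult smooth_Mk smooth_on_dz)

lemma smooth_Db: "smooth F \<Longrightarrow> smooth (Db a F)"
  unfolding Db_def[abs_def]
  by (intro smooth_on_sum open_V finite smooth_on_mult smooth_on_cnj smooth_Mk smooth_on_dzbar)

lemma D_add: "z \<in> V \<Longrightarrow> smooth F \<Longrightarrow> smooth G \<Longrightarrow> D a (\<lambda>w. F w + G w) z = D a F z + D a G z"
  and Db_add: "z \<in> V \<Longrightarrow> smooth F \<Longrightarrow> smooth G \<Longrightarrow> Db a (\<lambda>w. F w + G w) z = Db a F z + Db a G z"
  by (simp_all add: D_def Db_def dz_add[OF open_V] dzbar_add[OF open_V] sum_2 algebra_simps)

lemma D_mult: "z \<in> V \<Longrightarrow> smooth F \<Longrightarrow> smooth G \<Longrightarrow>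
    D a (\<lambda>w. F w * G w) z = D a F z * G z + F z * D a G z"
  and Db_mult: "z \<in> V \<Longrightarrow> smooth F \<Longrightarrow> smooth G \<Longrightarrow>
    Db a (\<lambda>w. F w * G w) z = Db a F z * G z + F z * Db a G z"
  by (simp_all add: D_def Db_def dz_mult[OF open_V] dzbar_mult[OF open_V] sum_2 algebra_simps)

lemma D_const: "D a (\<lambda>w. c) z = 0" and Db_const: "Db a (\<lambda>w. c) z = 0"
  by (simp_all add: D_def Db_def dz_def dzbar_def)

lemma D_cong: "(\<And>w. w \<in> V \<Longrightarrow> F w = G w) \<Longrightarrow> smooth F \<Longrightarrow> z \<in> V \<Longrightarrow> D a F z = D a G z"
  and Db_cong: "(\<And>w. w \<in> V \<Longrightarrow> F w = G w) \<Longrightarrow> smooth F \<Longrightarrow> z \<in> V \<Longrightarrow> Db a F z = Db a G z"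
  unfolding D_def Db_def using dz_cong[OF open_V, of z F G] dzbar_cong[OF open_V, of z F G] by simp_all

lemmas smooth_simps = smooth_on_add[OF open_V] smooth_on_mult[OF open_V] smooth_on_const
  smooth_m smooth_n smooth_H smooth_D smooth_Db smooth_Mk

lemmas D_simps = D_add D_mult
lemmas Db_simps = Db_add Db_mult

lemma Db_M: "z \<in> V \<Longrightarrow> Db b (\<lambda>w. M a w $ k) z = (\<Sum>c\<in>UNIV. A b c a * M c z $ k)"
  unfolding Db_def by (rule dbar_frame)

lemma D_m: "z \<in> V \<Longrightarrow> D a (m b l) z = (\<Sum>d\<in>UNIV. cnj (A a d b) * m d l z)"
proof -
  assume z: "z \<in> V"
  have "D a (m b l) z = cnj (Db a (\<lambda>w. M b w $ l) z)"
    unfolding D_def Db_def m_def[abs_def] by (simp add: dz_cnj[OF open_V z smooth_Mk])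
  then show ?thesis by (simp add: Db_M[OF z] m_def)
qed

text \<open>
  The frame fields are not coordinate fields.  Contracting a mixed second derivative with \<open>M\<^sub>a\<close> and the
  conjugate of \<open>M\<^sub>e\<close> differs from applying the two derivations in turn by the derivative of the conjugate
  of \<open>M\<^sub>e\<close> along \<open>M\<^sub>a\<close>, which the structure constants determine.
\<close>

lemma contract_dz_dzbar:
  assumes z: "z \<in> V" and F: "smooth F"
  shows "(\<Sum>i\<in>UNIV. \<Sum>j\<in>UNIV. M a z $ i * cnj (M e z $ j) * dz i (dzbar j F) z)
    = D a (Db e F) z - (\<Sum>d\<in>UNIV. cnj (A a d e) * Db d F z)"
proof -
  have "dz i (Db e F) z = (\<Sum>j\<in>UNIV. dz i (m e j) z * dzbar j F z + m e j z * dz i (dzbar j F) z)" for i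
    unfolding Db_def[abs_def] m_def[symmetric]
    by (simp add: sum_2 dz_add[OF open_V z] dz_mult[OF open_V z] smooth_simps smooth_on_dzbar[OF open_V] F)
  then have "D a (Db e F) z = (\<Sum>i\<in>UNIV. \<Sum>j\<in>UNIV. M a z $ i * m e j z * dz i (dzbar j F) z)
      + (\<Sum>j\<in>UNIV. D a (m e j) z * dzbar j F z)"
    by (simp add: D_def sum_2 algebra_simps)
  moreover have "(\<Sum>j\<in>UNIV. D a (m e j) z * dzbar j F z) = (\<Sum>d\<in>UNIV. cnj (A a d e) * Db d F z)"
    by (simp add: D_m[OF z] Db_def m_def sum_2 algebra_simps)
  ultimately show ?thesis by (simp add: m_def)
qed

lemma contract_dzbar_dz:
  assumes z: "z \<in> V" and F: "smooth F"
  shows "(\<Sum>i\<in>UNIV. \<Sum>j\<in>UNIV. M a z $ i * cnj (M e z $ j) * dzbar j (dz i F) z)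
    = Db e (D a F) z - (\<Sum>d\<in>UNIV. A e d a * D d F z)"
proof -
  have "dzbar j (D a F) z = (\<Sum>i\<in>UNIV. dzbar j (\<lambda>w. M a w $ i) z * dz i F z + M a z $ i * dzbar j (dz i F) z)" for j
    unfolding D_def[abs_def]
    by (simp add: sum_2 dzbar_add[OF open_V z] dzbar_mult[OF open_V z] smooth_simps smooth_on_dz[OF open_V] F)
  then have "Db e (D a F) z = (\<Sum>i\<in>UNIV. \<Sum>j\<in>UNIV. M a z $ i * cnj (M e z $ j) * dzbar j (dz i F) z)
      + (\<Sum>i\<in>UNIV. Db e (\<lambda>w. M a w $ i) z * dz i F z)"
    by (simp add: Db_def sum_2 algebra_simps)
  moreover have "(\<Sum>i\<in>UNIV. Db e (\<lambda>w. M a w $ i) z * dz i F z) = (\<Sum>d\<in>UNIV. A e d a * D d F z)"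
    by (simp add: Db_M[OF z] D_def sum_2 algebra_simps)
  ultimately show ?thesis by simp
qed

text \<open>
  The bracket of \<open>Z\<^sub>a\<close> and the conjugate of \<open>Z\<^sub>e\<close>: its \<open>(1,0)\<close>-part is read off from the \<open>\<partial>\<close>-bar derivatives of
  the frame, and the \<open>(0,1)\<close>-part is determined by conjugation.
\<close>

lemma commutator_D_Db:
  assumes z: "z \<in> V" and F: "smooth F"
  shows "D a (Db e F) z = Db e (D a F) z
    + (\<Sum>d\<in>UNIV. cnj (A a d e) * Db d F z) - (\<Sum>d\<in>UNIV. A e d a * D d F z)"
proof -
  have "D a (Db e F) z - (\<Sum>d\<in>UNIV. cnj (A a d e) * Db d F z)
      = Db e (D a F) z - (\<Sum>d\<in>UNIV. A e d a * D d F z)"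
    unfolding contract_dz_dzbar[OF z F, symmetric] contract_dzbar_dz[OF z F, symmetric]
      dz_dzbar_commute[OF open_V z F] ..
  then show ?thesis by (simp add: algebra_simps)
qed

lemma dual_frame: "z \<in> V \<Longrightarrow> (\<Sum>k\<in>UNIV. M a z $ k * n b k z) = (if a = b then 1 else 0)"
  using orthonormal[of z a b] by (simp add: n_def m_def sum_2 algebra_simps)

lemma dual_basis_2:
  fixes x y :: "2 \<Rightarrow> 2 \<Rightarrow> complex"
  assumes "\<And>a b. (\<Sum>k\<in>UNIV. x a k * y b k) = (if a = b then 1 else 0)"
  shows "(\<Sum>a\<in>UNIV. x a k * y a l) = (if k = l then 1 else 0)"
proof -
  let ?X = "(\<chi> a k. x a k) :: complex^2^2" and ?Y = "(\<chi> k b. y b k) :: complex^2^2"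
  have "?X ** ?Y = mat 1"
    using assms by (simp add: vec_eq_iff matrix_matrix_mult_def mat_def)
  then have "?Y ** ?X = mat 1" by (simp add: matrix_left_right_inverse)
  then have "(?Y ** ?X) $ l $ k = (if k = l then 1 else 0)" by (simp add: mat_def)
  then show ?thesis by (simp add: matrix_matrix_mult_def mult.commute)
qed

lemma dual_frame_complete: "z \<in> V \<Longrightarrow> (\<Sum>c\<in>UNIV. M c z $ k * n c l z) = (if k = l then 1 else 0)"
  by (rule dual_basis_2) (rule dual_frame)

text \<open>
  Differentiating the duality \<open>M\<^sub>c \<cdot> n\<^sub>b = \<delta>\<close> turns the known derivatives of \<open>M\<close> into those of \<open>n\<close>.  Thus
  \<open>m\<close> has constant coefficients under \<open>D\<close> and \<open>n\<close> under \<open>Db\<close>, while \<open>Db m\<close> and \<open>D n\<close> are unknown.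
\<close>

lemma Db_n:
  assumes z: "z \<in> V"
  shows "Db e (n b k) z = - (\<Sum>d\<in>UNIV. A e b d * n d k z)"
proof -
  have 0: "(\<Sum>k\<in>UNIV. M c z $ k * Db e (n b k) z) = - A e b c" for c
  proof -
    have "Db e (\<lambda>w. \<Sum>k\<in>UNIV. M c w $ k * n b k w) z = Db e (\<lambda>w. if c = b then 1 else 0) z"
      by (rule Db_cong[OF dual_frame _ z], assumption, unfold sum_2, intro smooth_simps)
    then have "(\<Sum>k\<in>UNIV. Db e (\<lambda>w. M c w $ k) z * n b k z + M c z $ k * Db e (n b k) z) = 0"
      by (simp add: sum_2 Db_simps[OF z] Db_const smooth_simps)
    moreover have "(\<Sum>k\<in>UNIV. Db e (\<lambda>w. M c w $ k) z * n b k z)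
        = (\<Sum>d\<in>UNIV. A e d c * (\<Sum>k\<in>UNIV. M d z $ k * n b k z))"
      by (simp add: Db_M[OF z] sum_2 algebra_simps)
    ultimately show ?thesis
      using exhaust_2[of b] by (auto simp: dual_frame[OF z] sum.distrib sum_2 eq_neg_iff_add_eq_0 add.commute)
  qed
  have "(\<Sum>c\<in>UNIV. (\<Sum>l\<in>UNIV. M c z $ l * Db e (n b l) z) * n c k z)
      = (\<Sum>l\<in>UNIV. Db e (n b l) z * (\<Sum>c\<in>UNIV. M c z $ l * n c k z))"
    by (simp add: sum_2 algebra_simps)
  also have "\<dots> = Db e (n b k) z"
    using exhaust_2[of k] by (auto simp: dual_frame_complete[OF z] sum_2)
  finally show ?thesis by (simp add: 0 sum_2)
qed

lemma herm_inverse_frame: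
  assumes z: "z \<in> V"
  shows "herm_inverse H z $ p $ q = (\<Sum>d\<in>UNIV. M d z $ p * m d q z)"
proof -
  let ?K = "(\<chi> q p. \<Sum>d\<in>UNIV. M d z $ p * m d q z) :: complex^2^2"
  have "(\<Sum>q\<in>UNIV. H z $ k $ q * (\<Sum>d\<in>UNIV. M d z $ p * m d q z)) = (\<Sum>d\<in>UNIV. M d z $ p * n d k z)" for k p
    by (simp add: n_def sum_2 algebra_simps)
  then have HK: "H z ** ?K = mat 1"
    by (auto simp: vec_eq_iff matrix_matrix_mult_def mat_def dual_frame_complete[OF z])
  then have KH: "?K ** H z = mat 1" by (simp add: matrix_left_right_inverse)
  have "H z ** matrix_inv (H z) = mat 1 \<and> matrix_inv (H z) ** H z = mat 1"
    unfolding matrix_inv_def by (rule someI[of _ ?K]) (use HK KH in auto)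
  then have "matrix_inv (H z) = ?K"
    using KH matrix_mul_assoc[of ?K "H z" "matrix_inv (H z)"] by (simp only: matrix_mul_lid matrix_mul_rid)
  then show ?thesis by (simp add: herm_inverse_def transpose_def)
qed

lemma herm_inverse_n:
  assumes z: "z \<in> V"
  shows "(\<Sum>p\<in>UNIV. herm_inverse H z $ p $ q * n d p z) = m d q z"
proof -
  have "(\<Sum>p\<in>UNIV. herm_inverse H z $ p $ q * n d p z)
      = (\<Sum>c\<in>UNIV. (\<Sum>p\<in>UNIV. M c z $ p * n d p z) * m c q z)"
    by (simp add: herm_inverse_frame[OF z] sum_2 algebra_simps)
  then show ?thesis using exhaust_2[of d] by (auto simp: dual_frame[OF z] sum_2)
qed

lemma herm_inverse_H:
  assumes z: "z \<in> V"
  shows "(\<Sum>p\<in>UNIV. herm_inverse H z $ p $ q * H z $ p $ l) = (if q = l then 1 else 0)"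
proof -
  have "(\<Sum>p\<in>UNIV. herm_inverse H z $ p $ q * H z $ p $ l)
      = (\<Sum>c\<in>UNIV. m c q z * (\<Sum>p\<in>UNIV. M c z $ p * H z $ p $ l))"
    by (simp add: herm_inverse_frame[OF z] sum_2 algebra_simps)
  also have "\<dots> = (if q = l then 1 else 0)"
  proof (rule dual_basis_2)
    show "(\<Sum>k\<in>UNIV. m a k z * (\<Sum>p\<in>UNIV. M b z $ p * H z $ p $ k)) = (if a = b then 1 else 0)" for a b
      using orthonormal[OF z, of b a] by (auto simp: m_def sum_2 algebra_simps)
  qed
  finally show ?thesis .
qed

lemma Db_n_product: "z \<in> V \<Longrightarrow>
    Db e (n b k) z = (\<Sum>l\<in>UNIV. Db e (Hf k l) z * m b l z + H z $ k $ l * Db e (m b l) z)"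
  unfolding n_def[abs_def] by (simp add: sum_2 Db_simps smooth_simps)

lemma D_n_product: "z \<in> V \<Longrightarrow>
    D e (n b k) z = (\<Sum>l\<in>UNIV. D e (Hf k l) z * m b l z + H z $ k $ l * D e (m b l) z)"
  unfolding n_def[abs_def] by (simp add: sum_2 D_simps smooth_simps)

lemma D_Db_n_product:
  assumes z: "z \<in> V"
  shows "D a (Db e (n b k)) z = (\<Sum>l\<in>UNIV. D a (Db e (Hf k l)) z * m b l z
      + Db e (Hf k l) z * D a (m b l) z + D a (Hf k l) z * Db e (m b l) z
      + H z $ k $ l * D a (Db e (m b l)) z)"
proof -
  have "D a (Db e (n b k)) z
      = D a (\<lambda>w. \<Sum>l\<in>UNIV. Db e (Hf k l) w * m b l w + H w $ k $ l * Db e (m b l) w) z"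
    by (rule D_cong[OF Db_n_product _ z]) (auto intro!: smooth_simps)
  then show ?thesis by (simp add: sum_2 D_simps[OF z] smooth_simps algebra_simps)
qed

text \<open>
  The last step of the curvature computation.  The unknowns are \<open>Dn\<close> (derivatives of the coframe along
  \<open>Z\<^sub>a\<close>), \<open>u\<close> and \<open>w\<close> (conjugate derivatives of \<open>m\<close>, lowered by \<open>H\<close>) and \<open>x\<close> (a derivative of \<open>H\<close> applied to
  one of \<open>m\<close>); all of them drop out.
\<close>

lemma curvature_cancellation:
  fixes x :: complex and Dn v u w :: "2 \<Rightarrow> complex" and P Q R :: "2 \<Rightarrow> 2 \<Rightarrow> complex" and p q r s :: "2 \<Rightarrow> complex"
  shows "- (- (\<Sum>d\<in>UNIV. p d * Dn d) - (\<Sum>d\<in>UNIV. q d * (- (\<Sum>f\<in>UNIV. P d f * v f) - u d)) - x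
       - ((\<Sum>d\<in>UNIV. s d * w d) + (\<Sum>d\<in>UNIV. q d * u d) - (\<Sum>d\<in>UNIV. r d * (\<Sum>f\<in>UNIV. Q d f * v f))))
     + (\<Sum>d\<in>UNIV. s d * (- (\<Sum>f\<in>UNIV. R d f * v f) - w d))
     + (- (\<Sum>d\<in>UNIV. p d * (Dn d - (\<Sum>f\<in>UNIV. S d f * v f))) - x)
    = (\<Sum>f\<in>UNIV. (\<Sum>d\<in>UNIV. p d * S d f - q d * P d f - r d * Q d f - s d * R d f) * v f)"
  by (simp add: sum_2 algebra_simps)

text \<open>
  Differentiating \<open>n = H m\<close> twice expresses the curvature applied to \<open>m\<close> by derivatives of \<open>m\<close> and \<open>n\<close> alone.
  The only second derivative that is not known from the structure constants is that of \<open>m\<close>, and the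
  commutator reduces it to first order.
\<close>

lemma curvature_on_frame:
  assumes z: "z \<in> V"
  shows "(\<Sum>l\<in>UNIV. (\<Sum>i\<in>UNIV. \<Sum>j\<in>UNIV. M a z $ i * cnj (M e z $ j) * chern_curvature H z i j k l) * m b l z)
   = (\<Sum>f\<in>UNIV. (\<Sum>d\<in>UNIV. A e b d * cnj (A a f d) - cnj (A a d b) * A e d f
        - A e d a * cnj (A d f b) - cnj (A a d e) * A d b f) * n f k z)"
proof -
  let ?h = "\<lambda>p q. herm_inverse H z $ p $ q"
  \<comment> \<open>The quantities that depend on the chart; they cancel in the end.\<close>
  define u where "u d = (\<Sum>l\<in>UNIV. H z $ k $ l * Db e (m d l) z)" for d
  define w where "w d = (\<Sum>l\<in>UNIV. H z $ k $ l * Db d (m b l) z)" for d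
  define x where "x = (\<Sum>q\<in>UNIV. D a (Hf k q) z * Db e (m b q) z)"
  have contracted: "(\<Sum>i\<in>UNIV. \<Sum>j\<in>UNIV. M a z $ i * cnj (M e z $ j) * chern_curvature H z i j k l)
      = - (D a (Db e (Hf k l)) z - (\<Sum>d\<in>UNIV. cnj (A a d e) * Db d (Hf k l) z))
        + (\<Sum>p\<in>UNIV. \<Sum>q\<in>UNIV. ?h p q * D a (Hf k q) z * Db e (Hf p l) z)" for l
    unfolding contract_dz_dzbar[OF z smooth_H, symmetric] chern_curvature_def
    by (simp add: D_def Db_def sum_2 algebra_simps)
  have S: "(\<Sum>l\<in>UNIV. D a (Db e (Hf k l)) z * m b l z) = D a (Db e (n b k)) z
      - (\<Sum>l\<in>UNIV. Db e (Hf k l) z * D a (m b l) z) - x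
      - (\<Sum>l\<in>UNIV. H z $ k $ l * D a (Db e (m b l)) z)"
    by (simp add: D_Db_n_product[OF z] x_def sum.distrib)
  have S1: "D a (Db e (n b k)) z = - (\<Sum>d\<in>UNIV. A e b d * D a (n d k) z)"
  proof -
    have "D a (Db e (n b k)) z = D a (\<lambda>w. \<Sum>d\<in>UNIV. - A e b d * n d k w) z"
      by (rule D_cong[OF _ _ z]) (auto simp: Db_n sum_negf intro!: smooth_simps)
    then show ?thesis by (simp only: sum_2 D_simps[OF z] D_const smooth_simps) simp
  qed
  have S2: "(\<Sum>l\<in>UNIV. Db e (Hf k l) z * D a (m b l) z)
      = (\<Sum>d\<in>UNIV. cnj (A a d b) * (Db e (n d k) z - u d))"
    by (simp add: D_m[OF z] Db_n_product[OF z] u_def sum_2 algebra_simps)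
  have S3: "(\<Sum>l\<in>UNIV. H z $ k $ l * D a (Db e (m b l)) z)
      = (\<Sum>d\<in>UNIV. cnj (A a d e) * w d) + (\<Sum>d\<in>UNIV. cnj (A a d b) * u d)
        - (\<Sum>d\<in>UNIV. A e d a * (\<Sum>f\<in>UNIV. cnj (A d f b) * n f k z))"
  proof -
    have "Db e (D a (m b l)) z = (\<Sum>d\<in>UNIV. cnj (A a d b) * Db e (m d l) z)" for l
    proof -
      have "Db e (D a (m b l)) z = Db e (\<lambda>w. \<Sum>d\<in>UNIV. cnj (A a d b) * m d l w) z"
        by (rule Db_cong[OF _ _ z]) (auto simp: D_m intro!: smooth_simps)
      then show ?thesis by (simp add: sum_2 Db_simps[OF z] Db_const smooth_simps)
    qed
    then have "D a (Db e (m b l)) z = (\<Sum>d\<in>UNIV. cnj (A a d b) * Db e (m d l) z)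
        + (\<Sum>d\<in>UNIV. cnj (A a d e) * Db d (m b l) z)
        - (\<Sum>d\<in>UNIV. A e d a * (\<Sum>f\<in>UNIV. cnj (A d f b) * m f l z))" for l
      by (simp add: commutator_D_Db[OF z smooth_m] D_m[OF z])
    note second = this
    show ?thesis
      unfolding second by (simp add: u_def w_def n_def sum_2 algebra_simps)
  qed
  have T: "(\<Sum>l\<in>UNIV. Db d (Hf k l) z * m b l z) = Db d (n b k) z - w d" for d
    by (simp add: Db_n_product[OF z] w_def sum_2 algebra_simps)
  have Z: "(\<Sum>l\<in>UNIV. (\<Sum>p\<in>UNIV. \<Sum>q\<in>UNIV. ?h p q * D a (Hf k q) z * Db e (Hf p l) z) * m b l z)
      = - (\<Sum>d\<in>UNIV. A e b d * (D a (n d k) z - (\<Sum>f\<in>UNIV. cnj (A a f d) * n f k z))) - x"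
  proof -
    have "(\<Sum>p\<in>UNIV. ?h p q * (\<Sum>l\<in>UNIV. Db e (Hf p l) z * m b l z))
        = - (\<Sum>d\<in>UNIV. A e b d * m d q z) - Db e (m b q) z" for q
    proof -
      have "(\<Sum>l\<in>UNIV. Db e (Hf p l) z * m b l z)
          = - (\<Sum>d\<in>UNIV. A e b d * n d p z) - (\<Sum>l\<in>UNIV. H z $ p $ l * Db e (m b l) z)" for p
        using Db_n_product[OF z, of e b p] Db_n[OF z, of e b p] by (simp add: sum.distrib)
      note first = this
      have "(\<Sum>p\<in>UNIV. ?h p q * (\<Sum>l\<in>UNIV. Db e (Hf p l) z * m b l z))
         = - (\<Sum>d\<in>UNIV. A e b d * (\<Sum>p\<in>UNIV. ?h p q * n d p z))
           - (\<Sum>l\<in>UNIV. (\<Sum>p\<in>UNIV. ?h p q * H z $ p $ l) * Db e (m b l) z)"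
        unfolding first by (simp add: sum_2 algebra_simps)
      then show ?thesis
        using exhaust_2[of q] by (auto simp: herm_inverse_n[OF z] herm_inverse_H[OF z] sum_2)
    qed
    note inner = this
    have contract_DH: "(\<Sum>q\<in>UNIV. D a (Hf k q) z * m d q z)
        = D a (n d k) z - (\<Sum>f\<in>UNIV. cnj (A a f d) * n f k z)" for d
      by (simp add: D_n_product[OF z] D_m[OF z] n_def sum_2 algebra_simps)
    have "(\<Sum>l\<in>UNIV. (\<Sum>p\<in>UNIV. \<Sum>q\<in>UNIV. ?h p q * D a (Hf k q) z * Db e (Hf p l) z) * m b l z)
        = (\<Sum>q\<in>UNIV. D a (Hf k q) z * (\<Sum>p\<in>UNIV. ?h p q * (\<Sum>l\<in>UNIV. Db e (Hf p l) z * m b l z)))"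
      by (simp add: sum_2 algebra_simps)
    also have "\<dots> = - (\<Sum>d\<in>UNIV. A e b d * (\<Sum>q\<in>UNIV. D a (Hf k q) z * m d q z)) - x"
      unfolding inner x_def by (simp add: sum_2 algebra_simps)
    finally show ?thesis unfolding contract_DH .
  qed
  have "(\<Sum>l\<in>UNIV. (\<Sum>i\<in>UNIV. \<Sum>j\<in>UNIV. M a z $ i * cnj (M e z $ j) * chern_curvature H z i j k l) * m b l z)
      = - (\<Sum>l\<in>UNIV. D a (Db e (Hf k l)) z * m b l z)
        + (\<Sum>d\<in>UNIV. cnj (A a d e) * (\<Sum>l\<in>UNIV. Db d (Hf k l) z * m b l z))
        + (\<Sum>l\<in>UNIV. (\<Sum>p\<in>UNIV. \<Sum>q\<in>UNIV. ?h p q * D a (Hf k q) z * Db e (Hf p l) z) * m b l z)"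
    unfolding contracted by (simp add: sum_2 algebra_simps)
  then show ?thesis
    unfolding Z T S S1 S2 S3 Db_n[OF z] by (rule trans[OF _ curvature_cancellation])
qed

lemma frame_curvature:
  assumes z: "z \<in> V"
  shows "(\<Sum>i\<in>UNIV. \<Sum>j\<in>UNIV. \<Sum>k\<in>UNIV. \<Sum>l\<in>UNIV. M a z $ i * cnj (M e z $ j) * M c z $ k * cnj (M b z $ l)
      * chern_curvature H z i j k l) = unitary_curvature A a e c b"
proof -
  let ?T = "\<lambda>k l. \<Sum>i\<in>UNIV. \<Sum>j\<in>UNIV. M a z $ i * cnj (M e z $ j) * chern_curvature H z i j k l"
  have "(\<Sum>i\<in>UNIV. \<Sum>j\<in>UNIV. \<Sum>k\<in>UNIV. \<Sum>l\<in>UNIV. M a z $ i * cnj (M e z $ j) * M c z $ k * cnj (M b z $ l)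
      * chern_curvature H z i j k l) = (\<Sum>k\<in>UNIV. M c z $ k * (\<Sum>l\<in>UNIV. ?T k l * m b l z))"
    by (simp add: m_def sum_2 algebra_simps)
  also have "\<dots> = (\<Sum>k\<in>UNIV. M c z $ k * (\<Sum>f\<in>UNIV. unitary_curvature A a e f b * n f k z))"
    unfolding curvature_on_frame[OF z] unitary_curvature_def ..
  also have "\<dots> = (\<Sum>f\<in>UNIV. unitary_curvature A a e f b * (\<Sum>k\<in>UNIV. M c z $ k * n f k z))"
    by (simp add: sum_2 algebra_simps)
  also have "\<dots> = unitary_curvature A a e c b"
    using exhaust_2[of c] by (auto simp: dual_frame[OF z] sum_2)
  finally show ?thesis .
qed

lemma frame_ricci1:
  assumes z: "z \<in> V"
  shows "(\<Sum>i\<in>UNIV. \<Sum>j\<in>UNIV. M a z $ i * cnj (M e z $ j) * ricci1_matrix H z $ i $ j)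
     = (\<Sum>c\<in>UNIV. unitary_curvature A a e c c)"
  unfolding frame_curvature[OF z, symmetric] ricci1_matrix_def
  by (simp add: herm_inverse_frame[OF z] m_def sum_2 algebra_simps)

lemma frame_ricci2:
  assumes z: "z \<in> V"
  shows "(\<Sum>k\<in>UNIV. \<Sum>l\<in>UNIV. M c z $ k * cnj (M b z $ l) * ricci2_matrix H z $ k $ l)
     = (\<Sum>a\<in>UNIV. unitary_curvature A a a c b)"
  unfolding frame_curvature[OF z, symmetric] ricci2_matrix_def
  by (simp add: herm_inverse_frame[OF z] m_def sum_2 algebra_simps)

text \<open>
  The frame spans at every point, so a form vanishing on all pairs of frame fields is zero.
\<close>

lemma ricci1_form_zero:
  assumes z: "z \<in> V" and 0: "\<And>a e. (\<Sum>c\<in>UNIV. unitary_curvature A a e c c) = 0"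
  shows "form11 (ricci1_matrix H z) u v = 0"
proof -
  let ?R = "ricci1_matrix H z"
  have "?R $ p $ q = (\<Sum>i\<in>UNIV. \<Sum>j\<in>UNIV. (\<Sum>a\<in>UNIV. M a z $ i * n a p z)
      * cnj (\<Sum>e\<in>UNIV. M e z $ j * n e q z) * ?R $ i $ j)" for p q
    using exhaust_2[of p] exhaust_2[of q] by (auto simp: dual_frame_complete[OF z] sum_2)
  also have "\<dots> p q = (\<Sum>a\<in>UNIV. \<Sum>e\<in>UNIV. n a p z * cnj (n e q z) *
      (\<Sum>i\<in>UNIV. \<Sum>j\<in>UNIV. M a z $ i * cnj (M e z $ j) * ?R $ i $ j))" for p q
    by (simp add: sum_2 algebra_simps)
  finally have "?R $ p $ q = 0" for p q
    by (simp only: frame_ricci1[OF z] 0) simp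
  then show ?thesis by (simp add: form11_def)
qed

end

section \<open>Groups with affine left translations\<close>

definition linear_part :: "(real^4) monoid \<Rightarrow> real^4 \<Rightarrow> real^4 \<Rightarrow> real^4" where
  "linear_part G a v = a \<otimes>\<^bsub>G\<^esub> v - a"

text \<open>
  For affine left translations this is the Lie bracket of the left-invariant fields extending \<open>u\<close> and
  \<open>v\<close>, evaluated at the neutral element.
\<close>

definition bracket :: "(real^4) monoid \<Rightarrow> real^4 \<Rightarrow> real^4 \<Rightarrow> real^4" where
  "bracket G u v = tangent_map (\<lambda>a. linear_part G a v) 0 u - tangent_map (\<lambda>a. linear_part G a u) 0 v"

text \<open>
  Affinity makes \<open>E\<close> a representation of the group, since \<open>E (a x) = E a \<circ> E x\<close>, and it makes the tangent
  map of a left translation independent of the point.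
\<close>

locale affine_group = group G for G :: "(real^4) monoid" (structure) +
  assumes carrier_UNIV: "carrier G = UNIV"
    and one_0: "\<one> = 0"
    and linear_linear_part: "linear (linear_part G a)"
    and smooth_linear_part: "smooth_on UNIV (\<lambda>a. linear_part G a v)"
begin

abbreviation "E \<equiv> linear_part G"

lemma mult_eq: "a \<otimes> x = a + E a x"
  by (simp add: linear_part_def)

lemma mult_0: "x \<otimes> 0 = x"
  by (simp add: mult_eq linear_0[OF linear_linear_part])

lemma linear_part_one: "E 0 v = v"
  using l_one[of v] by (simp add: linear_part_def one_0 carrier_UNIV)

lemma linear_part_mult: "E (a \<otimes> x) v = E a (E x v)"
proof -
  have "a \<otimes> x \<otimes> v = a \<otimes> (x \<otimes> v)" by (simp add: m_assoc carrier_UNIV)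
  moreover have "E a (E x v) = E a (x \<otimes> v) - E a x"
    by (simp add: linear_part_def[of G x] linear_diff[OF linear_linear_part])
  ultimately show ?thesis by (simp add: linear_part_def)
qed

lemma linear_part_inverse: "E (inv a) (E a v) = v"
  using linear_part_mult[of "inv a" a v] by (simp add: l_inv carrier_UNIV one_0 linear_part_one)

lemma linear_part_inverse': "E a (E (inv a) v) = v"
  using linear_part_mult[of a "inv a" v] by (simp add: r_inv carrier_UNIV one_0 linear_part_one)

lemma has_derivative_left_translation: "(left_translation G a has_derivative E a) (at x)"
proof -
  have "((\<lambda>x. a + E a x) has_derivative (\<lambda>v. 0 + E a v)) (at x)"
    by (intro has_derivative_add has_derivative_const linear_imp_has_derivative linear_linear_part)
  then show ?thesis by (simp add: mult_eq[abs_def])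
qed

lemma tangent_map_left_translation: "tangent_map (left_translation G a) x = E a"
  by (rule tangent_map_eqI[OF has_derivative_left_translation])

text \<open>
  Differentiate \<open>E (x y) v = E x (E y v)\<close> with respect to \<open>y\<close> at the neutral element: derivatives of
  invariant fields along invariant fields are determined at that element.
\<close>

lemma tangent_map_linear_part: "tangent_map (\<lambda>a. E a v) x (E x u) = E x (tangent_map (\<lambda>a. E a v) 0 u)"
proof -
  note D = smooth_on_has_derivative[OF smooth_linear_part UNIV_I]
  have "((\<lambda>y. E (x \<otimes> y) v) has_derivative (\<lambda>u. tangent_map (\<lambda>a. E a v) x (E x u))) (at 0)"
    using has_derivative_compose[OF has_derivative_left_translation[of x 0] D[of v "x \<otimes> 0"]] by (simp add: mult_0)
  moreover have "((\<lambda>y. E x (E y v)) has_derivative (\<lambda>u. E x (tangent_map (\<lambda>a. E a v) 0 u))) (at 0)"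
    using has_derivative_compose[OF D linear_imp_has_derivative[OF linear_linear_part]] .
  ultimately show ?thesis
    unfolding linear_part_mult using has_derivative_unique by metis
qed

lemma invariant_field_bracket:
  "tangent_map (\<lambda>a. E a v) x (E x u) - tangent_map (\<lambda>a. E a u) x (E x v) = E x (bracket G u v)"
  by (simp add: tangent_map_linear_part bracket_def linear_diff[OF linear_linear_part])

lemma invariant_endo_at:
  assumes "endo_invariant (left_translations G) J"
  shows "J x (E x v) = E x (J 0 v)"
proof -
  have "left_translation G x \<in> left_translations G" by (simp add: left_translations_def)
  with assms have "J (x \<otimes> 0) (tangent_map (left_translation G x) 0 v)
      = tangent_map (left_translation G x) 0 (J 0 v)"
    unfolding endo_invariant_def by blast
  then show ?thesis
    by (simp add: tangent_map_left_translation mult_0)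
qed

lemma invariant_metric_at:
  assumes "metric_invariant (left_translations G) g"
  shows "g x (E x u) (E x v) = g 0 u v"
proof -
  have "left_translation G x \<in> left_translations G" by (simp add: left_translations_def)
  with assms have "g (x \<otimes> 0) (tangent_map (left_translation G x) 0 u) (tangent_map (left_translation G x) 0 v)
      = g 0 u v"
    unfolding metric_invariant_def by blast
  then show ?thesis
    by (simp add: tangent_map_left_translation mult_0)
qed

end


section \<open>Invariant fields in holomorphic coordinates\<close>

lemma real_linear_complex2:
  fixes L :: "complex^2 \<Rightarrow> 'b::real_vector"
  assumes L: "linear L"
  shows "L w = (\<Sum>i\<in>UNIV. Re (w $ i) *\<^sub>R L (axis i 1) + Im (w $ i) *\<^sub>R L (axis i \<i>))"
proof -
  have "w = (\<Sum>i\<in>UNIV. Re (w $ i) *\<^sub>R axis i 1 + Im (w $ i) *\<^sub>R axis i \<i>)"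
    by (auto simp: vec_eq_iff forall_2 sum_2 axis_def complex_eq_iff)
  then have "L w = L (\<Sum>i\<in>UNIV. Re (w $ i) *\<^sub>R axis i 1 + Im (w $ i) *\<^sub>R axis i \<i>)"
    by (rule arg_cong)
  then show ?thesis by (simp only: linear_sum[OF L] linear_add[OF L] linear_cmul[OF L])
qed

text \<open>
  Contracting the antiholomorphic derivatives with the conjugate of \<open>w\<close> extracts the complex antilinear
  part of the differential \<open>L\<close> at \<open>w\<close>.
\<close>

lemma antiholomorphic_part:
  fixes L :: "complex^2 \<Rightarrow> complex"
  assumes L: "linear L"
  shows "(\<Sum>i\<in>UNIV. cnj (w $ i) * ((L (axis i 1) + \<i> * L (axis i \<i>)) / 2)) = (L w + \<i> * L (\<i> *s w)) / 2"
  unfolding real_linear_complex2[OF L, of w] real_linear_complex2[OF L, of "\<i> *s w"]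
  by (simp add: sum_2 scaleR_conv_of_real complex_eq_iff algebra_simps) (simp add: field_simps)

text \<open>
  A left-invariant integrable complex structure; \<open>J 0\<close> is the induced one on the Lie algebra.
\<close>

locale invariant_complex_group = affine_group +
  fixes J :: endo_field
  assumes complex_structure: "complex_structure J"
    and J_invariant: "endo_invariant (left_translations G) J"
begin

lemma linear_J: "linear (J x)" and J_J: "J x (J x v) = - v"
  using complex_structure by (auto simp: complex_structure_def)

text \<open>
  Up to the identification of a real vector \<open>v\<close> with its \<open>(1,0)\<close>-part \<open>Z\<^sub>v\<close>, this is the \<open>(1,0)\<close>-part of the
  bracket of the conjugate of \<open>Z\<^sub>u\<close> with \<open>Z\<^sub>v\<close>.
\<close>

definition dbar_bracket where "dbar_bracket u v = (1/2) *\<^sub>R (bracket G u v + J 0 (bracket G (J 0 u) v))"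

text \<open>
  Multiplication by complex scalars on the Lie algebra, with \<open>J 0\<close> as multiplication by \<open>\<i>\<close>.
\<close>

definition cscale where "cscale c v = Re c *\<^sub>R v + Im c *\<^sub>R J 0 v"

end

locale invariant_chart = invariant_complex_group +
  fixes V :: "(complex^2) set" and \<psi> :: "complex^2 \<Rightarrow> real^4"
  assumes parametrization: "holomorphic_parametrization J V \<psi>"
begin

abbreviation "\<phi> \<equiv> inv_into V \<psi>"

text \<open>
  The left-invariant field extending \<open>v\<close>, pulled back to the chart.
\<close>

definition coord_field where "coord_field v z = tangent_map \<phi> (\<psi> z) (E (\<psi> z) v)"

lemma open_V: "open V" and open_U: "open (\<psi> ` V)" and inj: "inj_on \<psi> V"
  and smooth_psi: "smooth_on V \<psi>" and smooth_phi: "smooth_on (\<psi> ` V) \<phi>"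
  and psi_holomorphic: "z \<in> V \<Longrightarrow> tangent_map \<psi> z (\<i> *s v) = J (\<psi> z) (tangent_map \<psi> z v)"
  using parametrization by (auto simp: holomorphic_parametrization_def)

lemma tangent_phi_psi: "z \<in> V \<Longrightarrow> tangent_map \<phi> (\<psi> z) (tangent_map \<psi> z w) = w"
proof -
  assume z: "z \<in> V"
  have "((\<lambda>z. \<phi> (\<psi> z)) has_derivative (\<lambda>w. tangent_map \<phi> (\<psi> z) (tangent_map \<psi> z w))) (at z)"
    by (rule has_derivative_compose[OF smooth_on_has_derivative[OF smooth_psi z]
        smooth_on_has_derivative[OF smooth_phi imageI[OF z]]])
  then have "((\<lambda>z. z) has_derivative (\<lambda>w. tangent_map \<phi> (\<psi> z) (tangent_map \<psi> z w))) (at z)"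
    by (rule has_derivative_transform_within_open[OF _ open_V z]) (simp add: inj)
  from fun_cong[OF has_derivative_unique[OF this has_derivative_ident]] show ?thesis .
qed

lemma tangent_psi_phi: "z \<in> V \<Longrightarrow> tangent_map \<psi> z (tangent_map \<phi> (\<psi> z) w) = w"
proof -
  assume z: "z \<in> V"
  have "((\<lambda>x. \<psi> (\<phi> x)) has_derivative (\<lambda>w. tangent_map \<psi> (\<phi> (\<psi> z)) (tangent_map \<phi> (\<psi> z) w))) (at (\<psi> z))"
    using has_derivative_compose[OF smooth_on_has_derivative[OF smooth_phi imageI[OF z]]
        smooth_on_has_derivative[OF smooth_psi, of "\<phi> (\<psi> z)"]] z by (simp add: inj)
  then have "((\<lambda>x. x) has_derivative (\<lambda>w. tangent_map \<psi> (\<phi> (\<psi> z)) (tangent_map \<phi> (\<psi> z) w))) (at (\<psi> z))"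
    by (rule has_derivative_transform_within_open[OF _ open_U]) (use z in \<open>auto simp: inj f_inv_into_f\<close>)
  from fun_cong[OF has_derivative_unique[OF this has_derivative_ident], of w] show ?thesis
    using z by (simp add: inj)
qed

lemma linear_tangent_psi: "z \<in> V \<Longrightarrow> linear (tangent_map \<psi> z)"
  by (rule smooth_on_linear_tangent_map[OF smooth_psi])

lemma linear_tangent_phi: "z \<in> V \<Longrightarrow> linear (tangent_map \<phi> (\<psi> z))"
  by (rule smooth_on_linear_tangent_map[OF smooth_phi]) simp

lemma tangent_psi_coord_field: "z \<in> V \<Longrightarrow> tangent_map \<psi> z (coord_field v z) = E (\<psi> z) v"
  by (simp add: coord_field_def tangent_psi_phi)

lemma linear_coord_field: "z \<in> V \<Longrightarrow> linear (\<lambda>v. coord_field v z)"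
  unfolding coord_field_def using linear_compose[OF linear_linear_part linear_tangent_phi] by (simp add: o_def)

lemma coord_field_inject: "z \<in> V \<Longrightarrow> coord_field u z = coord_field v z \<longleftrightarrow> u = v"
proof
  assume z: "z \<in> V" and eq: "coord_field u z = coord_field v z"
  have "E (\<psi> z) u = E (\<psi> z) v"
    using tangent_psi_coord_field[OF z, of u] tangent_psi_coord_field[OF z, of v] eq by simp
  then have "E (inv (\<psi> z)) (E (\<psi> z) u) = E (inv (\<psi> z)) (E (\<psi> z) v)" by simp
  then show "u = v" by (simp only: linear_part_inverse)
qed auto

lemma coord_field_J: "z \<in> V \<Longrightarrow> coord_field (J 0 v) z = \<i> *s coord_field v z"
proof -
  assume z: "z \<in> V"
  have "tangent_map \<psi> z (\<i> *s coord_field v z) = E (\<psi> z) (J 0 v)"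
    by (simp add: psi_holomorphic[OF z] tangent_psi_coord_field[OF z] invariant_endo_at[OF J_invariant])
  from arg_cong[OF this, of "tangent_map \<phi> (\<psi> z)"] show ?thesis
    by (simp add: coord_field_def tangent_phi_psi[OF z])
qed

lemma smooth_coord_field: "smooth_on V (coord_field v)"
proof -
  have "smooth_on (\<psi> ` V) (\<lambda>x. tangent_map \<phi> x (E x v))"
    by (rule smooth_on_tangent_map_field[OF open_U smooth_phi])
       (rule smooth_on_subset[OF smooth_linear_part subset_UNIV])
  from smooth_on_compose[OF open_V open_U subset_refl smooth_psi this]
  show ?thesis by (simp add: coord_field_def[abs_def])
qed

text \<open>
  Applying the tangent map of \<open>\<psi>\<close> to the pulled-back field gives \<open>E (\<psi> z) v\<close>.  Differentiating this
  relation, the second derivatives of \<open>\<psi>\<close> cancel by symmetry after exchanging \<open>u\<close> and \<open>v\<close>.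
\<close>

lemma coord_field_bracket:
  assumes z: "z \<in> V"
  shows "tangent_map (coord_field v) z (coord_field u z) - tangent_map (coord_field u) z (coord_field v z) = coord_field (bracket G u v) z"
proof -
  have Duv: "tangent_map (\<lambda>w. E (\<psi> w) v) z (coord_field u z) = tangent_map (\<lambda>a. E a v) (\<psi> z) (E (\<psi> z) u)" for u v
  proof -
    have "((\<lambda>w. E (\<psi> w) v) has_derivative (\<lambda>y. tangent_map (\<lambda>a. E a v) (\<psi> z) (tangent_map \<psi> z y))) (at z)"
      by (rule has_derivative_compose[OF smooth_on_has_derivative[OF smooth_psi z]
            smooth_on_has_derivative[OF smooth_linear_part UNIV_I]])
    from tangent_map_eqI[OF this] show ?thesis by (simp add: tangent_psi_coord_field[OF z])
  qed
  have prod: "tangent_map (\<lambda>w. E (\<psi> w) v) z (coord_field u z)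
      = tangent_map (\<lambda>y. tangent_map \<psi> y (coord_field v z)) z (coord_field u z) + tangent_map \<psi> z (tangent_map (coord_field v) z (coord_field u z))" for u v
  proof -
    have "tangent_map (\<lambda>w. tangent_map \<psi> w (coord_field v w)) z = tangent_map (\<lambda>w. E (\<psi> w) v) z"
      by (rule tangent_map_cong[OF open_V z tangent_psi_coord_field])
         (auto intro: smooth_on_tangent_map_field open_V smooth_psi smooth_coord_field)
    then show ?thesis
      using tangent_map_along_field[OF open_V z smooth_psi smooth_coord_field, of v "coord_field u z"] by simp
  qed
  have "tangent_map \<psi> z (tangent_map (coord_field v) z (coord_field u z) - tangent_map (coord_field u) z (coord_field v z))
      = tangent_map (\<lambda>w. E (\<psi> w) v) z (coord_field u z) - tangent_map (\<lambda>w. E (\<psi> w) u) z (coord_field v z)"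
    unfolding prod symmetric_second_derivative[OF open_V z smooth_psi, of "coord_field v z" "coord_field u z"]
    by (simp add: linear_diff[OF linear_tangent_psi[OF z]])
  also have "\<dots> = E (\<psi> z) (bracket G u v)"
    unfolding Duv by (rule invariant_field_bracket)
  finally have "tangent_map \<psi> z (tangent_map (coord_field v) z (coord_field u z) - tangent_map (coord_field u) z (coord_field v z))
      = E (\<psi> z) (bracket G u v)" .
  from arg_cong[OF this, of "tangent_map \<phi> (\<psi> z)"] show ?thesis
    by (simp add: coord_field_def[of "bracket G u v"] tangent_phi_psi[OF z])
qed

lemma tangent_coord_field_J: "z \<in> V \<Longrightarrow> tangent_map (coord_field (J 0 v)) z w = \<i> *s tangent_map (coord_field v) z w"
proof -
  assume z: "z \<in> V"
  have bl: "bounded_linear (\<lambda>x::complex^2. \<i> *s x)"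
    by (intro linear_conv_bounded_linear[THEN iffD1] linearI) (auto simp: vec_eq_iff algebra_simps)
  have "((\<lambda>y. \<i> *s coord_field v y) has_derivative (\<lambda>w. \<i> *s tangent_map (coord_field v) z w)) (at z)"
    by (rule bounded_linear.has_derivative[OF bl smooth_on_has_derivative[OF smooth_coord_field z]])
  then have "(coord_field (J 0 v) has_derivative (\<lambda>w. \<i> *s tangent_map (coord_field v) z w)) (at z)"
    by (rule has_derivative_transform_within_open[OF _ open_V z]) (simp add: coord_field_J)
  then show ?thesis by (simp add: tangent_map_eqI)
qed

text \<open>
  The derivative of the field of \<open>v\<close> along that of \<open>u\<close> is the derivative of the field of \<open>u\<close> along that of
  \<open>v\<close> plus the bracket.  Replacing \<open>u\<close> by \<open>J u\<close> multiplies the field of \<open>u\<close>, and hence its derivative, by \<open>\<i>\<close>,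
  so that these derivatives cancel in the antilinear part and only brackets remain.
\<close>

lemma dbar_coord_field:
  assumes z: "z \<in> V"
  shows "(1/2) *\<^sub>R (tangent_map (coord_field v) z (coord_field u z) + \<i> *s tangent_map (coord_field v) z (\<i> *s coord_field u z)) = coord_field (dbar_bracket u v) z"
proof -
  note lin = linear_coord_field[OF z]
  have 1: "tangent_map (coord_field v) z (coord_field u z) = tangent_map (coord_field u) z (coord_field v z) + coord_field (bracket G u v) z" for u
    using coord_field_bracket[OF z, of v u] by (simp add: algebra_simps)
  have 2: "tangent_map (coord_field v) z (\<i> *s coord_field u z)
      = \<i> *s tangent_map (coord_field u) z (coord_field v z) + coord_field (bracket G (J 0 u) v) z"
    using 1[of "J 0 u"] by (simp only: coord_field_J[OF z] tangent_coord_field_J[OF z])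
  have "tangent_map (coord_field v) z (coord_field u z) + \<i> *s tangent_map (coord_field v) z (\<i> *s coord_field u z)
      = coord_field (bracket G u v) z + \<i> *s coord_field (bracket G (J 0 u) v) z"
    unfolding 1 2 by (simp add: vec_eq_iff algebra_simps)
  then show ?thesis
    by (simp add: dbar_bracket_def coord_field_J[OF z] linear_cmul[OF lin] linear_add[OF lin])
qed

text \<open>
  Integrability in algebraic form: the \<open>\<partial>\<close>-bar derivative is complex linear in the differentiated field.
\<close>

lemma dbar_bracket_J_chart:
  assumes z: "z \<in> V"
  shows "dbar_bracket u (J 0 v) = J 0 (dbar_bracket u v)"
proof -
  have "coord_field (dbar_bracket u (J 0 v)) z = coord_field (J 0 (dbar_bracket u v)) z"
    unfolding coord_field_J[OF z] dbar_coord_field[OF z, symmetric] tangent_coord_field_J[OF z]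
    by (simp add: vec_eq_iff algebra_simps)
  then show ?thesis by (simp add: coord_field_inject[OF z])
qed

lemma coord_field_cscale: "z \<in> V \<Longrightarrow> coord_field (cscale c v) z = c *s coord_field v z"
  by (simp add: cscale_def linear_add[OF linear_coord_field] linear_cmul[OF linear_coord_field] coord_field_J vec_eq_iff complex_eq_iff)

end


section \<open>Curvature of an invariant metric\<close>

lemma smooth_on_metric_field:
  fixes g :: metric_field and \<psi> :: "complex^2 \<Rightarrow> real^4"
  assumes V: "open V" and g: "\<And>x. bilinear (g x)" "\<And>u v. smooth_on UNIV (\<lambda>x. g x u v)"
    and \<psi>: "smooth_on V \<psi>" and X: "smooth_on V X" and Y: "smooth_on V Y"
  shows "smooth_on V (\<lambda>z. g (\<psi> z) (X z) (Y z))"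
proof -
  have "g x u v = (\<Sum>b\<in>Basis. \<Sum>c\<in>Basis. (u \<bullet> b) * ((v \<bullet> c) * g x b c))" for x u v
  proof -
    have "g x u v = (\<Sum>b\<in>Basis. (u \<bullet> b) *\<^sub>R g x b v)"
      by (rule linear_euclidean_expansion) (use g(1) in \<open>simp add: bilinear_def\<close>)
    moreover have "g x b v = (\<Sum>c\<in>Basis. (v \<bullet> c) *\<^sub>R g x b c)" for b
      by (rule linear_euclidean_expansion) (use g(1) in \<open>simp add: bilinear_def\<close>)
    ultimately show ?thesis by (simp add: sum_distrib_left)
  qed
  note expand = this
  have "smooth_on V (\<lambda>z. g (\<psi> z) b c)" for b c
    by (rule smooth_on_compose[OF V open_UNIV subset_UNIV \<psi> g(2)])
  then have "smooth_on V (\<lambda>z. \<Sum>b\<in>Basis. \<Sum>c\<in>Basis. (X z \<bullet> b) * ((Y z \<bullet> c) * g (\<psi> z) b c))"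
    by (intro smooth_on_sum[OF V] finite_Basis smooth_on_mult[OF V]
        smooth_on_bounded_linear[OF V bounded_linear_inner_left X]
        smooth_on_bounded_linear[OF V bounded_linear_inner_left Y])
  then show ?thesis by (rule smooth_on_cong[OF V expand[symmetric]])
qed

text \<open>
  Two vectors of the Lie algebra, unitary at the neutral element, together with their structure
  constants; the invariant fields extending them form a unitary frame in every holomorphic chart.
\<close>

locale invariant_unitary_frame = invariant_chart +
  fixes g :: metric_field and D :: "(real^4 \<Rightarrow> real^4) set"
    and f :: "2 \<Rightarrow> real^4" and A :: "2 \<Rightarrow> 2 \<Rightarrow> 2 \<Rightarrow> complex"
  assumes hermitian: "hermitian_metric D J g"
    and g_invariant: "metric_invariant (left_translations G) g"
    and f_orthonormal: "g 0 (f a) (f b) = (if a = b then 1 else 0)" "g 0 (f a) (J 0 (f b)) = 0"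
    and structure_constants: "dbar_bracket (f b) (f a) = (\<Sum>c\<in>UNIV. cscale (A b c a) (f c))"
begin

lemma bilinear_g: "bilinear (g x)" and g_J: "g x (J x u) (J x v) = g x u v"
  and g_sym: "g x u v = g x v u" and smooth_g: "smooth_on UNIV (\<lambda>x. g x u v)"
  using hermitian by (auto simp: hermitian_metric_def)

lemmas g_linear = bilinear_ladd[OF bilinear_g] bilinear_radd[OF bilinear_g]
  bilinear_lmul[OF bilinear_g] bilinear_rmul[OF bilinear_g]

lemma g_J_left: "g x (J x u) v = - g x u (J x v)"
  using g_J[of x u "J x v"] by (simp add: J_J bilinear_rneg[OF bilinear_g])

lemmas herm_simps = herm_def omega_def g_linear linear_add[OF linear_J] linear_cmul[OF linear_J]
  g_J_left J_J bilinear_rneg[OF bilinear_g]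

lemma herm_sesquilinear:
  "herm J g x (u + u') v = herm J g x u v + herm J g x u' v"
  "herm J g x u (v + v') = herm J g x u v + herm J g x u v'"
  "herm J g x (r *\<^sub>R u) v = r * herm J g x u v"
  "herm J g x u (r *\<^sub>R v) = r * herm J g x u v"
  "herm J g x (J x u) v = - \<i> * herm J g x u v"
  "herm J g x u (J x v) = \<i> * herm J g x u v"
  by (simp_all add: herm_simps complex_eq_iff algebra_simps)

text \<open>
  The first argument of \<^const>\<open>herm\<close> is the antilinear one; this fixes the order of \<open>w\<close> and \<open>w'\<close>.
\<close>

lemma herm_matrix_apply:
  assumes z: "z \<in> V"
  shows "(\<Sum>k\<in>UNIV. \<Sum>l\<in>UNIV. w $ k * herm_matrix J g \<psi> z $ k $ l * cnj (w' $ l))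
      = herm J g (\<psi> z) (tangent_map \<psi> z w') (tangent_map \<psi> z w)"
proof -
  have ax: "tangent_map \<psi> z (axis k \<i>) = J (\<psi> z) (tangent_map \<psi> z (axis k 1))" for k
  proof -
    have "axis k \<i> = \<i> *s (axis k 1 :: complex^2)" by (simp add: vec_eq_iff axis_def)
    then show ?thesis by (simp only: psi_holomorphic[OF z])
  qed
  show ?thesis
    unfolding real_linear_complex2[OF linear_tangent_psi[OF z], of w]
      real_linear_complex2[OF linear_tangent_psi[OF z], of w'] ax herm_matrix_def
    by (simp add: sum_2 herm_sesquilinear complex_eq_iff) (simp add: algebra_simps)
qed

lemma smooth_herm_matrix: "smooth_on V (\<lambda>z. herm_matrix J g \<psi> z $ k $ l)"
proof -
  let ?X = "\<lambda>w z. tangent_map \<psi> z w"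
  have g: "smooth_on V (\<lambda>z. complex_of_real (g (\<psi> z) (?X u z) (?X v z)))" for u v
    by (rule smooth_on_bounded_linear[OF open_V bounded_linear_of_real
      smooth_on_metric_field[OF open_V bilinear_g smooth_g smooth_psi
        smooth_on_tangent_map[OF smooth_psi] smooth_on_tangent_map[OF smooth_psi]]])
  have "smooth_on V (\<lambda>z. complex_of_real (g (\<psi> z) (?X (axis l 1) z) (?X (axis k 1) z))
      + (- \<i>) * complex_of_real (g (\<psi> z) (?X (axis l 1) z) (?X (\<i> *s axis k 1) z)))"
    by (intro smooth_on_add[OF open_V] smooth_on_mult[OF open_V] smooth_on_const g)
  then show ?thesis
    by (rule smooth_on_cong[OF open_V, rotated])
      (simp add: herm_matrix_def herm_def omega_def psi_holomorphic)
qed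

sublocale unitary_frame V "herm_matrix J g \<psi>" "\<lambda>a. coord_field (f a)" A
proof
  show "open V" by (rule open_V)
  show "smooth_on V (coord_field (f a))" for a by (rule smooth_coord_field)
  show "smooth_on V (\<lambda>z. herm_matrix J g \<psi> z $ k $ l)" for k l by (rule smooth_herm_matrix)
  show "(\<Sum>k\<in>UNIV. \<Sum>l\<in>UNIV. coord_field (f a) z $ k * herm_matrix J g \<psi> z $ k $ l * cnj (coord_field (f b) z $ l))
      = (if a = b then 1 else 0)" if z: "z \<in> V" for z a b
    unfolding herm_matrix_apply[OF z] tangent_psi_coord_field[OF z] herm_def omega_def
      invariant_endo_at[OF J_invariant] invariant_metric_at[OF g_invariant]
    by (auto simp: f_orthonormal)
  show "(\<Sum>i\<in>UNIV. cnj (coord_field (f b) z $ i) * dzbar i (\<lambda>w. coord_field (f a) w $ k) z)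
      = (\<Sum>c\<in>UNIV. A b c a * coord_field (f c) z $ k)" if z: "z \<in> V" for z a b k
  proof -
    let ?T = "tangent_map (\<lambda>w. coord_field (f a) w $ k) z"
    have T: "?T = (\<lambda>w. tangent_map (coord_field (f a)) z w $ k)"
      by (rule tangent_map_eqI[OF bounded_linear.has_derivative[OF bounded_linear_vec_nth
        smooth_on_has_derivative[OF smooth_coord_field z]]])
    have "linear ?T"
      by (rule smooth_on_linear_tangent_map[OF smooth_on_nth[OF open_V smooth_coord_field] z])
    from antiholomorphic_part[OF this, of "coord_field (f b) z"]
    have "(\<Sum>i\<in>UNIV. cnj (coord_field (f b) z $ i) * dzbar i (\<lambda>w. coord_field (f a) w $ k) z)
       = (?T (coord_field (f b) z) + \<i> * ?T (\<i> *s coord_field (f b) z)) / 2"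
      by (simp add: dzbar_def)
    also have "\<dots> = coord_field (dbar_bracket (f b) (f a)) z $ k"
      unfolding dbar_coord_field[OF z, symmetric] T vector_scaleR_component by (simp add: scaleR_conv_of_real)
    also have "\<dots> = (\<Sum>c\<in>UNIV. A b c a * coord_field (f c) z $ k)"
      by (simp add: structure_constants linear_sum[OF linear_coord_field[OF z]] coord_field_cscale[OF z])
    finally show ?thesis .
  qed
qed

text \<open>
  Evaluating on \<open>w\<close> and \<open>\<i> w\<close> recovers the Hermitian form of the matrix \<open>R\<close>, by which the Einstein equation
  is compared on unit vectors.
\<close>

lemma form11_diagonal: "form11 R w (\<i> *s w) = 2 * (\<Sum>k\<in>UNIV. \<Sum>l\<in>UNIV. w $ k * cnj (w $ l) * R $ k $ l)"
  by (simp add: form11_def sum_2 algebra_simps) 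

lemma second_chern_einstein_frame:
  assumes einstein: "second_chern_einstein D J g" and z: "z \<in> V"
  shows "(\<Sum>a\<in>UNIV. unitary_curvature A a a 1 1) = (\<Sum>a\<in>UNIV. unitary_curvature A a a 2 2)"
proof -
  from einstein obtain lam where "\<forall>V \<psi>. holomorphic_parametrization J V \<psi> \<longrightarrow>
       (\<forall>z\<in>V. \<forall>u v. form11 (ricci2_matrix (herm_matrix J g \<psi>) z) u v =
            of_real (lam (\<psi> z) *
              omega J g (\<psi> z) (tangent_map \<psi> z u) (tangent_map \<psi> z v)))"
    unfolding second_chern_einstein_def by (elim exE conjE)
  from this[rule_format, OF parametrization z]
  have lam: "form11 (ricci2_matrix (herm_matrix J g \<psi>) z) u v =
      of_real (lam (\<psi> z) * omega J g (\<psi> z) (tangent_map \<psi> z u) (tangent_map \<psi> z v))" for u v .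
  have "2 * (\<Sum>a\<in>UNIV. unitary_curvature A a a c c) = of_real (- lam (\<psi> z))" for c
  proof -
    have "2 * (\<Sum>a\<in>UNIV. unitary_curvature A a a c c)
        = form11 (ricci2_matrix (herm_matrix J g \<psi>) z) (coord_field (f c) z) (\<i> *s coord_field (f c) z)"
      unfolding form11_diagonal frame_ricci2[OF z, symmetric] ..
    also have "\<dots> = of_real (- lam (\<psi> z))"
      unfolding lam psi_holomorphic[OF z] tangent_psi_coord_field[OF z] omega_def J_J
        bilinear_rneg[OF bilinear_g] invariant_metric_at[OF g_invariant] f_orthonormal
      by simp
    finally show ?thesis .
  qed
  from this[of 1] this[of 2] have "2 * (\<Sum>a\<in>UNIV. unitary_curvature A a a 1 1)
     = 2 * (\<Sum>a\<in>UNIV. unitary_curvature A a a 2 2)" by (simp only:)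
  then show ?thesis by simp
qed

end

section \<open>Integrable complex structures and unitary frames of the Lie algebra\<close>

context affine_group
begin

lemma bracket_antisym: "bracket G v u = - bracket G u v"
  by (simp add: bracket_def)

lemma bracket_self: "bracket G v v = 0"
  by (simp add: bracket_def)

lemma linear_bracket_left: "linear (\<lambda>u. bracket G u v)"
proof -
  have 1: "linear (\<lambda>u. tangent_map (\<lambda>a. E a v) 0 u)"
    using smooth_on_linear_tangent_map[OF smooth_linear_part UNIV_I] .
  have D: "((\<lambda>a. E a u) has_derivative tangent_map (\<lambda>a. E a u) 0) (at 0)" for u
    by (rule smooth_on_has_derivative[OF smooth_linear_part UNIV_I])
  have add: "tangent_map (\<lambda>a. E a (u + u')) 0 v
      = tangent_map (\<lambda>a. E a u) 0 v + tangent_map (\<lambda>a. E a u') 0 v" for u u'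
    using tangent_map_eqI[OF has_derivative_add[OF D[of u] D[of u']]]
    by (simp add: linear_add[OF linear_linear_part])
  have cmul: "tangent_map (\<lambda>a. E a (c *\<^sub>R u)) 0 v = c *\<^sub>R tangent_map (\<lambda>a. E a u) 0 v" for c u
    using tangent_map_eqI[OF has_derivative_scaleR_right[OF D[of u], of c]]
    by (simp add: linear_cmul[OF linear_linear_part])
  show ?thesis
    unfolding bracket_def
    by (rule linearI) (simp_all add: add cmul linear_add[OF 1] linear_cmul[OF 1] algebra_simps)
qed

lemma linear_bracket_right: "linear (bracket G u)"
proof -
  have "bracket G u = (\<lambda>v. - bracket G v u)" by (simp add: bracket_def fun_eq_iff)
  then show ?thesis using linear_compose_neg[OF linear_bracket_left] by simp
qed

end

context invariant_complex_group
begin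

abbreviation "I \<equiv> J 0"
abbreviation "br \<equiv> bracket G"

lemmas lin_simps =
  linear_add[OF linear_J] linear_cmul[OF linear_J] linear_neg[OF linear_J] linear_diff[OF linear_J] linear_0[OF linear_J]
  linear_add[OF linear_bracket_left] linear_cmul[OF linear_bracket_left] linear_neg[OF linear_bracket_left]
  linear_diff[OF linear_bracket_left] linear_0[OF linear_bracket_left]
  linear_add[OF linear_bracket_right] linear_cmul[OF linear_bracket_right] linear_neg[OF linear_bracket_right]
  linear_diff[OF linear_bracket_right] linear_0[OF linear_bracket_right] J_J

lemma chart_at_0: obtains V \<psi> z where "invariant_chart G J V \<psi>" "z \<in> V"
proof -
  obtain V \<psi> where "holomorphic_parametrization J V \<psi>" "0 \<in> \<psi> ` V"
    using complex_structure unfolding complex_structure_def by blast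
  moreover from this obtain z where "z \<in> V" by auto
  moreover have "invariant_chart G J V \<psi>"
    by unfold_locales (fact calculation)
  ultimately show ?thesis using that by blast
qed

lemma dbar_bracket_J: "dbar_bracket u (I v) = I (dbar_bracket u v)"
proof -
  obtain V \<psi> z where "invariant_chart G J V \<psi>" "z \<in> V" by (rule chart_at_0)
  then show ?thesis by (rule invariant_chart.dbar_bracket_J_chart)
qed

text \<open>
  Vanishing of the Nijenhuis tensor.  All restrictions on \<open>J\<close> in the individual groups follow from it.
\<close>

lemma nijenhuis: "br u (I v) + I (br (I u) (I v)) = I (br u v) - br (I u) v"
  using dbar_bracket_J[of u v] by (simp add: dbar_bracket_def lin_simps)

lemma cscale_algebra:
  "cscale c (u + v) = cscale c u + cscale c v" "cscale c (- u) = - cscale c u" "cscale c (I v) = I (cscale c v)" "cscale (c * d) v = cscale c (cscale d v)"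
  "cscale (c + d) v = cscale c v + cscale d v" "cscale 0 v = 0" "cscale 1 v = v" "cscale \<i> v = I v" "cscale (of_real r) v = r *\<^sub>R v"
  "cscale (- c) v = - cscale c v" "cscale c 0 = 0" "cscale c (r *\<^sub>R v) = r *\<^sub>R cscale c v"
  by (simp_all add: cscale_def lin_simps algebra_simps)

text \<open>
  An operator with square \<open>-1\<close> has no real eigenvector.  This excludes most configurations of \<open>J\<close>.
\<close>

lemma I_neq: "v \<noteq> 0 \<Longrightarrow> I v \<noteq> r *\<^sub>R v"
proof
  assume "v \<noteq> 0" and eq: "I v = r *\<^sub>R v"
  from eq have "I (I v) = r *\<^sub>R r *\<^sub>R v" by (simp add: lin_simps)
  then have "(r * r) *\<^sub>R v = - v" by (simp add: J_J)
  then have "(r * r + 1) *\<^sub>R v = 0" by (simp add: scaleR_add_left)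
  moreover have "r * r + 1 \<noteq> 0" by (smt (verit) zero_le_square)
  ultimately show False using \<open>v \<noteq> 0\<close> by simp
qed

end

locale invariant_hermitian_group = invariant_complex_group +
  fixes g :: metric_field and D :: "(real^4 \<Rightarrow> real^4) set"
  assumes hermitian: "hermitian_metric D J g"
    and g_invariant: "metric_invariant (left_translations G) g"
begin

definition unitary_pair where
  "unitary_pair u w \<longleftrightarrow> g 0 u u = 1 \<and> g 0 w w = 1 \<and> g 0 u w = 0 \<and> g 0 u (I w) = 0"

lemma bilinear_g: "bilinear (g x)" and g_J: "g x (J x u) (J x v) = g x u v"
  and g_sym: "g x u v = g x v u" and g_pos: "u \<noteq> 0 \<Longrightarrow> g x u u > 0"
  using hermitian by (auto simp: hermitian_metric_def)

lemmas g_simps = bilinear_ladd[OF bilinear_g] bilinear_radd[OF bilinear_g]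
  bilinear_lmul[OF bilinear_g] bilinear_rmul[OF bilinear_g] bilinear_lneg[OF bilinear_g]
  bilinear_rneg[OF bilinear_g] bilinear_lzero[OF bilinear_g] bilinear_rzero[OF bilinear_g]
  bilinear_lsub[OF bilinear_g] bilinear_rsub[OF bilinear_g]

lemma g_J_left: "g x (J x u) v = - g x u (J x v)"
  using g_J[of x u "J x v"] by (simp add: J_J g_simps)

lemma g_J_self: "g x u (J x u) = 0"
  using g_J_left[of x u u] g_sym[of x u "J x u"] by simp

lemma unitary_pair_gram:
  assumes "unitary_pair u w"
  shows "g 0 u u = 1" "g 0 w w = 1" "g 0 u w = 0" "g 0 w u = 0" "g 0 u (I w) = 0" "g 0 w (I u) = 0"
    "g 0 u (I u) = 0" "g 0 w (I w) = 0" "g 0 (I u) u = 0" "g 0 (I w) w = 0" "g 0 (I u) w = 0" "g 0 (I w) u = 0"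
    "g 0 (I u) (I u) = 1" "g 0 (I w) (I w) = 1" "g 0 (I u) (I w) = 0" "g 0 (I w) (I u) = 0"
  using assms g_sym[of 0 w u] g_sym[of 0 w "I u"] by (auto simp: unitary_pair_def g_J g_J_self g_J_left J_J g_simps)

lemma unitary_pair_independent:
  assumes uw: "unitary_pair u w" and 0: "cscale c u + cscale d w = 0"
  shows "c = 0" "d = 0"
proof -
  have "g 0 x (cscale c u + cscale d w) = 0" for x by (simp add: 0 g_simps)
  from this[of u] this[of "I u"] this[of w] this[of "I w"] show "c = 0" "d = 0"
    by (auto simp: cscale_def g_simps unitary_pair_gram[OF uw] complex_eq_iff)
qed

lemma unitary_pair_spans:
  assumes uw: "unitary_pair u w"
  obtains c d where "x = cscale c u + cscale d w"
proof -
  let ?L = "\<lambda>y::real^4. cscale (Complex (y$1) (y$2)) u + cscale (Complex (y$3) (y$4)) w"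
  have lin: "linear ?L"
    by (rule linearI) (simp_all add: cscale_def algebra_simps)
  have "inj ?L"
  proof (rule linear_injective_0[OF lin, THEN iffD2], intro allI impI)
    fix y assume "?L y = 0"
    from unitary_pair_independent[OF uw this] show "y = 0"
      by (simp add: pt_eq_iff complex_eq_iff)
  qed
  then have "surj ?L" using linear_injective_imp_surjective[OF lin] by simp
  then obtain y where "x = ?L y" by blast
  then show ?thesis by (rule that)
qed

lemma unitary_pair_extending:
  assumes e: "e \<noteq> 0"
  obtains u w \<rho> where "unitary_pair u w" "\<rho> > 0" "e = \<rho> *\<^sub>R u"
proof -
  have normalize: "g 0 ((1 / sqrt (g 0 x x)) *\<^sub>R x) ((1 / sqrt (g 0 x x)) *\<^sub>R x) = 1" if "x \<noteq> 0" for x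
    using g_pos[OF that, of 0] by (simp add: g_simps divide_simps)
  define \<rho> where "\<rho> = sqrt (g 0 e e)"
  define u where "u = (1 / \<rho>) *\<^sub>R e"
  have \<rho>: "\<rho> > 0" and u: "e = \<rho> *\<^sub>R u" using g_pos[OF e, of 0] by (simp_all add: \<rho>_def u_def)
  have uu: "g 0 u u = 1" unfolding u_def \<rho>_def by (rule normalize[OF e])
  define p where "p x = x - g 0 u x *\<^sub>R u - g 0 (I u) x *\<^sub>R I u" for x
  have "\<exists>x. p x \<noteq> 0"
  proof (rule ccontr)
    assume "\<not> ?thesis"
    then have "x = g 0 u x *\<^sub>R u + g 0 (I u) x *\<^sub>R I u" for x by (simp add: p_def algebra_simps)
    then have "x \<in> span {u, I u}" for x
      by (metis insertI1 insertI2 singletonI span_add span_base span_mul)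
    then have "(UNIV :: (real^4) set) \<subseteq> span {u, I u}" by auto
    then have "dim (UNIV :: (real^4) set) \<le> card {u, I u}" by (intro dim_le_card) auto
    also have "\<dots> \<le> 2" by (simp add: card_insert_if)
    finally show False by simp
  qed
  then obtain x where x: "p x \<noteq> 0" by blast
  define w where "w = (1 / sqrt (g 0 (p x) (p x))) *\<^sub>R p x"
  have ww: "g 0 w w = 1" unfolding w_def by (rule normalize[OF x])
  have "g 0 u (p x) = 0"
    by (simp add: p_def g_simps uu g_J_self)
  moreover have "g 0 u (I (p x)) = 0"
    by (simp add: p_def g_simps lin_simps uu g_J_self g_J_left)
  ultimately have "unitary_pair u w"
    using uu ww by (simp add: unitary_pair_def w_def g_simps lin_simps)
  with \<rho> u show ?thesis by (rule that[rotated 1])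
qed

text \<open>
  The structure constants \<open>A 1 = (0, n; 0, m)\<close> and \<open>A 2 = (\<kappa>, s; 0, t)\<close>.
\<close>

definition triangular where
  "triangular \<kappa> n m s t b c a = (if b = 1 then (if a = 1 then 0 else if c = 1 then n else m)
     else if a = 1 then (if c = 1 then \<kappa> else 0) else if c = 1 then s else t)"
  for \<kappa> n m s t :: complex and a b c :: 2

definition triangular_frame where
  "triangular_frame u w \<kappa> n m s t \<longleftrightarrow> unitary_pair u w \<and> dbar_bracket u u = 0 \<and> dbar_bracket w u = cscale \<kappa> u \<and>
     dbar_bracket u w = cscale n u + cscale m w \<and> dbar_bracket w w = cscale s u + cscale t w"

lemma unitary_frame_of_triangular_frame:
  assumes tri: "triangular_frame u w \<kappa> n m s t" and chart: "invariant_chart G J V \<psi>"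
  shows "invariant_unitary_frame G J V \<psi> g D (\<lambda>a. if a = 1 then u else w) (triangular \<kappa> n m s t)"
proof -
  interpret invariant_chart G J V \<psi> by (rule chart)
  have uw: "unitary_pair u w" using tri by (simp add: triangular_frame_def)
  show ?thesis
  proof
    let ?f = "\<lambda>a::2. if a = 1 then u else w"
    show "g 0 (?f a) (?f b) = (if a = b then 1 else 0)" for a b
      using exhaust_2[of a] exhaust_2[of b] by (auto simp: unitary_pair_gram[OF uw])
    show "g 0 (?f a) (I (?f b)) = 0" for a b
      by (auto simp: unitary_pair_gram[OF uw])
    show "dbar_bracket (?f b) (?f a) = (\<Sum>c\<in>UNIV. cscale (triangular \<kappa> n m s t b c a) (?f c))" for a b
      using tri exhaust_2[of a] exhaust_2[of b]
      by (auto simp: sum_2 triangular_def triangular_frame_def cscale_algebra)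
  qed (fact hermitian g_invariant)+
qed

text \<open>
  Half the difference of the two diagonal entries of the second Chern-Ricci form is the expression
  assumed to be nonzero.
\<close>

lemma not_second_chern_einstein:
  assumes tri: "triangular_frame u w \<kappa> n m s t"
    and ne: "(cmod n)\<^sup>2 + (cmod s)\<^sup>2 + (cmod t)\<^sup>2 + Re (cnj s * m) - Re (cnj t * \<kappa>) \<noteq> 0"
  shows "\<not> second_chern_einstein D J g"
proof
  assume einstein: "second_chern_einstein D J g"
  obtain V \<psi> z where chart: "invariant_chart G J V \<psi>" "z \<in> V" by (rule chart_at_0)
  have two: "(2::2) \<noteq> 1" by simp
  note eq = invariant_unitary_frame.second_chern_einstein_frame[OF
      unitary_frame_of_triangular_frame[OF tri chart(1)] einstein chart(2)]
  have "(cmod n)\<^sup>2 + (cmod s)\<^sup>2 + (cmod t)\<^sup>2 + Re (cnj s * m) - Re (cnj t * \<kappa>) = 0"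
    unfolding cmod_power2 using arg_cong[OF eq, of Re]
    by (simp add: sum_2 unitary_curvature_def triangular_def two power2_eq_square algebra_simps, linarith?)
  with ne show False by simp
qed

text \<open>
  The trace removes the commutator from the curvature formula, and for \<open>\<kappa> = 0\<close> the traces of \<open>A 1\<close> and
  \<open>A 2\<close> are \<open>m\<close> and \<open>t\<close>.  The entries of the first Chern-Ricci form that can be nonzero are then the
  left-hand sides of the two equations, up to conjugation and a real factor.
\<close>

lemma first_chern_ricci_flat:
  assumes tri: "triangular_frame u w 0 n m s t"
    and eq: "n * cnj m + m * cnj t = 0" "Re (cnj s * m) + (cmod t)\<^sup>2 = 0"
  shows "first_chern_ricci_flat J g"
  unfolding first_chern_ricci_flat_def
proof (intro allI impI ballI)
  fix V \<psi> z x y assume par: "holomorphic_parametrization J V \<psi>" and z: "z \<in> V"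
  have two: "(2::2) \<noteq> 1" by simp
  have chart: "invariant_chart G J V \<psi>" by unfold_locales (rule par)
  interpret invariant_unitary_frame G J V \<psi> g D "\<lambda>a. if a = 1 then u else w" "triangular 0 n m s t"
    by (rule unitary_frame_of_triangular_frame[OF tri chart])
  have eq': "cnj n * m + cnj m * t = 0" using arg_cong[OF eq(1), of cnj] by simp
  have "(\<Sum>c\<in>UNIV. unitary_curvature (triangular 0 n m s t) a e c c) = 0" for a e
    using exhaust_2[of a] exhaust_2[of e] eq[unfolded cmod_power2] eq'
    by (auto simp: sum_2 unitary_curvature_def triangular_def two complex_eq_iff
        power2_eq_square algebra_simps)
  then show "form11 (ricci1_matrix (herm_matrix J g \<psi>) z) x y = 0"
    by (rule ricci1_form_zero[OF z])
qed

end

section \<open>The four groups\<close>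

lemma pt_expand: "pt x y z t = x *\<^sub>R pt 1 0 0 0 + y *\<^sub>R pt 0 1 0 0 + z *\<^sub>R pt 0 0 1 0 + t *\<^sub>R pt 0 0 0 1"
  by (simp add: pt_eq_iff)

lemma smooth_on_pt:
  fixes x y z t :: "real^4 \<Rightarrow> real"
  assumes "smooth_on UNIV x" "smooth_on UNIV y" "smooth_on UNIV z" "smooth_on UNIV t"
  shows "smooth_on UNIV (\<lambda>a. pt (x a) (y a) (z a) (t a))"
proof -
  have "smooth_on UNIV (\<lambda>a. x a *\<^sub>R pt 1 0 0 0 + y a *\<^sub>R pt 0 1 0 0 + z a *\<^sub>R pt 0 0 1 0 + t a *\<^sub>R pt 0 0 0 1)"
    by (intro smooth_on_add[OF open_UNIV] smooth_on_bilinear[OF open_UNIV bounded_bilinear_scaleR]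
        smooth_on_const assms)
  then show ?thesis by (rule smooth_on_cong[OF open_UNIV pt_expand[symmetric]])
qed

lemma has_derivative_pt:
  assumes "(x has_derivative x') F" "(y has_derivative y') F" "(z has_derivative z') F" "(t has_derivative t') F"
  shows "((\<lambda>a. pt (x a) (y a) (z a) (t a)) has_derivative (\<lambda>h. pt (x' h) (y' h) (z' h) (t' h))) F"
proof -
  have "((\<lambda>a. x a *\<^sub>R pt 1 0 0 0 + y a *\<^sub>R pt 0 1 0 0 + z a *\<^sub>R pt 0 0 1 0 + t a *\<^sub>R pt 0 0 0 1)
    has_derivative (\<lambda>a. x' a *\<^sub>R pt 1 0 0 0 + y' a *\<^sub>R pt 0 1 0 0 + z' a *\<^sub>R pt 0 0 1 0 + t' a *\<^sub>R pt 0 0 0 1)) F"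
    by (intro has_derivative_add has_derivative_scaleR_left assms)
  then show ?thesis by (simp only: pt_expand[symmetric])
qed

text \<open>
  The linear combinations form a class closed under differentiation, which sine alone does not.
\<close>

lemma smooth_on_sin_cos_combination: "smooth_on UNIV (\<lambda>x::real. a * cos x + b * sin x)"
  unfolding smooth_on_def
proof
  fix n show "Ck_on n UNIV (\<lambda>x::real. a * cos x + b * sin x)"
  proof (induction n arbitrary: a b)
    case 0
    then show ?case by (simp add: continuous_intros)
  next
    case (Suc n)
    show ?case
    proof (rule Ck_on_SucI[OF open_UNIV])
      show "((\<lambda>x. a * cos x + b * sin x) has_derivative (\<lambda>v. (v * b) * cos x + (v * - a) * sin x)) (at x)" for x
        by (auto intro!: derivative_eq_intros simp: algebra_simps)
    qed (rule Suc.IH)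
  qed
qed

lemma smooth_on_exp: "smooth_on UNIV (exp :: real \<Rightarrow> real)"
proof -
  have "Ck_on n UNIV (\<lambda>x::real. a * exp x)" for n a
  proof (induction n arbitrary: a)
    case 0
    then show ?case by (simp add: continuous_intros)
  next
    case (Suc n)
    show ?case
    proof (rule Ck_on_SucI[OF open_UNIV])
      show "((\<lambda>x. a * exp x) has_derivative (\<lambda>v. (v * a) * exp x)) (at x)" for x
        by (auto intro!: derivative_eq_intros simp: algebra_simps)
    qed (rule Suc.IH)
  qed
  from this[of _ 1] show ?thesis by (simp add: smooth_on_def)
qed

lemma smooth_on_cos_o: "smooth_on UNIV f \<Longrightarrow> smooth_on UNIV (\<lambda>a::real^4. cos (f a :: real))"
  and smooth_on_sin_o: "smooth_on UNIV f \<Longrightarrow> smooth_on UNIV (\<lambda>a::real^4. sin (f a :: real))"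
  and smooth_on_exp_o: "smooth_on UNIV f \<Longrightarrow> smooth_on UNIV (\<lambda>a::real^4. exp (f a :: real))"
  using smooth_on_compose[OF open_UNIV open_UNIV subset_UNIV _ smooth_on_sin_cos_combination[of 1 0], of f]
    smooth_on_compose[OF open_UNIV open_UNIV subset_UNIV _ smooth_on_sin_cos_combination[of 0 1], of f]
    smooth_on_compose[OF open_UNIV open_UNIV subset_UNIV _ smooth_on_exp, of f]
  by simp_all

lemma smooth_on_coordinate: "smooth_on UNIV (\<lambda>a::real^4. a $ k)"
  by (rule smooth_on_nth[OF open_UNIV smooth_on_id[OF open_UNIV]])

lemma smooth_on_uminus: "smooth_on UNIV f \<Longrightarrow> smooth_on UNIV (\<lambda>a::real^4. - (f a :: real))"
  using smooth_on_mult[OF open_UNIV smooth_on_const[of UNIV "-1"], of f] by simp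

lemma smooth_on_minus: "smooth_on UNIV f \<Longrightarrow> smooth_on UNIV h \<Longrightarrow> smooth_on UNIV (\<lambda>a::real^4. f a - (h a :: real))"
  using smooth_on_add[OF open_UNIV _ smooth_on_uminus, of f h] by simp

lemma smooth_on_divide: "smooth_on UNIV f \<Longrightarrow> smooth_on UNIV (\<lambda>a::real^4. f a / (c :: real))"
  using smooth_on_mult[OF open_UNIV _ smooth_on_const[of UNIV "inverse c"], of f] by (simp add: divide_inverse)

lemmas smooth_intros = smooth_on_pt smooth_on_const smooth_on_coordinate smooth_on_cos_o smooth_on_sin_o smooth_on_exp_o
  smooth_on_minus smooth_on_uminus smooth_on_divide smooth_on_add[OF open_UNIV] smooth_on_mult[OF open_UNIV]

lemma linear_part_nil3_R:
  "linear_part nil3_R a v = pt (v$1) (v$2) (v$3 + (a$1 * v$2 - a$2 * v$1) / 2) (v$4)"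
  by (simp add: linear_part_def nil3_R_def pt_eq_iff)

lemma linear_part_nil3_rot:
  "linear_part nil3_rot a v = pt (cos (a$4) * v$1 - sin (a$4) * v$2) (sin (a$4) * v$1 + cos (a$4) * v$2)
     (v$3 + (a$1 * (sin (a$4) * v$1 + cos (a$4) * v$2) - a$2 * (cos (a$4) * v$1 - sin (a$4) * v$2)) / 2) (v$4)"
  by (simp add: linear_part_def nil3_rot_def pt_eq_iff Let_def)

lemma linear_part_sol0:
  "linear_part (sol0 \<alpha> \<beta>) a v = pt (exp (\<alpha> * a$4) * (cos (\<beta> * a$4) * v$1 - sin (\<beta> * a$4) * v$2))
     (exp (\<alpha> * a$4) * (sin (\<beta> * a$4) * v$1 + cos (\<beta> * a$4) * v$2)) (exp (- 2 * \<alpha> * a$4) * v$3) (v$4)"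
  by (simp add: linear_part_def sol0_def pt_eq_iff)

lemma linear_part_sol1:
  "linear_part sol1 a v = pt (exp (a$4) * v$1) (exp (- a$4) * v$2)
     (v$3 + (a$1 * (exp (- a$4) * v$2) - a$2 * (exp (a$4) * v$1)) / 2) (v$4)"
  by (simp add: linear_part_def sol1_def pt_eq_iff Let_def)

lemma affine_group_nil3_R: "affine_group nil3_R"
proof (intro affine_group.intro affine_group_axioms.intro group_nil3_R)
  show "linear (linear_part nil3_R a)" for a
    unfolding linear_part_nil3_R[abs_def] by (rule linearI) (simp_all add: pt_eq_iff field_simps)
  show "smooth_on UNIV (\<lambda>a. linear_part nil3_R a v)" for v
    unfolding linear_part_nil3_R by (intro smooth_intros)
qed (simp_all add: nil3_R_def)

lemma affine_group_nil3_rot: "affine_group nil3_rot"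
proof (intro affine_group.intro affine_group_axioms.intro group_nil3_rot)
  show "linear (linear_part nil3_rot a)" for a
    unfolding linear_part_nil3_rot[abs_def] by (rule linearI) (simp_all add: pt_eq_iff field_simps)
  show "smooth_on UNIV (\<lambda>a. linear_part nil3_rot a v)" for v
    unfolding linear_part_nil3_rot by (intro smooth_intros)
qed (simp_all add: nil3_rot_def)

lemma affine_group_sol0: "affine_group (sol0 \<alpha> \<beta>)"
proof (intro affine_group.intro affine_group_axioms.intro group_sol0)
  show "linear (linear_part (sol0 \<alpha> \<beta>) a)" for a
    unfolding linear_part_sol0[abs_def] by (rule linearI) (simp_all add: pt_eq_iff algebra_simps)
  show "smooth_on UNIV (\<lambda>a. linear_part (sol0 \<alpha> \<beta>) a v)" for v
    unfolding linear_part_sol0 by (intro smooth_intros)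
qed (simp_all add: sol0_def)

lemma affine_group_sol1: "affine_group sol1"
proof (intro affine_group.intro affine_group_axioms.intro group_sol1)
  show "linear (linear_part sol1 a)" for a
    unfolding linear_part_sol1[abs_def] by (rule linearI) (simp_all add: pt_eq_iff field_simps)
  show "smooth_on UNIV (\<lambda>a. linear_part sol1 a v)" for v
    unfolding linear_part_sol1 by (intro smooth_intros)
qed (simp_all add: sol1_def)

lemma has_derivative_coordinate: "((\<lambda>a::real^4. a $ k) has_derivative (\<lambda>h. h $ k)) F"
  by (rule bounded_linear_imp_has_derivative[OF bounded_linear_vec_nth])

lemma bracketI:
  assumes "\<And>v. ((\<lambda>a. linear_part G a v) has_derivative (\<lambda>u. B u v)) (at 0)"
  shows "bracket G u v = B u v - B v u"
  unfolding bracket_def tangent_map_eqI[OF assms] ..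

lemma bracket_nil3_R: "bracket nil3_R u v = pt 0 0 (u$1 * v$2 - u$2 * v$1) 0"
proof -
  have "((\<lambda>a. linear_part nil3_R a v) has_derivative (\<lambda>u. pt 0 0 ((u$1 * v$2 - u$2 * v$1) / 2) 0)) (at 0)" for v
    unfolding linear_part_nil3_R
    by (rule has_derivative_pt) (auto intro!: derivative_eq_intros has_derivative_coordinate simp: fun_eq_iff field_simps)
  note D = this
  show ?thesis unfolding bracketI[OF D] by (simp add: pt_eq_iff field_simps)
qed

lemma bracket_nil3_rot: "bracket nil3_rot u v
  = pt (u$2 * v$4 - u$4 * v$2) (u$4 * v$1 - u$1 * v$4) (u$1 * v$2 - u$2 * v$1) 0"
proof -
  have "((\<lambda>a. linear_part nil3_rot a v) has_derivative
      (\<lambda>u. pt (- u$4 * v$2) (u$4 * v$1) ((u$1 * v$2 - u$2 * v$1) / 2) 0)) (at 0)" for v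
    unfolding linear_part_nil3_rot
    by (rule has_derivative_pt) (auto intro!: derivative_eq_intros has_derivative_coordinate simp: fun_eq_iff field_simps)
  note D = this
  show ?thesis unfolding bracketI[OF D] by (simp add: pt_eq_iff field_simps)
qed

lemma bracket_sol0: "bracket (sol0 \<alpha> \<beta>) u v
  = pt (\<alpha> * (u$4 * v$1 - u$1 * v$4) - \<beta> * (u$4 * v$2 - u$2 * v$4))
       (\<beta> * (u$4 * v$1 - u$1 * v$4) + \<alpha> * (u$4 * v$2 - u$2 * v$4))
       (- 2 * \<alpha> * (u$4 * v$3 - u$3 * v$4)) 0"
proof -
  have "((\<lambda>a. linear_part (sol0 \<alpha> \<beta>) a v) has_derivative
      (\<lambda>u. pt (\<alpha> * u$4 * v$1 - \<beta> * u$4 * v$2) (\<beta> * u$4 * v$1 + \<alpha> * u$4 * v$2) (- 2 * \<alpha> * u$4 * v$3) 0)) (at 0)" for v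
    unfolding linear_part_sol0
    by (rule has_derivative_pt) (auto intro!: derivative_eq_intros has_derivative_coordinate simp: fun_eq_iff algebra_simps)
  note D = this
  show ?thesis unfolding bracketI[OF D] by (simp add: pt_eq_iff algebra_simps)
qed

lemma bracket_sol1: "bracket sol1 u v
  = pt (u$4 * v$1 - u$1 * v$4) (u$2 * v$4 - u$4 * v$2) (u$1 * v$2 - u$2 * v$1) 0"
proof -
  have "((\<lambda>a. linear_part sol1 a v) has_derivative
      (\<lambda>u. pt (u$4 * v$1) (- u$4 * v$2) ((u$1 * v$2 - u$2 * v$1) / 2) 0)) (at 0)" for v
    unfolding linear_part_sol1
    by (rule has_derivative_pt) (auto intro!: derivative_eq_intros has_derivative_coordinate simp: fun_eq_iff field_simps)
  note D = this
  show ?thesis unfolding bracketI[OF D] by (simp add: pt_eq_iff field_simps)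
qed

section \<open>Adapted unitary frames in the four groups\<close>

context invariant_hermitian_group
begin

text \<open>
  If \<open>e\<close> is central, then \<open>ad (J e)\<close> is complex linear.  In the three groups with \<open>e\<^sub>3\<close> central the proofs
  compare this with the shape of the bracket.
\<close>

lemma central_commutes:
  assumes "\<And>v. br e v = 0"
  shows "br (I e) (I v) = I (br (I e) v)"
proof -
  have "I (br (I e) (I v)) = - br (I e) v"
    using nijenhuis[of e v] by (simp add: assms lin_simps)
  from arg_cong[OF this, of I] show ?thesis by (simp add: lin_simps)
qed

lemma central_dbar_bracket:
  assumes central: "\<And>v. br e v = 0" and \<rho>: "\<rho> > 0" "e = \<rho> *\<^sub>R u"
  shows "dbar_bracket u u = 0" "dbar_bracket w u = 0" "dbar_bracket u w = (1 / (2 * \<rho>)) *\<^sub>R I (br (I e) w)"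
    "dbar_bracket w w = (1/2) *\<^sub>R I (br (I w) w)"
proof -
  have u: "u = (1 / \<rho>) *\<^sub>R e" using \<rho> by simp
  have uv: "br u v = 0" for v using central[of v] by (simp add: u lin_simps)
  have vu: "br v u = 0" for v using bracket_antisym[of v u] by (simp add: uv)
  have ww: "br w w = 0" by (rule bracket_self)
  show "dbar_bracket u u = 0" "dbar_bracket w u = 0" by (simp_all add: dbar_bracket_def uv vu lin_simps)
  show "dbar_bracket u w = (1 / (2 * \<rho>)) *\<^sub>R I (br (I e) w)"
    using \<rho>(1) by (simp add: dbar_bracket_def uv \<rho>(2) lin_simps)
  show "dbar_bracket w w = (1/2) *\<^sub>R I (br (I w) w)" by (simp add: dbar_bracket_def ww)
qed

text \<open>
  All brackets are multiples of \<open>e\<^sub>3\<close>, and a real line is not \<open>J\<close>-invariant; hence \<open>ad (J e\<^sub>3)\<close>, being complex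
  linear, is zero and the complex line of \<open>e\<^sub>3\<close> is central.  The only possibly nonzero constant is \<open>s\<close>,
  which measures \<open>[J w, w]\<close> and cannot vanish since the group is not abelian.
\<close>

lemma nil3_R_frame:
  assumes G: "G = nil3_R"
  shows "\<exists>u w s. triangular_frame u w 0 0 0 s 0 \<and> s \<noteq> 0"
proof -
  define e where "e = pt 0 0 1 0"
  have br: "br u v = (u$1 * v$2 - u$2 * v$1) *\<^sub>R e" for u v
    by (simp add: G bracket_nil3_R e_def pt_eq_iff)
  have e: "e \<noteq> 0" by (simp add: e_def pt_eq_iff)
  have central: "br e v = 0" for v unfolding br by (simp add: e_def)
  obtain u w \<rho> where uw: "unitary_pair u w" and \<rho>: "\<rho> > 0" "e = \<rho> *\<^sub>R u"
    by (rule unitary_pair_extending[OF e])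
  have Ie_central: "br (I e) v = 0" for v
  proof (rule ccontr)
    assume ne: "br (I e) v \<noteq> 0"
    let ?a = "\<lambda>v. (I e)$1 * v$2 - (I e)$2 * v$1"
    have a: "?a v \<noteq> 0" using ne by (auto simp: br)
    have "?a (I v) *\<^sub>R e = ?a v *\<^sub>R I e"
      using central_commutes[OF central, of v] by (simp add: br[of "I e"] lin_simps)
    then have "(1 / ?a v) *\<^sub>R ?a (I v) *\<^sub>R e = (1 / ?a v) *\<^sub>R ?a v *\<^sub>R I e" by simp
    then have "I e = (?a (I v) / ?a v) *\<^sub>R e" using a by simp
    with I_neq[OF e] show False by blast
  qed
  define y where "y = (I w)$1 * w$2 - (I w)$2 * w$1"
  have Iw: "br (I w) w = y *\<^sub>R e" by (simp add: y_def br)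
  have wI: "br w (I w) = - y *\<^sub>R e" using bracket_antisym[of w "I w"] by (simp add: Iw)
  have "y \<noteq> 0"
  proof
    assume y: "y = 0"
    have "br x x' = 0" for x x'
    proof -
      obtain c d where x: "x = cscale c u + cscale d w" by (rule unitary_pair_spans[OF uw])
      obtain c' d' where x': "x' = cscale c' u + cscale d' w" by (rule unitary_pair_spans[OF uw])
      have u: "u = (1 / \<rho>) *\<^sub>R e" using \<rho> by simp
      have u0: "br u v = 0" "br (I u) v = 0" for v
        using central[of v] Ie_central[of v] by (simp_all add: u lin_simps)
      have u0': "br v u = 0" "br v (I u) = 0" for v
        using bracket_antisym[of v u] bracket_antisym[of v "I u"] by (simp_all add: u0)
      have ww: "br v v = 0" for v by (rule bracket_self)
      show ?thesis unfolding x x' cscale_def using Iw wI y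
        by (simp add: lin_simps u0 u0' ww)
    qed
    from this[of "pt 1 0 0 0" "pt 0 1 0 0"] show False by (simp add: br e)
  qed
  note y_ne = this
  define r where "r = y * \<rho> / 2"
  have "\<i> * complex_of_real r \<noteq> 0" using y_ne \<rho>(1) by (simp add: r_def)
  moreover have "dbar_bracket u w = 0" "dbar_bracket w w = cscale (\<i> * of_real r) u"
    unfolding central_dbar_bracket(3,4)[OF central \<rho>] Ie_central Iw
    by (simp_all add: cscale_def r_def lin_simps \<rho>(2))
  with central_dbar_bracket(1,2)[OF central \<rho>] uw
  have "triangular_frame u w 0 0 0 (\<i> * of_real r) 0"
    by (simp add: triangular_frame_def cscale_algebra)
  ultimately show ?thesis by blast
qed

text \<open>
  The operator \<open>T = ad (J e\<^sub>3)\<close> has the eigenvalues \<open>\<plusminus>x\<^sub>4, 0, 0\<close>, where \<open>x = J e\<^sub>3\<close>.  A nonzero \<open>x\<^sub>4\<close> would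
  be a simple eigenvalue, whose eigenline would be invariant under \<open>J\<close>, as no real line is; so \<open>x\<^sub>4 = 0\<close> and \<open>T\<close> is nilpotent.
  Then \<open>T w\<close> has no component along \<open>w\<close>, i.e. \<open>m = 0\<close>, while \<open>n \<noteq> 0\<close> because \<open>J e\<^sub>3\<close> is not central.
\<close>

lemma sol1_frame:
  assumes G: "G = sol1"
  shows "\<exists>u w n s t. triangular_frame u w 0 n 0 s t \<and> n \<noteq> 0"
proof -
  define e where "e = pt 0 0 1 0"
  have br: "br u v = pt (u$4 * v$1 - u$1 * v$4) (u$2 * v$4 - u$4 * v$2) (u$1 * v$2 - u$2 * v$1) 0" for u v
    by (simp add: G bracket_sol1)
  have e: "e \<noteq> 0" by (simp add: e_def pt_eq_iff)
  have central: "br e v = 0" for v unfolding br by (simp add: e_def pt_eq_iff)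
  obtain u w \<rho> where uw: "unitary_pair u w" and \<rho>: "\<rho> > 0" "e = \<rho> *\<^sub>R u"
    by (rule unitary_pair_extending[OF e])
  define x where "x = I e"
  define T where "T v = br x v" for v
  have TI: "T (I v) = I (T v)" for v unfolding T_def x_def by (rule central_commutes[OF central])
  have linT: "T (v + v') = T v + T v'" "T (r *\<^sub>R v) = r *\<^sub>R T v" for v v' r
    by (simp_all add: T_def lin_simps)
  have Tcs: "T (cscale c v) = cscale c (T v)" for c v by (simp add: cscale_def linT TI)
  have Tu: "T u = 0"
    using bracket_antisym[of e x] central[of x] \<rho> by (simp add: T_def lin_simps)
  have x_ne: "x \<noteq> r *\<^sub>R e" for r unfolding x_def by (rule I_neq[OF e])
  have x4: "x$4 = 0"
  proof (rule ccontr)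
    assume x4: "x$4 \<noteq> 0"
    \<comment> \<open>The eigenvector of T for the eigenvalue x_4.\<close>
    define p where "p = pt 1 0 (- (x$2 / x$4)) 0"
    have p: "p \<noteq> 0" by (simp add: p_def pt_eq_iff)
    have "T p = x$4 *\<^sub>R p" using x4 by (simp add: T_def br p_def pt_eq_iff)
    then have "T (I p) = x$4 *\<^sub>R I p" by (simp add: TI lin_simps)
    then have eqs: "x$4 * (I p)$1 - x$1 * (I p)$4 = x$4 * (I p)$1"
      "x$2 * (I p)$4 - x$4 * (I p)$2 = x$4 * (I p)$2"
      "x$1 * (I p)$2 - x$2 * (I p)$1 = x$4 * (I p)$3" "x$4 * (I p)$4 = 0"
      by (simp_all add: T_def br pt_eq_iff)
    have 4: "(I p)$4 = 0" using eqs(4) x4 by simp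
    have 2: "(I p)$2 = 0" using eqs(2) x4 by (simp add: 4)
    have "(I p)$3 = - (x$2 / x$4) * (I p)$1" using eqs(3) x4 by (simp add: 2 field_simps)
    moreover have "p$1 = 1" "p$2 = 0" "p$3 = - (x$2 / x$4)" "p$4 = 0" by (simp_all add: p_def)
    ultimately have "I p = (I p)$1 *\<^sub>R p" by (simp add: pt_eq_iff 2 4)
    with I_neq[OF p] show False by blast
  qed
  have T3: "T (T (T v)) = 0" for v by (simp add: T_def br x4 pt_eq_iff)
  obtain a b where Tw: "T w = cscale a u + cscale b w" by (rule unitary_pair_spans[OF uw])
  have "T (T (T w)) = cscale (b * b * a) u + cscale (b * b * b) w"
    by (simp add: Tw linT Tcs Tu cscale_algebra)
  then have "cscale (b * b * a) u + cscale (b * b * b) w = 0" by (simp add: T3)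
  from unitary_pair_independent(2)[OF uw this] have b: "b = 0" by simp
  have a: "a \<noteq> 0"
  proof
    assume a: "a = 0"
    have "T v = 0" for v
    proof -
      obtain c d where v: "v = cscale c u + cscale d w" by (rule unitary_pair_spans[OF uw])
      show ?thesis by (simp add: v linT Tcs Tu Tw a b cscale_algebra)
    qed
    from this[of "pt 0 0 0 1"] have "x = x$3 *\<^sub>R e" by (simp add: T_def br pt_eq_iff e_def x4)
    with x_ne show False by blast
  qed
  obtain s t where st: "dbar_bracket w w = cscale s u + cscale t w" by (rule unitary_pair_spans[OF uw])
  have "dbar_bracket u w = cscale (\<i> * (a * of_real (1 / (2 * \<rho>)))) u"
    unfolding central_dbar_bracket(3)[OF central \<rho>]
    using Tw by (simp add: T_def x_def b cscale_algebra lin_simps del: of_real_divide)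
  then have "triangular_frame u w 0 (\<i> * (a * of_real (1 / (2 * \<rho>)))) 0 s t"
    unfolding triangular_frame_def using uw st central_dbar_bracket(1,2)[OF central \<rho>] by (simp add: cscale_algebra)
  moreover have "\<i> * (a * complex_of_real (1 / (2 * \<rho>))) \<noteq> 0" using a \<rho> by simp
  ultimately show ?thesis by blast
qed

text \<open>
  Write \<open>T = ad e\<^sub>4\<close>.  Where both \<open>p\<close> and \<open>J p\<close> lie in the abelian ideal \<open>\<langle>e\<^sub>1, e\<^sub>2, e\<^sub>3\<rangle>\<close>, integrability forces
  \<open>T\<close> and \<open>J\<close> to commute.  As \<open>T\<close> acts by \<open>-2\<alpha>\<close> on \<open>e\<^sub>3\<close>, the operator \<open>T + 2\<alpha>\<close> maps \<open>p\<close> and \<open>J p\<close> into the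
  plane \<open>\<langle>e\<^sub>1, e\<^sub>2\<rangle>\<close>, which is therefore a complex line on which \<open>T\<close> is multiplication by some \<open>\<gamma>\<close>; its trace
  gives \<open>Re \<gamma> = \<alpha>\<close>.  Modulo this line \<open>T\<close> is the scalar \<open>-2\<alpha>\<close> on \<open>e\<^sub>3\<close>, of the opposite sign, whence
  \<open>cnj t \<cdot> \<kappa> = -(\<alpha> |a|\<^sup>2 / 2) \<gamma>\<close> where the \<open>e\<^sub>4\<close>-components of \<open>w\<close> and \<open>J w\<close>
  are the real and imaginary parts of \<open>a\<close>.
\<close>

lemma sol0_frame:
  assumes G: "G = sol0 \<alpha> \<beta>" and \<alpha>: "\<alpha> \<noteq> 0"
  shows "\<exists>u w \<kappa> s t. triangular_frame u w \<kappa> 0 0 s t \<and> Re (cnj t * \<kappa>) < 0"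
proof -
  define T where "T v = pt (\<alpha> * v$1 - \<beta> * v$2) (\<beta> * v$1 + \<alpha> * v$2) (- 2 * \<alpha> * v$3) 0" for v :: "real^4"
  have br: "br u v = u$4 *\<^sub>R T v - v$4 *\<^sub>R T u" for u v
    by (simp add: G bracket_sol0 T_def pt_eq_iff algebra_simps)
  have linT: "T (v + v') = T v + T v'" "T (r *\<^sub>R v) = r *\<^sub>R T v" for v v' r
    by (simp_all add: T_def pt_eq_iff algebra_simps)
  have T4: "T v $ 4 = 0" for v by (simp add: T_def)
  have TI: "T (I p) = I (T p)" if p: "p$4 = 0" "(I p)$4 = 0" for p
  proof -
    define e y where "e = pt 0 0 0 1" and "y = (I e)$4"
    define K where "K = T (I p) - I (T p)"
    have Te: "T e = 0" "e$4 = 1" by (simp_all add: T_def e_def pt_eq_iff)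
    have "- y *\<^sub>R (T p + I (T (I p))) = K"
      using nijenhuis[of p e] p by (simp add: br Te y_def[symmetric] lin_simps K_def algebra_simps)
    moreover have IK: "T p + I (T (I p)) = I K" by (simp add: K_def lin_simps)
    ultimately have K: "K = - y *\<^sub>R I K" by simp
    show ?thesis
    proof (cases "K = 0")
      case False
      have "I K = y *\<^sub>R K" using arg_cong[OF K, of I] by (simp add: lin_simps)
      with I_neq[OF False] show ?thesis by blast
    qed (simp add: K_def)
  qed
  \<comment> \<open>The functional v \<mapsto> (J v)_4 vanishes on a nonzero vector of the plane of e_1 and e_2.\<close>
  obtain p where p: "p \<noteq> 0" "p$3 = 0" "p$4 = 0" "(I p)$4 = 0"
  proof -
    define a b where "a = (I (pt 1 0 0 0))$4" and "b = (I (pt 0 1 0 0))$4"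
    show ?thesis
    proof (cases "a = 0")
      case True
      show ?thesis by (rule that[of "pt 1 0 0 0"]) (use True in \<open>simp_all add: a_def pt_eq_iff\<close>)
    next
      case False
      have "pt b (- a) 0 0 = b *\<^sub>R pt 1 0 0 0 + (- a) *\<^sub>R pt 0 1 0 0" by (simp add: pt_eq_iff)
      then have "I (pt b (- a) 0 0) = b *\<^sub>R I (pt 1 0 0 0) + (- a) *\<^sub>R I (pt 0 1 0 0)"
        by (simp only: lin_simps)
      then have "(I (pt b (- a) 0 0))$4 = 0" by (simp add: a_def b_def)
      then show ?thesis by (intro that[of "pt b (- a) 0 0"]) (use False in \<open>simp_all add: pt_eq_iff\<close>)
    qed
  qed
  define e where "e = T p + (2 * \<alpha>) *\<^sub>R p"
  have Ie: "I e = T (I p) + (2 * \<alpha>) *\<^sub>R I p"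
    by (simp add: e_def lin_simps TI[OF p(3,4)])
  have plane: "e$3 = 0" "e$4 = 0" "(I e)$3 = 0" "(I e)$4 = 0"
    unfolding Ie by (simp_all add: e_def T_def p)
  have e: "e \<noteq> 0"
  proof
    assume "e = 0"
    then have "3 * \<alpha> * p$1 = \<beta> * p$2" "3 * \<alpha> * p$2 = - \<beta> * p$1"
      by (simp_all add: e_def T_def pt_eq_iff)
    then have "3 * \<alpha> * (p$1 * p$1 + p$2 * p$2) = 0" by algebra
    then have "p$1 * p$1 + p$2 * p$2 = 0" using \<alpha> by simp
    then have "p$1 = 0 \<and> p$2 = 0" by (simp add: sum_squares_eq_zero_iff)
    with p show False by (simp add: pt_eq_iff)
  qed
  obtain u w \<rho> where uw: "unitary_pair u w" and \<rho>: "\<rho> > 0" "e = \<rho> *\<^sub>R u"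
    by (rule unitary_pair_extending[OF e])
  have u: "u = (1 / \<rho>) *\<^sub>R e" using \<rho> by simp
  have Pu: "u$3 = 0" "u$4 = 0" "(I u)$3 = 0" "(I u)$4 = 0"
    unfolding u by (simp_all add: plane lin_simps)
  have u_ne: "u \<noteq> 0" using e \<rho> by auto
  define d where "d = u$1 * (I u)$2 - u$2 * (I u)$1"
  have d: "d \<noteq> 0"
  proof
    assume "d = 0"
    then have d0: "u$1 * (I u)$2 = u$2 * (I u)$1" by (simp add: d_def)
    show False
    proof (cases "u$1 = 0")
      case True
      then have "u$2 \<noteq> 0" using u_ne Pu by (auto simp: pt_eq_iff)
      then have "I u = ((I u)$2 / u$2) *\<^sub>R u" using d0 True Pu by (simp add: pt_eq_iff)
      with I_neq[OF u_ne] show False by blast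
    next
      case False
      then have "I u = ((I u)$1 / u$1) *\<^sub>R u" using d0 Pu by (simp add: pt_eq_iff field_simps)
      with I_neq[OF u_ne] show False by blast
    qed
  qed
  have in_plane: "\<exists>c. q = cscale c u" if "q$3 = 0" "q$4 = 0" for q
  proof
    show "q = cscale (Complex ((q$1 * (I u)$2 - q$2 * (I u)$1) / d) ((u$1 * q$2 - u$2 * q$1) / d)) u"
      using d that Pu by (simp add: cscale_def pt_eq_iff field_simps) (simp add: d_def algebra_simps)
  qed
  have "\<exists>\<gamma>. T u = cscale \<gamma> u" by (rule in_plane) (simp_all add: T_def Pu)
  then obtain \<gamma> where \<gamma>: "T u = cscale \<gamma> u" by blast
  have TIu: "T (I u) = cscale \<gamma> (I u)" by (simp add: TI[OF Pu(2,4)] \<gamma> cscale_algebra)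
  \<comment> \<open>det (T u, J u) + det (u, T J u) is d times the trace of T on the plane.\<close>
  have Re_\<gamma>: "Re \<gamma> = \<alpha>"
  proof -
    have "T u $ 1 * (I u)$2 - T u $ 2 * (I u)$1 + u$1 * T (I u) $ 2 - u$2 * T (I u) $ 1 = 2 * \<alpha> * d"
      by (simp add: T_def d_def algebra_simps)
    moreover have "T u $ 1 * (I u)$2 - T u $ 2 * (I u)$1 + u$1 * T (I u) $ 2 - u$2 * T (I u) $ 1 = 2 * Re \<gamma> * d"
      unfolding \<gamma> TIu by (simp add: cscale_def lin_simps d_def algebra_simps)
    ultimately show ?thesis using d by simp
  qed
  define a where "a = Complex (w$4) ((I w)$4)"
  have a: "a \<noteq> 0"
  proof
    assume "a = 0"
    then have w: "w$4 = 0" "(I w)$4 = 0" by (simp_all add: a_def complex_eq_iff)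
    obtain c c' where "pt 0 0 0 1 = cscale c u + cscale c' w" by (rule unitary_pair_spans[OF uw])
    then have "pt 0 0 0 1 $ 4 = (cscale c u + cscale c' w) $ 4" by simp
    then show False by (simp add: cscale_def Pu w)
  qed
  have uu: "dbar_bracket u u = 0" by (simp add: dbar_bracket_def br Pu lin_simps)
  have cmuw: "dbar_bracket u w = 0"
    by (simp add: dbar_bracket_def br Pu TI[OF Pu(2,4)] lin_simps)
  have cmwu: "dbar_bracket w u = cscale (a * \<gamma> / 2) u"
  proof -
    have "cscale (a * \<gamma> / 2) u = (1/2) *\<^sub>R cscale (a * \<gamma>) u"
      using cscale_algebra(4)[of "of_real (1/2)" "a * \<gamma>" u] by (simp add: cscale_algebra(9) mult.commute del: of_real_divide)
        (simp add: cscale_def)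
    moreover have "cscale (a * \<gamma>) u = w$4 *\<^sub>R T u + (I w)$4 *\<^sub>R I (T u)"
      unfolding cscale_algebra(4) \<gamma>[symmetric] by (simp add: cscale_def a_def)
    ultimately show ?thesis by (simp add: dbar_bracket_def br Pu lin_simps)
  qed
  \<comment> \<open>The subtracted term has the same e_3- and e_4-components as the bracket.\<close>
  obtain \<sigma> where \<sigma>: "br (I w) w - (2 * \<alpha>) *\<^sub>R (w$4 *\<^sub>R I w - (I w)$4 *\<^sub>R w) = cscale \<sigma> u"
    using in_plane[of "br (I w) w - (2 * \<alpha>) *\<^sub>R (w$4 *\<^sub>R I w - (I w)$4 *\<^sub>R w)"]
    by (auto simp: br T_def algebra_simps)
  have ww: "br w w = 0" by (rule bracket_self)
  have cmww: "dbar_bracket w w = cscale (\<i> * \<sigma> / 2) u + cscale (- of_real \<alpha> * a) w"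
  proof -
    have "br (I w) w = cscale \<sigma> u + (2 * \<alpha>) *\<^sub>R (w$4 *\<^sub>R I w - (I w)$4 *\<^sub>R w)"
      using \<sigma> by (simp add: algebra_simps)
    then show ?thesis
      by (simp add: dbar_bracket_def ww lin_simps) (simp add: cscale_def a_def lin_simps algebra_simps)
  qed
  have "triangular_frame u w (a * \<gamma> / 2) 0 0 (\<i> * \<sigma> / 2) (- of_real \<alpha> * a)"
    using uw uu cmuw cmwu cmww by (simp add: triangular_frame_def cscale_algebra)
  moreover have "Re (cnj (- of_real \<alpha> * a) * (a * \<gamma> / 2)) < 0"
  proof -
    have "cnj (- of_real \<alpha> * a) * (a * \<gamma> / 2) = of_real (- \<alpha> * (cmod a)\<^sup>2 / 2) * \<gamma>"
      using complex_norm_square[of a] by (simp add: algebra_simps)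
    then have "Re (cnj (- of_real \<alpha> * a) * (a * \<gamma> / 2)) = - \<alpha> * (cmod a)\<^sup>2 / 2 * \<alpha>"
      by (simp only: Re_complex_of_real Re_\<gamma> times_complex.simps Im_complex_of_real)
    also have "\<dots> = - ((\<alpha> * cmod a)\<^sup>2 / 2)" by (simp add: power2_eq_square)
    also have "\<dots> < 0" using \<alpha> a by simp
    finally show ?thesis .
  qed
  ultimately show ?thesis by blast
qed

text \<open>
  Let \<open>x = J e\<^sub>3\<close> and \<open>T = ad x\<close>.  If \<open>x\<^sub>4 = 0\<close>, then \<open>e\<^sub>3\<close> is in the image of \<open>T\<close> and its image under \<open>J\<close> would
  have to be as well, which the coordinates exclude.  So \<open>T\<close> is \<open>x\<^sub>4\<close> times a rotation on its two-dimensional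
  image, where the commuting \<open>J\<close> is the rotation up to sign, and its kernel is the complex line of \<open>e\<^sub>3\<close>.
  Hence \<open>T w = \<mu> J w + \<nu> e\<^sub>3\<close> with real \<open>\<mu> \<noteq> 0\<close> and complex \<open>\<nu>\<close>.  Solving this for \<open>w\<close> and \<open>J w\<close> expresses
  \<open>[J w, w]\<close>, and with it all structure constants, by \<open>\<mu>\<close>, \<open>\<nu>\<close> and the bracket of the image plane; the latter
  is a nonzero multiple of \<open>e\<^sub>3\<close> and contributes the nonzero imaginary part of \<open>s\<close>.
\<close>

lemma nil3_rot_frame:
  assumes G: "G = nil3_rot"
  shows "\<exists>u w n m s t. triangular_frame u w 0 n m s t \<and> s \<noteq> 0 \<and>
     n * cnj m + m * cnj t = 0 \<and> Re (cnj s * m) + (cmod t)\<^sup>2 = 0"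
proof -
  define e where "e = pt 0 0 1 0"
  have br: "br u v = pt (u$2 * v$4 - u$4 * v$2) (u$4 * v$1 - u$1 * v$4) (u$1 * v$2 - u$2 * v$1) 0" for u v
    by (simp add: G bracket_nil3_rot)
  have e: "e \<noteq> 0" by (simp add: e_def pt_eq_iff)
  have central: "br e v = 0" for v unfolding br by (simp add: e_def pt_eq_iff)
  obtain u w \<rho> where uw: "unitary_pair u w" and \<rho>: "\<rho> > 0" "e = \<rho> *\<^sub>R u"
    by (rule unitary_pair_extending[OF e])
  define x where "x = I e"
  define T where "T v = br x v" for v
  have Tpt: "T v = pt (x$2 * v$4 - x$4 * v$2) (x$4 * v$1 - x$1 * v$4) (x$1 * v$2 - x$2 * v$1) 0" for v
    by (simp add: T_def br)
  have TI: "T (I v) = I (T v)" for v unfolding T_def x_def by (rule central_commutes[OF central])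
  have linT: "T (v + v') = T v + T v'" "T (r *\<^sub>R v) = r *\<^sub>R T v" "T (v - v') = T v - T v'" "T (- v) = - T v" for v v' r
    by (simp_all add: T_def lin_simps)
  have x_ne: "x \<noteq> r *\<^sub>R e" for r unfolding x_def by (rule I_neq[OF e])
  have x4: "x$4 \<noteq> 0"
  proof
    assume x4: "x$4 = 0"
    define N where "N = x$1 * x$1 + x$2 * x$2"
    have N: "N \<noteq> 0"
    proof
      assume "N = 0"
      then have "x$1 = 0" "x$2 = 0" by (simp_all add: N_def sum_squares_eq_zero_iff)
      then have "x = x$3 *\<^sub>R e" by (simp add: pt_eq_iff e_def x4)
      with x_ne show False by blast
    qed
    define p where "p = pt (- x$2) (x$1) 0 0"
    have "T p = N *\<^sub>R e" by (simp add: Tpt p_def e_def N_def x4 pt_eq_iff)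
    then have "T (I p) = N *\<^sub>R x" by (simp add: TI lin_simps x_def)
    then have "x$2 * (I p)$4 = N * x$1" "- (x$1 * (I p)$4) = N * x$2"
      by (simp_all add: Tpt x4 pt_eq_iff)
    then have "N * N = 0" unfolding N_def by algebra
    with N show False by simp
  qed
  define a b where "a = T (pt 1 0 0 0)" and "b = T (pt 0 1 0 0)"
  have image: "T v = (v$1 - x$1 / x$4 * v$4) *\<^sub>R a + (v$2 - x$2 / x$4 * v$4) *\<^sub>R b" for v
    using x4 by (simp add: a_def b_def Tpt pt_eq_iff field_simps)
  have Ta: "T a = x$4 *\<^sub>R b" and Tb: "T b = - x$4 *\<^sub>R a"
    by (simp_all add: a_def b_def Tpt pt_eq_iff)
  \<comment> \<open>On the image of T, the operator T / x_4 is a rotation taking a to b, and I commutes with it.\<close>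
  obtain q where q: "q * q = 1" and Ia: "I a = q *\<^sub>R b" and Ib: "I b = - q *\<^sub>R a"
  proof -
    obtain p q where Ia: "I a = p *\<^sub>R a + q *\<^sub>R b"
      using image[of "I (pt 1 0 0 0)"] by (auto simp: a_def TI)
    have "x$4 *\<^sub>R I b = T (I a)" by (simp add: TI Ta lin_simps)
    also have "\<dots> = x$4 *\<^sub>R (p *\<^sub>R b - q *\<^sub>R a)" by (simp add: Ia linT Ta Tb algebra_simps)
    finally have Ib: "I b = p *\<^sub>R b - q *\<^sub>R a" using x4 by simp
    have "- a = I (I a)" by (simp only: J_J)
    also have "\<dots> = p *\<^sub>R I a + q *\<^sub>R I b" by (subst Ia) (simp only: lin_simps)
    also have "\<dots> = (p * p - q * q) *\<^sub>R a + (2 * p * q) *\<^sub>R b"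
      unfolding Ia Ib by (simp add: vec_eq_iff algebra_simps)
    finally have eq: "- a = (p * p - q * q) *\<^sub>R a + (2 * p * q) *\<^sub>R b" .
    have ab: "a$1 = 0" "a$2 = x$4" "b$1 = - (x$4)" "b$2 = 0"
      by (simp_all add: a_def b_def Tpt)
    have 2: "p * q = 0" using arg_cong[OF eq, of "\<lambda>v. v$1"] x4 by (simp add: ab)
    have eigen: "- (x$4) = (p * p - q * q) * x$4"
      using arg_cong[OF eq, of "\<lambda>v. v$2"]
      by (simp only: vector_uminus_component vector_add_component vector_scaleR_component ab) simp
    have "(p * p - q * q + 1) * x$4 = (p * p - q * q) * x$4 + x$4" by (simp only: distrib_right mult_1)
    also have "\<dots> = 0" using eigen by linarith
    finally have "p * p - q * q + 1 = 0" using x4 by (simp only: mult_eq_0_iff) simp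
    then have 1: "p * p - q * q = -1" by linarith
    have "q \<noteq> 0" 
    proof
      assume "q = 0"
      with 1 have "p * p = -1" by simp
      with zero_le_square[of p] show False by linarith
    qed
    then have "p = 0" using 2 by simp
    then show ?thesis using 1 Ia Ib by (intro that[of q]) simp_all
  qed
  define \<mu> where "\<mu> = x$4 * q"
  have \<mu>: "\<mu> \<noteq> 0" using x4 q by (auto simp: \<mu>_def)
  have TT: "T (T v) = \<mu> *\<^sub>R I (T v)" for v
  proof -
    have "T (T v) = (v$1 - x$1 / x$4 * v$4) *\<^sub>R T a + (v$2 - x$2 / x$4 * v$4) *\<^sub>R T b"
      by (subst (2) image) (simp add: linT)
    moreover have "\<mu> *\<^sub>R I (T v) = (v$1 - x$1 / x$4 * v$4) *\<^sub>R \<mu> *\<^sub>R I a + (v$2 - x$2 / x$4 * v$4) *\<^sub>R \<mu> *\<^sub>R I b"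
      by (subst image) (simp add: lin_simps algebra_simps)
    moreover have "\<mu> *\<^sub>R I a = T a" "\<mu> *\<^sub>R I b = T b"
      using q by (simp_all add: Ia Ib Ta Tb \<mu>_def mult.assoc)
    ultimately show ?thesis by simp
  qed
  have e_components: "e$1 = 0" "e$2 = 0" "e$3 = 1" "e$4 = 0" by (simp_all add: e_def)
  have kernel: "\<exists>\<nu>. v = cscale \<nu> e" if "T v = 0" for v
  proof
    have "v$1 = v$4 / x$4 * x$1" "v$2 = v$4 / x$4 * x$2"
      using that x4 by (simp_all add: Tpt pt_eq_iff field_simps)
    then show "v = cscale (Complex (v$3 - v$4 / x$4 * x$3) (v$4 / x$4)) e"
      using x4 by (simp add: cscale_def x_def[symmetric] pt_eq_iff e_components)
  qed
  have "T (T w - \<mu> *\<^sub>R I w) = 0" by (simp add: linT TT TI)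
  from kernel[OF this] obtain \<nu> where "T w - \<mu> *\<^sub>R I w = cscale \<nu> e" by blast
  then have Tw: "T w = \<mu> *\<^sub>R I w + cscale \<nu> e" by (simp add: algebra_simps)
  \<comment> \<open>The e_3-component of the bracket of T w with its rotated image, normalized by powers of mu.\<close>
  define \<delta> where "\<delta> = x$4 * ((T w $ 1)\<^sup>2 + (T w $ 2)\<^sup>2) / (\<mu> * \<mu> * \<mu>)"
  have \<delta>: "\<delta> \<noteq> 0"
  proof
    assume "\<delta> = 0"
    then have "(T w $ 1)\<^sup>2 + (T w $ 2)\<^sup>2 = 0" using \<mu> x4 by (simp add: \<delta>_def)
    then have 0: "T w $ 1 = 0" "T w $ 2 = 0" by (simp_all add: sum_power2_eq_zero_iff)
    then have "T (T w) = 0" by (simp add: Tpt[of "T w"]) (simp add: Tpt pt_eq_iff)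
    then have "I (T w) = 0" using TT[of w] \<mu> by simp
    then have "I (I (T w)) = 0" by (simp add: lin_simps)
    then have "T w = 0" by (simp add: J_J)
    from kernel[OF this] obtain c where "w = cscale c e" by blast
    then have "cscale (- (c * of_real \<rho>)) u + cscale 1 w = 0" by (simp add: \<rho>(2) cscale_def lin_simps)
    from unitary_pair_independent(2)[OF uw this] show False by simp
  qed
  have br_cscale_e: "br (cscale c e) v = Im c *\<^sub>R T v" for c v
    by (simp add: cscale_def lin_simps central T_def x_def)
  have brTTT: "br (T w) (T (T w)) = (\<delta> * (\<mu> * \<mu> * \<mu>)) *\<^sub>R e"
    using \<mu> by (simp add: br Tpt[of "T w"] \<delta>_def e_def pt_eq_iff) (simp add: Tpt power2_eq_square algebra_simps)
  define l k where "l = Re \<nu>" and "k = Im \<nu>"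
  have cscale_\<nu>: "cscale \<nu> e = (l * \<rho>) *\<^sub>R u + (k * \<rho>) *\<^sub>R I u"
    "cscale (\<i> * \<nu>) e = (l * \<rho>) *\<^sub>R I u - (k * \<rho>) *\<^sub>R u"
    by (simp_all add: cscale_def l_def k_def \<rho>(2) lin_simps)
  have TTw: "T (T w) = \<mu> *\<^sub>R cscale (\<i> * \<nu>) e - (\<mu> * \<mu>) *\<^sub>R w"
  proof -
    have "I (T w) = cscale (\<i> * \<nu>) e - \<mu> *\<^sub>R w"
      unfolding Tw cscale_\<nu> by (simp add: lin_simps algebra_simps)
    note ITw = this
    show ?thesis unfolding TT ITw by (simp add: algebra_simps)
  qed
  have brTw: "br (T w) w = - (l / \<mu>) *\<^sub>R T (T w) - (\<delta> * \<mu>) *\<^sub>R e"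
  proof -
    have "w = (1 / \<mu>) *\<^sub>R cscale (\<i> * \<nu>) e - (1 / (\<mu> * \<mu>)) *\<^sub>R T (T w)"
      unfolding TTw using \<mu> by (simp add: algebra_simps)
    then have "br (T w) w = br (T w) ((1 / \<mu>) *\<^sub>R cscale (\<i> * \<nu>) e - (1 / (\<mu> * \<mu>)) *\<^sub>R T (T w))"
      by (rule arg_cong)
    also have "\<dots> = - (1 / \<mu>) *\<^sub>R br (cscale (\<i> * \<nu>) e) (T w) - (1 / (\<mu> * \<mu>)) *\<^sub>R br (T w) (T (T w))"
      using bracket_antisym[of "cscale (\<i> * \<nu>) e" "T w"] by (simp add: lin_simps)
    also have "\<dots> = - (l / \<mu>) *\<^sub>R T (T w) - (\<delta> * \<mu>) *\<^sub>R e"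
      unfolding br_cscale_e brTTT using \<mu> by (simp add: l_def)
    finally show ?thesis .
  qed
  have brIw: "br (I w) w = - (l / (\<mu> * \<mu>)) *\<^sub>R T (T w) - \<delta> *\<^sub>R e - (k / \<mu>) *\<^sub>R T w"
  proof -
    have "I w = (1 / \<mu>) *\<^sub>R (T w - cscale \<nu> e)" unfolding Tw using \<mu> by simp
    then have "br (I w) w = (1 / \<mu>) *\<^sub>R (br (T w) w - k *\<^sub>R T w)"
      by (simp add: lin_simps br_cscale_e k_def)
    then show ?thesis unfolding brTw using \<mu> by (simp add: algebra_simps)
  qed
  define n m s t where "n = Complex (- k / 2) (l / 2)" and "m = complex_of_real (- \<mu> / (2 * \<rho>))"
    and "s = Complex (\<rho> * (l * l + k * k) / (2 * \<mu>)) (- \<rho> * \<delta> / 2)" and "t = Complex (k / 2) (l / 2)"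
  have Ie: "I e = \<rho> *\<^sub>R I u" by (simp add: \<rho>(2) lin_simps)
  have "dbar_bracket u w = cscale n u + cscale m w"
    unfolding central_dbar_bracket(3)[OF central \<rho>] x_def[symmetric] T_def[symmetric] Tw cscale_\<nu>
    using \<rho>(1) by (simp add: cscale_def n_def m_def lin_simps algebra_simps)
  moreover have "dbar_bracket w w = cscale s u + cscale t w"
    unfolding central_dbar_bracket(4)[OF central \<rho>] brIw TTw unfolding Tw cscale_\<nu>
    using \<rho>(1) \<mu> by (simp add: cscale_def s_def t_def lin_simps Ie vec_eq_iff) (simp add: field_simps)
  ultimately have "triangular_frame u w 0 n m s t"
    using uw central_dbar_bracket(1,2)[OF central \<rho>] by (simp add: triangular_frame_def cscale_algebra)
  moreover have "s \<noteq> 0" using \<delta> \<rho>(1) by (simp add: s_def complex_eq_iff)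
  moreover have "n * cnj m + m * cnj t = 0"
    by (simp add: n_def m_def t_def complex_eq_iff)
  moreover have "Re (cnj s * m) + (cmod t)\<^sup>2 = 0"
    using \<mu> \<rho>(1) by (simp add: s_def m_def t_def cmod_power2 field_simps) (simp add: power2_eq_square field_simps)
  ultimately show ?thesis by blast
qed

end

section \<open>Existence of invariant metrics\<close>

lemma (in affine_group) linear_part_inverse_mult: "E (inv (a \<otimes> x)) (E a v) = E (inv x) v"
  using inv_mult_group[of a x] by (simp add: carrier_UNIV linear_part_mult linear_part_inverse)

text \<open>
  Averaging the standard inner product over \<open>J 0\<close> makes it Hermitian, and left translation spreads it.
\<close>

lemma (in invariant_complex_group) invariant_metric_exists:
  assumes smooth_inverse: "\<And>v. smooth_on UNIV (\<lambda>x. E (inv x) v)"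
    and D: "D \<subseteq> left_translations G"
  shows "\<exists>g. invariant_hermitian_metric G D J g"
proof -
  define q where "q u v = u \<bullet> v + I u \<bullet> I v" for u v
  define g where "g x u v = q (E (inv x) u) (E (inv x) v)" for x u v
  have EJ: "E (inv x) (J x u) = I (E (inv x) u)" for x u
  proof -
    have "J x (E x (E (inv x) u)) = E x (I (E (inv x) u))" by (rule invariant_endo_at[OF J_invariant])
    from arg_cong[OF this, of "E (inv x)"] show ?thesis
      by (simp add: linear_part_inverse linear_part_inverse')
  qed
  note E_lin = linear_add[OF linear_linear_part] linear_cmul[OF linear_linear_part]
  have bil: "bilinear (g x)" for x
    unfolding bilinear_def g_def q_def
    by (auto intro!: linearI simp: E_lin lin_simps inner_simps algebra_simps)
  have inv: "metric_invariant (left_translations G) g"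
    unfolding metric_invariant_def
    by (auto simp: left_translations_def g_def tangent_map_left_translation linear_part_inverse_mult)
  have pos: "g x u u > 0" if "u \<noteq> 0" for x u
  proof -
    have "E (inv x) u \<noteq> 0"
      using that linear_part_inverse'[of x u] linear_0[OF linear_linear_part] by metis
    then show ?thesis by (simp add: g_def q_def add_pos_nonneg)
  qed
  have smooth: "smooth_on UNIV (\<lambda>x. g x u v)" for u v
    unfolding g_def q_def
    by (intro smooth_on_add[OF open_UNIV] smooth_on_bilinear[OF open_UNIV bounded_bilinear_inner]
        smooth_on_bounded_linear[OF open_UNIV linear_J[unfolded linear_conv_bounded_linear]] smooth_inverse)
  have "hermitian_metric D J g"
    unfolding hermitian_metric_def
  proof (intro conjI allI impI)
    show "g x u v = g x v u" for x u v by (simp add: g_def q_def inner_commute)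
    show "g x (J x u) (J x v) = g x u v" for x u v by (simp add: g_def EJ q_def lin_simps)
    show "metric_invariant D g" using inv D by (auto simp: metric_invariant_def)
  qed (fact bil pos smooth)+
  with inv show ?thesis by (auto simp: invariant_hermitian_metric_def)
qed

lemma smooth_inverse_nil3_R: "smooth_on UNIV (\<lambda>x. linear_part nil3_R (inv\<^bsub>nil3_R\<^esub> x) v)"
proof -
  interpret affine_group nil3_R by (rule affine_group_nil3_R)
  have "inv\<^bsub>nil3_R\<^esub> x = - x" for x
    by (rule inv_equality) (auto simp: nil3_R_def pt_eq_iff)
  then show ?thesis by (simp only: linear_part_nil3_R vector_uminus_component) (intro smooth_intros)
qed

lemma smooth_inverse_nil3_rot: "smooth_on UNIV (\<lambda>x. linear_part nil3_rot (inv\<^bsub>nil3_rot\<^esub> x) v)"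
proof -
  interpret affine_group nil3_rot by (rule affine_group_nil3_rot)
  have "inv\<^bsub>nil3_rot\<^esub> x = pt (- (cos (x$4) * x$1 + sin (x$4) * x$2))
      (sin (x$4) * x$1 - cos (x$4) * x$2) (- x$3) (- x$4)" for x
    by (rule inv_equality) (auto simp: nil3_rot_def pt_eq_iff Let_def algebra_simps)
  then show ?thesis by (simp only: linear_part_nil3_rot pt_nth) (intro smooth_intros)
qed

text \<open>
  The two equations are those of flatness; they also reduce the obstruction to the Einstein equation to
  \<open>|n|\<^sup>2 + |s|\<^sup>2\<close>.
\<close>

lemma kodaira_frame:
  assumes "invariant_hermitian_group G J g D" and "G = nil3_R \<or> G = nil3_rot"
  shows "\<exists>u w n m s t. invariant_hermitian_group.triangular_frame G J g u w 0 n m s t \<and> s \<noteq> 0 \<and>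
     n * cnj m + m * cnj t = 0 \<and> Re (cnj s * m) + (cmod t)\<^sup>2 = 0"
proof -
  interpret invariant_hermitian_group G J g D by (rule assms(1))
  from assms(2) show ?thesis
  proof
    assume "G = nil3_R"
    from nil3_R_frame[OF this] obtain u w s where
      "triangular_frame u w 0 0 0 s 0" "s \<noteq> 0" by blast
    then show ?thesis by (intro exI[of _ u] exI[of _ w] exI[of _ "0::complex"] exI[of _ s]) simp
  qed (rule nil3_rot_frame)
qed

theorem theorem4:
  fixes G :: "(real^4) monoid" and D :: "(real^4 \<Rightarrow> real^4) set" and J :: endo_field
  shows "(inoue_surface G D J \<or> kodaira_surface G D J \<longrightarrow>
            \<not> (\<exists>g. invariant_hermitian_metric G D J g \<and> second_chern_einstein D J g)) \<and>
         (kodaira_surface G D J \<longrightarrow>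
            (\<exists>g. hermitian_metric D J g \<and> first_chern_ricci_flat J g))"
proof -
  have group_with_metric: "invariant_hermitian_group G J g D"
    if "affine_group G" "invariant_complex_structure G D J" "invariant_hermitian_metric G D J g" for g
    using that by (simp add: invariant_hermitian_group_def invariant_hermitian_group_axioms_def
        invariant_complex_group_def invariant_complex_group_axioms_def
        invariant_complex_structure_def invariant_hermitian_metric_def)
  show ?thesis
  proof (intro conjI impI notI)
    assume surface: "inoue_surface G D J \<or> kodaira_surface G D J"
      and "\<exists>g. invariant_hermitian_metric G D J g \<and> second_chern_einstein D J g"
    then obtain g where g: "invariant_hermitian_metric G D J g" and einstein: "second_chern_einstein D J g"
      by blast
    have J: "invariant_complex_structure G D J"
      using surface by (auto simp: inoue_surface_def inoue_surface_SM_def inoue_surface_S_plus_def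
          inoue_surface_S_minus_def kodaira_surface_def)
    consider (sol0) \<alpha> \<beta> where "\<alpha> \<noteq> 0" "G = sol0 \<alpha> \<beta>" | (sol1) "G = sol1"
      | (nil) "G = nil3_R \<or> G = nil3_rot"
      using surface by (auto simp: inoue_surface_def inoue_surface_SM_def inoue_surface_S_plus_def
          inoue_surface_S_minus_def kodaira_surface_def)
    then show False
    proof cases
      case sol0
      interpret invariant_hermitian_group G J g D
        by (rule group_with_metric[OF _ J g]) (simp add: sol0 affine_group_sol0)
      obtain u w \<kappa> s t where tri: "triangular_frame u w \<kappa> 0 0 s t" and neg: "Re (cnj t * \<kappa>) < 0"
        using sol0_frame[OF sol0(2,1)] by blast
      have "Re (cnj t * \<kappa>) < (cmod s)\<^sup>2 + (cmod t)\<^sup>2"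
        using neg by (rule less_le_trans) simp
      with not_second_chern_einstein[OF tri] einstein show False by simp
    next
      case sol1
      interpret invariant_hermitian_group G J g D
        by (rule group_with_metric[OF _ J g]) (simp add: sol1 affine_group_sol1)
      obtain u w n s t where tri: "triangular_frame u w 0 n 0 s t" and n: "n \<noteq> 0"
        using sol1_frame[OF sol1] by blast
      have "(cmod n)\<^sup>2 + (cmod s)\<^sup>2 + (cmod t)\<^sup>2 + Re (cnj s * 0) - Re (cnj t * 0) > 0"
        using n by (simp add: add_pos_nonneg)
      with not_second_chern_einstein[OF tri] einstein show False by simp
    next
      case nil
      have aff: "affine_group G" using nil affine_group_nil3_R affine_group_nil3_rot by auto
      interpret invariant_hermitian_group G J g D
        by (rule group_with_metric[OF aff J g])
      obtain u w n m s t where tri: "triangular_frame u w 0 n m s t" and s: "s \<noteq> 0"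
        and eq: "Re (cnj s * m) + (cmod t)\<^sup>2 = 0"
        using kodaira_frame[OF invariant_hermitian_group_axioms nil] by blast
      have "(cmod n)\<^sup>2 + (cmod s)\<^sup>2 + (cmod t)\<^sup>2 + Re (cnj s * m) - Re (cnj t * 0) = (cmod n)\<^sup>2 + (cmod s)\<^sup>2"
        using eq by simp
      also have "\<dots> > 0" using s by (simp add: add_nonneg_pos)
      finally show False using not_second_chern_einstein[OF tri] einstein by simp
    qed
  next
    assume "kodaira_surface G D J"
    then have G: "G = nil3_R \<or> G = nil3_rot" and J: "invariant_complex_structure G D J"
      and "solvmanifold G D"
      by (auto simp: kodaira_surface_def)
    then have D: "D \<subseteq> left_translations G" by (auto simp: solvmanifold_def left_translations_def)
    have aff: "affine_group G" using G affine_group_nil3_R affine_group_nil3_rot by auto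
    have "invariant_complex_group G J"
      using aff J by (simp add: invariant_complex_group_def invariant_complex_group_axioms_def
          invariant_complex_structure_def)
    from invariant_complex_group.invariant_metric_exists[OF this _ D]
    obtain g where g: "invariant_hermitian_metric G D J g"
      using G smooth_inverse_nil3_R smooth_inverse_nil3_rot by blast
    interpret invariant_hermitian_group G J g D by (rule group_with_metric[OF aff J g])
    obtain u w n m s t where tri: "triangular_frame u w 0 n m s t"
      and eq: "n * cnj m + m * cnj t = 0" "Re (cnj s * m) + (cmod t)\<^sup>2 = 0"
      using kodaira_frame[OF invariant_hermitian_group_axioms G] by blast
    from first_chern_ricci_flat[OF tri eq] hermitian
    show "\<exists>g. hermitian_metric D J g \<and> first_chern_ricci_flat J g" by blast
  qed
qed

end
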